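(* Let $k$ be an algebraically closed field of characteristic $p>2$. Let $e_1,\dots,e_n$ be positive integers prime to $p$ and $d$ a positive integer with $\sum_{i}(e_i-1)=2d-2$. Then for a general choice of points $P_1,\dots,P_n\in\mathbb P^1$, the set of separable degree-$d$ morphisms $f:\mathbb P^1\to\mathbb P^1$ ramified to order $e_i$ at $P_i$ for every $i$, modulo automorphism of the image $\mathbb P^1$: (i) is finite; (ii) contains no element mapping any two of the points $P_i$ to the same point.
   Context: "Ramified to order $e_i$ at $P_i$" means that the ramification index (local degree) of $f$ at $P_i$ is $e_i$. "Modulo automorphism of the image" means $f$ and $\alpha\circ f$ are identified for all $\alpha\in\mathrm{Aut}(\mathbb P^1)$. "For a general choice of points" means for all $(P_1,\dots,P_n)$ in some nonempty open subset of $(\mathbb P^1)^n$ (contained in the locus of distinct points). *)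

theory Defs
  imports
    "HOL-Computational_Algebra.Computational_Algebra"
    "HOL-Library.FuncSet"
begin

subsection \<open>The projective line\<close>

definition proportional :: "'k::field \<times> 'k \<Rightarrow> 'k \<times> 'k \<Rightarrow> bool" where
  "proportional v w \<longleftrightarrow> v \<noteq> (0, 0) \<and> w \<noteq> (0, 0) \<and>
     (\<exists>c. c \<noteq> 0 \<and> fst w = c * fst v \<and> snd w = c * snd v)"

lemma part_equivp_proportional: "part_equivp (proportional :: 'k::field \<times> 'k \<Rightarrow> _)"
proof (rule part_equivpI)
  show "\<exists>v :: 'k \<times> 'k. proportional v v"
    by (intro exI[of _ "(1, 0)"]) (auto simp: proportional_def intro: exI[of _ 1])
  show "symp (proportional :: 'k \<times> 'k \<Rightarrow> _)"
  proof (rule sympI)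
    fix v w :: "'k \<times> 'k"
    assume "proportional v w"
    then obtain c where "v \<noteq> (0, 0)" "w \<noteq> (0, 0)" "c \<noteq> 0" "fst w = c * fst v" "snd w = c * snd v"
      by (auto simp: proportional_def)
    then show "proportional w v"
      unfolding proportional_def by (intro conjI exI[of _ "inverse c"]) auto
  qed
  show "transp (proportional :: 'k \<times> 'k \<Rightarrow> _)"
  proof (rule transpI)
    fix u v w :: "'k \<times> 'k"
    assume "proportional u v" "proportional v w"
    then obtain b c where "u \<noteq> (0, 0)" "w \<noteq> (0, 0)"
        "b \<noteq> 0" "fst v = b * fst u" "snd v = b * snd u"
        "c \<noteq> 0" "fst w = c * fst v" "snd w = c * snd v"
      by (auto simp: proportional_def)
    then show "proportional u w"
      unfolding proportional_def by (intro conjI exI[of _ "c * b"]) auto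
  qed
qed

quotient_type (overloaded) 'k proj_line = "'k::field \<times> 'k" / partial: proportional
  by (rule part_equivp_proportional)

text \<open>The point \<open>[x : y]\<close>; only meaningful for \<open>(x, y) \<noteq> (0, 0)\<close>.\<close>

definition proj_pt :: "'k::field \<Rightarrow> 'k \<Rightarrow> 'k proj_line" where
  "proj_pt x y = abs_proj_line (x, y)"


subsection \<open>Binary forms and morphisms\<close>

text \<open>
  A binary form \<open>H(X, Y)\<close> of degree \<open>d\<close> is encoded by \<open>d\<close> together with its
  dehomogenization \<open>H(T, 1)\<close>, a univariate polynomial of degree at most \<open>d\<close>:
  the coefficient of \<open>T ^ i\<close> is the coefficient of \<open>X ^ i Y ^ (d - i)\<close>.
\<close>

definition eval_form :: "nat \<Rightarrow> 'k::field poly \<Rightarrow> 'k \<Rightarrow> 'k \<Rightarrow> 'k" where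
  "eval_form d H x y = (\<Sum>i\<le>d. coeff H i * x ^ i * y ^ (d - i))"

text \<open>\<open>f = [F : G]\<close> for binary forms \<open>F\<close>, \<open>G\<close> of degree \<open>d\<close> without common zero.\<close>

definition given_by_forms ::
    "('k::field proj_line \<Rightarrow> 'k proj_line) \<Rightarrow> nat \<Rightarrow> 'k poly \<Rightarrow> 'k poly \<Rightarrow> bool" where
  "given_by_forms f d F G \<longleftrightarrow> degree F \<le> d \<and> degree G \<le> d \<and>
     (\<forall>x y. (x, y) \<noteq> (0, 0) \<longrightarrow>
        (eval_form d F x y, eval_form d G x y) \<noteq> (0, 0) \<and>
        f (proj_pt x y) = proj_pt (eval_form d F x y) (eval_form d G x y))"

text \<open>
  Over an algebraically closed field a morphism \<open>P\<^sup>1 \<rightarrow> P\<^sup>1\<close> is determined by its map on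
  closed points, and its degree is the degree of the pullback of \<open>O(1)\<close>.
\<close>

definition morphism_of_degree :: "nat \<Rightarrow> ('k::field proj_line \<Rightarrow> 'k proj_line) \<Rightarrow> bool" where
  "morphism_of_degree d f \<longleftrightarrow> (\<exists>F G. given_by_forms f d F G)"

definition is_morphism :: "('k::field proj_line \<Rightarrow> 'k proj_line) \<Rightarrow> bool" where
  "is_morphism f \<longleftrightarrow> (\<exists>d. morphism_of_degree d f)"

definition proj_line_Aut :: "('k::field proj_line \<Rightarrow> 'k proj_line) set" where
  "proj_line_Aut = {\<alpha>. is_morphism \<alpha> \<and> (\<exists>\<beta>. is_morphism \<beta> \<and> \<alpha> \<circ> \<beta> = id \<and> \<beta> \<circ> \<alpha> = id)}"


subsection \<open>Separability\<close>

text \<open>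
  The function field of \<open>P\<^sup>1\<close> is \<open>k(t)\<close>. If \<open>\<phi> \<in> k(t)\<close> is the image of the coordinate
  under \<open>f\<^sup>*\<close>, then the image of \<open>f\<^sup>*\<close> is the subfield \<open>k(\<phi>)\<close>.
\<close>

definition eval_const_poly :: "'k::field poly \<Rightarrow> 'k poly fract \<Rightarrow> 'k poly fract" where
  "eval_const_poly a \<phi> = poly (map_poly (\<lambda>c. Fract [:c:] 1) a) \<phi>"

definition generated_subfield :: "'k::field poly fract \<Rightarrow> 'k poly fract set" where
  "generated_subfield \<phi> =
     {eval_const_poly a \<phi> / eval_const_poly b \<phi> | a b. eval_const_poly b \<phi> \<noteq> 0}"

definition separable_over :: "'a::field set \<Rightarrow> 'a \<Rightarrow> bool" where
  "separable_over L u \<longleftrightarrow>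
     (\<exists>m. (\<forall>i. coeff m i \<in> L) \<and> coprime m (pderiv m) \<and> poly m u = 0)"

definition separable_morphism :: "('k::field proj_line \<Rightarrow> 'k proj_line) \<Rightarrow> bool" where
  "separable_morphism f \<longleftrightarrow> (\<exists>d F G. given_by_forms f d F G \<and> G \<noteq> 0 \<and>
     (\<forall>u. separable_over (generated_subfield (Fract F G)) u))"


subsection \<open>Ramification\<close>

text \<open>
  Order of vanishing at \<open>[x : y]\<close> of a nonzero form of degree \<open>d\<close>: near a finite point the
  local coordinate is \<open>T\<close>, near infinity it is \<open>1 / T\<close>, where the form becomes
  \<open>H(1, S) = S ^ d H(1 / S, 1)\<close>, of order \<open>d - degree H\<close> at \<open>S = 0\<close>.
\<close>

definition form_order :: "nat \<Rightarrow> 'k::field poly \<Rightarrow> 'k \<Rightarrow> 'k \<Rightarrow> nat" where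
  "form_order d H x y = (if y = 0 then d - degree H else order (x / y) H)"

text \<open>
  If \<open>f(P) = [a : b]\<close>, the linear form \<open>b X - a Y\<close> cuts out \<open>f(P)\<close> on the target, and the
  ramification index of \<open>f\<close> at \<open>P\<close> is the order of vanishing at \<open>P\<close> of its pullback \<open>b F - a G\<close>.
  Only meaningful for nonconstant \<open>f\<close>.
\<close>

definition ramified_to_order ::
    "('k::field proj_line \<Rightarrow> 'k proj_line) \<Rightarrow> 'k proj_line \<Rightarrow> nat \<Rightarrow> bool" where
  "ramified_to_order f P e \<longleftrightarrow> (\<exists>d F G x y a b. given_by_forms f d F G \<and>
     (x, y) \<noteq> (0, 0) \<and> P = proj_pt x y \<and> (a, b) \<noteq> (0, 0) \<and> f P = proj_pt a b \<and>
     form_order d (smult b F - smult a G) x y = e)"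


subsection \<open>The Zariski topology on powers of the projective line\<close>

definition proj_power :: "nat \<Rightarrow> (nat \<Rightarrow> 'k::field proj_line) set" where
  "proj_power n = ({..<n} \<rightarrow>\<^sub>E UNIV)"

text \<open>
  A multihomogeneous form of multidegree \<open>m\<close> in the \<open>n\<close> pairs of variables \<open>(X\<^sub>i, Y\<^sub>i)\<close>;
  \<open>c a\<close> is the coefficient of the monomial \<open>\<Prod>i<n. X\<^sub>i ^ a i * Y\<^sub>i ^ (m i - a i)\<close>.
\<close>

definition eval_multiform ::
    "nat \<Rightarrow> (nat \<Rightarrow> nat) \<Rightarrow> ((nat \<Rightarrow> nat) \<Rightarrow> 'k::field) \<Rightarrow> (nat \<Rightarrow> 'k) \<Rightarrow> (nat \<Rightarrow> 'k) \<Rightarrow> 'k" where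
  "eval_multiform n m c x y =
     (\<Sum>a\<in>(\<Pi>\<^sub>E i\<in>{..<n}. {..m i}). c a * (\<Prod>i<n. x i ^ a i * y i ^ (m i - a i)))"

definition multiform_vanishes ::
    "nat \<Rightarrow> (nat \<Rightarrow> nat) \<Rightarrow> ((nat \<Rightarrow> nat) \<Rightarrow> 'k::field) \<Rightarrow> (nat \<Rightarrow> 'k proj_line) \<Rightarrow> bool" where
  "multiform_vanishes n m c P \<longleftrightarrow>
     (\<forall>x y. (\<forall>i<n. (x i, y i) \<noteq> (0, 0) \<and> P i = proj_pt (x i) (y i)) \<longrightarrow>
        eval_multiform n m c x y = 0)"

definition zariski_closed :: "nat \<Rightarrow> (nat \<Rightarrow> 'k::field proj_line) set \<Rightarrow> bool" where
  "zariski_closed n Z \<longleftrightarrow>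
     (\<exists>S. Z = {P \<in> proj_power n. \<forall>(m, c)\<in>S. multiform_vanishes n m c P})"

definition zariski_open :: "nat \<Rightarrow> (nat \<Rightarrow> 'k::field proj_line) set \<Rightarrow> bool" where
  "zariski_open n U \<longleftrightarrow> U \<subseteq> proj_power n \<and> zariski_closed n (proj_power n - U)"


subsection \<open>Separable maps with prescribed ramification\<close>

definition ramified_maps ::
    "nat \<Rightarrow> nat \<Rightarrow> (nat \<Rightarrow> nat) \<Rightarrow> (nat \<Rightarrow> 'k::field proj_line) \<Rightarrow> ('k proj_line \<Rightarrow> 'k proj_line) set" where
  "ramified_maps d n e P = {f. morphism_of_degree d f \<and> separable_morphism f \<and>
     (\<forall>i<n. ramified_to_order f (P i) (e i))}"

definition image_aut_rel ::
    "('k::field proj_line \<Rightarrow> 'k proj_line) set \<Rightarrow>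
      (('k proj_line \<Rightarrow> 'k proj_line) \<times> ('k proj_line \<Rightarrow> 'k proj_line)) set" where
  "image_aut_rel M = {(f, g). f \<in> M \<and> g \<in> M \<and> (\<exists>\<alpha>\<in>proj_line_Aut. g = \<alpha> \<circ> f)}"

definition ramified_map_classes ::
    "nat \<Rightarrow> nat \<Rightarrow> (nat \<Rightarrow> nat) \<Rightarrow> (nat \<Rightarrow> 'k::field proj_line) \<Rightarrow> ('k proj_line \<Rightarrow> 'k proj_line) set set" where
  "ramified_map_classes d n e P = ramified_maps d n e P // image_aut_rel (ramified_maps d n e P)"

end

theory Submission
  imports Defs "HOL-Library.Function_Algebras"
begin

text \<open>
  The idea is a dimension count. A map with all \<open>e\<^sub>i\<close> prime to \<open>p\<close> is infinitesimally rigid once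
  its branch points \<open>f(P\<^sub>i)\<close> are fixed: a first-order deformation fixing them is given by a form that
  vanishes on the whole ramification divisor, of degree \<open>2d - 2\<close>, and to order 3 at the point used to
  normalize \<open>f\<close> on the target, so it vanishes for degree reasons. Hence a family of normalized maps
  has at most as many independent parameters as there are distinct branch points. If infinitely many
  classes existed over general \<open>P\<close>, the \<open>P\<^sub>i\<close> and some coefficient of \<open>f\<close> would be \<open>n + 1\<close> independent
  functions on such a family; if \<open>f(P\<^sub>i) = f(P\<^sub>j)\<close> for general \<open>P\<close>, there would be \<open>n\<close> independent
  functions but only \<open>n - 1\<close> branch points.

  Characteristic \<open>p\<close> gives an elementary proof of the bound on the number of parameters. If locally
  the maximal ideal of each point is generated, modulo its square, by \<open>r\<close> functions \<open>u\<close>, then by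
  Nakayama's lemma the ring of functions is, after a localization, generated by the restricted
  monomials in \<open>u\<close> over its \<open>p\<close>-th powers. So the space of polynomial expressions of degree \<open>N\<close> has
  dimension at most \<open>p ^ r\<close> times that in degree about \<open>N / p\<close>, and grows like \<open>N ^ r\<close>, which leaves no
  room for \<open>r + 1\<close> algebraically independent functions.
\<close>

subsection \<open>Spaces of polynomial expressions\<close>

text \<open>The parameter space is a bare set of normalized maps with named coordinates. No variety
  structure is put on it, so every argument is about spaces of functions and their dimensions over
  k. This shapes two steps. Localizing means discarding the points where a denominator \<sigma>
  vanishes. And the local argument is run at all base points at once: the ring consists of functions
  of pairs (x, x'), in which whatever depends on x alone is a constant. The denominators
  \<open>\<sigma> x\<close> then lie in one finite-dimensional space and satisfy
  \<open>\<sigma> x x = 1\<close>, so finitely many base points cover the family, and the product of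
  their relations holds everywhere. The branch points become functions only in a target coordinate
  that is finite at all of them. For each map one of any n + 1 values of c makes F / (G + c F) such
  a coordinate, so finitely many families suffice. Separability enters through a nonzero Wronskian.
  Its degree is at most 2d - 2 and the prescribed ramification uses all of it, so 0 is unramified as
  soon as no P_i is 0, and f can be normalized there.\<close>

definition fscale :: "'k::field \<Rightarrow> ('x \<Rightarrow> 'k) \<Rightarrow> 'x \<Rightarrow> 'k" where
  "fscale c f = (\<lambda>x. c * f x)"

lemma fscale_apply [simp]: "fscale c f x = c * f x"
  by (simp add: fscale_def)

interpretation fsp: vector_space "fscale :: 'k::field \<Rightarrow> ('x \<Rightarrow> 'k) \<Rightarrow> 'x \<Rightarrow> 'k"
  by unfold_locales (auto simp: fun_eq_iff algebra_simps)

lemma sum_fun_apply: "(\<Sum>i\<in>A. f i) x = (\<Sum>i\<in>A. f i x)"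
  for f :: "'i \<Rightarrow> 'x \<Rightarrow> 'k::comm_monoid_add"
  by (induction A rule: infinite_finite_induct) auto

definition mono_fun :: "'l set \<Rightarrow> ('l \<Rightarrow> 'x \<Rightarrow> 'k::field) \<Rightarrow> ('l \<Rightarrow> nat) \<Rightarrow> 'x \<Rightarrow> 'k" where
  "mono_fun L y I = (\<lambda>x. \<Prod>l\<in>L. y l x ^ I l)"

text \<open>A filtered piece of the coordinate ring; its dimension as a function of \<open>N\<close>
  is the affine Hilbert function. Equality is equality of functions, so relations among the
  \<open>y l\<close> are already divided out.\<close>

definition polys_le :: "'l set \<Rightarrow> ('l \<Rightarrow> 'x \<Rightarrow> 'k::field) \<Rightarrow> nat \<Rightarrow> ('x \<Rightarrow> 'k) set" where
  "polys_le L y N = fsp.span {mono_fun L y I | I. (\<Sum>l\<in>L. I l) \<le> N}"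

lemma mono_fun_cong: "(\<And>l. l \<in> L \<Longrightarrow> I l = J l) \<Longrightarrow> mono_fun L y I = mono_fun L y J"
  by (auto simp: mono_fun_def fun_eq_iff intro!: prod.cong)

lemma mono_fun_add: "mono_fun L y (\<lambda>l. I l + J l) = (\<lambda>x. mono_fun L y I x * mono_fun L y J x)"
  by (simp add: mono_fun_def fun_eq_iff power_add prod.distrib)

lemma mono_fun_mult: "mono_fun L y (\<lambda>l. p * I l) = (\<lambda>x. mono_fun L y I x ^ p)"
  by (simp add: mono_fun_def fun_eq_iff power_mult prod_power_distrib mult.commute[of p])

lemma mono_fun_polys_le: "(\<Sum>l\<in>L. I l) \<le> N \<Longrightarrow> mono_fun L y I \<in> polys_le L y N"
  unfolding polys_le_def by (intro fsp.span_base) auto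

lemma polys_le_const: "(\<lambda>_. c) \<in> polys_le L y N"
proof -
  have "fscale c (mono_fun L y (\<lambda>_. 0)) \<in> polys_le L y N"
    unfolding polys_le_def by (intro fsp.span_scale fsp.span_base) auto
  then show ?thesis by (simp add: fscale_def mono_fun_def)
qed

lemma polys_le_mono: "N \<le> M \<Longrightarrow> f \<in> polys_le L y N \<Longrightarrow> f \<in> polys_le L y M"
  unfolding polys_le_def by (rule subsetD[OF fsp.span_mono]) auto

lemma polys_le_add: "f \<in> polys_le L y N \<Longrightarrow> g \<in> polys_le L y N \<Longrightarrow> (\<lambda>x. f x + g x) \<in> polys_le L y N"
  using fsp.span_add[of f _ g] by (simp add: polys_le_def plus_fun_def)

lemma polys_le_scale: "f \<in> polys_le L y N \<Longrightarrow> (\<lambda>x. c * f x) \<in> polys_le L y N"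
  using fsp.span_scale[of f _ c] by (simp add: polys_le_def fscale_def)

lemma polys_le_sum: "(\<And>i. i \<in> A \<Longrightarrow> f i \<in> polys_le L y N) \<Longrightarrow> (\<lambda>x. \<Sum>i\<in>A. f i x) \<in> polys_le L y N"
proof -
  assume "\<And>i. i \<in> A \<Longrightarrow> f i \<in> polys_le L y N"
  then have "sum f A \<in> polys_le L y N" unfolding polys_le_def by (rule fsp.span_sum)
  moreover have "sum f A = (\<lambda>x. \<Sum>i\<in>A. f i x)" by (simp add: fun_eq_iff sum_fun_apply)
  ultimately show ?thesis by simp
qed

lemma polys_le_diff: "f \<in> polys_le L y N \<Longrightarrow> g \<in> polys_le L y N \<Longrightarrow> (\<lambda>x. f x - g x) \<in> polys_le L y N"
  using polys_le_add[OF _ polys_le_scale[of g _ _ _ "-1"], of f] by simp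

lemma polys_le_var:
  assumes "finite L" "l \<in> L" "N \<ge> 1"
  shows "y l \<in> polys_le L y N"
proof -
  have "mono_fun L y (\<lambda>m. if m = l then 1 else 0) \<in> polys_le L y N"
    by (rule mono_fun_polys_le) (use assms in \<open>simp add: sum.delta\<close>)
  moreover have "mono_fun L y (\<lambda>m. if m = l then 1 else 0) = y l"
    using assms by (simp add: mono_fun_def fun_eq_iff if_distrib[of "\<lambda>n. _ ^ n"] prod.delta cong: if_cong)
  ultimately show ?thesis by simp
qed

lemma polys_le_mult:
  assumes "f \<in> polys_le L y N" "g \<in> polys_le L y M"
  shows "(\<lambda>x. f x * g x) \<in> polys_le L y (N + M)"
  using assms(1) unfolding polys_le_def[of L y N]
proof (induction f rule: fsp.span_induct_alt)
  case base
  then show ?case by (simp add: polys_le_const)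
next
  case (step c a f)
  then obtain I where I: "a = mono_fun L y I" "(\<Sum>l\<in>L. I l) \<le> N" by auto
  have "(\<lambda>x. a x * g x) \<in> polys_le L y (N + M)"
    using assms(2) unfolding polys_le_def[of L y M]
  proof (induction g rule: fsp.span_induct_alt)
    case base
    then show ?case by (simp add: polys_le_const)
  next
    case (step c b g)
    then obtain J where J: "b = mono_fun L y J" "(\<Sum>l\<in>L. J l) \<le> M" by auto
    have "mono_fun L y (\<lambda>l. I l + J l) \<in> polys_le L y (N + M)"
      by (rule mono_fun_polys_le) (use I J in \<open>simp add: sum.distrib\<close>)
    from polys_le_add[OF polys_le_scale[OF this, of c] step(2)]
    show ?case by (simp add: mono_fun_add I J algebra_simps)
  qed
  from polys_le_add[OF polys_le_scale[OF this, of c] step(2)]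
  show ?case by (simp add: algebra_simps)
qed

lemma polys_le_prod:
  assumes "finite A" "\<And>i. i \<in> A \<Longrightarrow> f i \<in> polys_le L y (N i)"
  shows "(\<lambda>x. \<Prod>i\<in>A. f i x) \<in> polys_le L y (\<Sum>i\<in>A. N i)"
  using assms by (induction A) (auto simp: polys_le_const intro: polys_le_mult)

lemma polys_le_power:
  assumes "f \<in> polys_le L y N"
  shows "(\<lambda>x. f x ^ m) \<in> polys_le L y (m * N)"
  using polys_le_prod[of "{..<m}" "\<lambda>_. f" L y "\<lambda>_. N"] assms by simp

text \<open>Restriction to a subset of the points is expressed by a map \<rho> of the whole type
  into that subset.\<close>

lemma polys_le_comp:
  assumes "f \<in> polys_le L y N"
  shows "(\<lambda>x. f (\<rho> x)) \<in> polys_le L (\<lambda>l x. y l (\<rho> x)) N"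
  using assms unfolding polys_le_def[of L y N]
proof (induction f rule: fsp.span_induct_alt)
  case base
  then show ?case by (simp add: polys_le_const)
next
  case (step c a f)
  then obtain I where I: "a = mono_fun L y I" "(\<Sum>l\<in>L. I l) \<le> N" by auto
  have "mono_fun L (\<lambda>l x. y l (\<rho> x)) I \<in> polys_le L (\<lambda>l x. y l (\<rho> x)) N"
    by (rule mono_fun_polys_le) (use I in simp)
  from polys_le_add[OF polys_le_scale[OF this, of c] step(2)]
  show ?case by (simp add: mono_fun_def I)
qed

text \<open>Exponents outside \<open>L\<close> do not affect a monomial, so restricting the exponent
  functions to \<open>L\<close> leaves a finite index set.\<close>

lemma polys_le_generators:
  assumes "finite L"
  shows "\<exists>E \<subseteq> (\<Pi>\<^sub>E l\<in>L. {..N}). {mono_fun L y I | I. (\<Sum>l\<in>L. I l) \<le> N} = mono_fun L y ` E"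
proof (intro exI conjI)
  let ?E = "{I \<in> (\<Pi>\<^sub>E l\<in>L. {..N}). (\<Sum>l\<in>L. I l) \<le> N}"
  show "?E \<subseteq> (\<Pi>\<^sub>E l\<in>L. {..N})" by auto
  show "{mono_fun L y I | I. (\<Sum>l\<in>L. I l) \<le> N} = mono_fun L y ` ?E"
  proof (intro equalityI subsetI)
    fix f assume "f \<in> {mono_fun L y I | I. (\<Sum>l\<in>L. I l) \<le> N}"
    then obtain I where I: "f = mono_fun L y I" "(\<Sum>l\<in>L. I l) \<le> N" by auto
    have le: "I l \<le> N" if "l \<in> L" for l
      using member_le_sum[of l L I] assms that I by simp
    have "mono_fun L y I = mono_fun L y (restrict I L)" by (rule mono_fun_cong) simp
    moreover have "restrict I L \<in> ?E" using le I by auto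
    ultimately show "f \<in> mono_fun L y ` ?E" using I by blast
  qed auto
qed

lemma polys_le_explicit:
  assumes "finite L" "f \<in> polys_le L y N"
  shows "\<exists>c. f = (\<lambda>x. \<Sum>I\<in>(\<Pi>\<^sub>E l\<in>L. {..N}). c I * mono_fun L y I x)"
proof -
  let ?E = "\<Pi>\<^sub>E l\<in>L. {..N}"
  obtain E where E: "E \<subseteq> ?E" "{mono_fun L y I | I. (\<Sum>l\<in>L. I l) \<le> N} = mono_fun L y ` E"
    using polys_le_generators[OF assms(1), of N y] by (elim exE conjE)
  have fin: "finite ?E" using assms by (intro finite_PiE) auto
  show ?thesis
    using assms(2) unfolding polys_le_def E(2)
  proof (induction f rule: fsp.span_induct_alt)
    case base
    then show ?case by (intro exI[of _ "\<lambda>_. 0"]) auto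
  next
    case (step c a f)
    then obtain I c' where I: "a = mono_fun L y I" "I \<in> E"
      and c': "f = (\<lambda>x. \<Sum>I\<in>?E. c' I * mono_fun L y I x)" by auto
    have "fscale c a + f = (\<lambda>x. \<Sum>J\<in>?E. (c' J + (if J = I then c else 0)) * mono_fun L y J x)"
      using I subsetD[OF E(1) I(2)] fin
      by (intro ext) (simp add: c' distrib_right sum.distrib if_distrib[of "\<lambda>u. u * _"]
        sum.delta cong: if_cong)
    then show ?case by (intro exI[of _ "\<lambda>J. c' J + (if J = I then c else 0)"])
  qed
qed

lemma polys_le_finite_dim:
  assumes "finite L"
  shows "\<exists>B. finite B \<and> polys_le L y N \<subseteq> fsp.span B"
proof -
  obtain E where E: "E \<subseteq> (\<Pi>\<^sub>E l\<in>L. {..N})" "{mono_fun L y I | I. (\<Sum>l\<in>L. I l) \<le> N} = mono_fun L y ` E"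
    using polys_le_generators[OF assms(1), of N y] by (elim exE conjE)
  have "finite (\<Pi>\<^sub>E l\<in>L. {..N})" using assms by (intro finite_PiE) auto
  then have "finite (mono_fun L y ` E)" using finite_subset[OF E(1)] by blast
  then show ?thesis unfolding polys_le_def E(2) by blast
qed

subsection \<open>Polynomial functions\<close>

abbreviation polyfuns :: "'j set \<Rightarrow> (('j \<Rightarrow> 'k::field) \<Rightarrow> 'k) set" where
  "polyfuns Z \<equiv> (\<Union>N. polys_le Z (\<lambda>j a. a j) N)"

text \<open>Over a finite field the product of all T - a, plus 1, has positive degree and no
  root.\<close>

lemma infinite_UNIV_alg_closed: "infinite (UNIV :: 'k::alg_closed_field set)"
proof
  assume fin: "finite (UNIV :: 'k set)"
  let ?q = "(\<Prod>a\<in>UNIV. [:-a, 1:]) + 1 :: 'k poly"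
  have "degree (\<Prod>a\<in>UNIV. [:-a, 1:] :: 'k poly) = card (UNIV :: 'k set)"
    by (subst degree_prod_eq_sum_degree) auto
  moreover have "card (UNIV :: 'k set) > 0" using fin by (simp add: card_gt_0_iff)
  ultimately have "degree ?q > 0" by (simp add: degree_add_eq_left)
  then obtain x where "poly ?q x = 0" using alg_closed_imp_poly_has_root by blast
  moreover have "poly (\<Prod>a\<in>UNIV. [:-a, 1:]) x = 0"
    using fin by (auto simp: poly_prod)
  ultimately show False by simp
qed

lemma poly_zero_iff_alg_closed: "(\<forall>t. poly q t = 0) \<longleftrightarrow> q = (0 :: 'k::alg_closed_field poly)"
proof
  assume "\<forall>t. poly q t = 0"
  then have "{t. poly q t = 0} = UNIV" by auto
  then show "q = 0" using infinite_UNIV_alg_closed poly_roots_finite[of q] by metis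
qed simp

lemma polyfuns_var: "finite Z \<Longrightarrow> j \<in> Z \<Longrightarrow> (\<lambda>a. a j) \<in> polyfuns Z"
  using polys_le_var[of Z j 1 "\<lambda>j a. a j"] by auto

lemma polyfuns_diff:
  assumes "H \<in> polyfuns Z" "H' \<in> polyfuns Z"
  shows "(\<lambda>a. H a - H' a) \<in> polyfuns Z"
proof -
  obtain N M where "H \<in> polys_le Z (\<lambda>j a. a j) N" "H' \<in> polys_le Z (\<lambda>j a. a j) M"
    using assms by auto
  then have "H \<in> polys_le Z (\<lambda>j a. a j) (max N M)" "H' \<in> polys_le Z (\<lambda>j a. a j) (max N M)"
    using polys_le_mono[OF max.cobounded1] polys_le_mono[OF max.cobounded2] by metis+
  then have "(\<lambda>a. H a - H' a) \<in> polys_le Z (\<lambda>j a. a j) (max N M)" by (rule polys_le_diff)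
  then show ?thesis by (rule UN_I[OF UNIV_I])
qed

lemma polyfuns_line:
  fixes H :: "('j \<Rightarrow> 'k::field) \<Rightarrow> 'k"
  assumes "H \<in> polyfuns Z"
  shows "\<exists>q. \<forall>t. H (\<lambda>j. a j + t * b j) = poly q t"
proof -
  obtain N where "H \<in> polys_le Z (\<lambda>j a. a j) N" using assms by auto
  then show ?thesis
    unfolding polys_le_def
  proof (induction H rule: fsp.span_induct_alt)
    case base
    then show ?case by (intro exI[of _ 0]) auto
  next
    case (step c m f)
    then obtain I q where I: "m = mono_fun Z (\<lambda>j a. a j) I"
      and q: "\<forall>t. f (\<lambda>j. a j + t * b j) = poly q t" by auto
    show ?case
      by (intro exI[of _ "smult c (\<Prod>j\<in>Z. [:a j, b j:] ^ I j) + q"])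
         (simp add: q I mono_fun_def poly_prod)
  qed
qed

definition nonzero_polyfuns :: "'j set \<Rightarrow> (('j \<Rightarrow> 'k::field) \<Rightarrow> 'k) set" where
  "nonzero_polyfuns Z = {H \<in> polyfuns Z. \<exists>a. H a \<noteq> 0}"

lemma nonzero_polyfuns_one: "(\<lambda>_. 1) \<in> nonzero_polyfuns Z"
  using polys_le_const[of 1] by (fastforce simp: nonzero_polyfuns_def)

text \<open>Restrict to a line joining points where the two factors do not vanish.\<close>

lemma nonzero_polyfuns_mult:
  fixes H H' :: "('j \<Rightarrow> 'k::alg_closed_field) \<Rightarrow> 'k"
  assumes "H \<in> nonzero_polyfuns Z" "H' \<in> nonzero_polyfuns Z"
  shows "(\<lambda>a. H a * H' a) \<in> nonzero_polyfuns Z"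
proof -
  obtain a b where ab: "H a \<noteq> 0" "H' b \<noteq> 0" using assms by (auto simp: nonzero_polyfuns_def)
  have H: "H \<in> polyfuns Z" "H' \<in> polyfuns Z" using assms by (auto simp: nonzero_polyfuns_def)
  obtain q where q: "\<And>t. H (\<lambda>j. a j + t * (b j - a j)) = poly q t"
    using polyfuns_line[OF H(1), of a "\<lambda>j. b j - a j"] by auto
  obtain q' where q': "\<And>t. H' (\<lambda>j. a j + t * (b j - a j)) = poly q' t"
    using polyfuns_line[OF H(2), of a "\<lambda>j. b j - a j"] by auto
  have "poly q 0 \<noteq> 0" "poly q' 1 \<noteq> 0" using ab by (simp_all flip: q q')
  then have "q * q' \<noteq> 0" by auto
  then obtain t where "poly (q * q') t \<noteq> 0"
    using poly_zero_iff_alg_closed[of "q * q'"] by auto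
  then have "H (\<lambda>j. a j + t * (b j - a j)) * H' (\<lambda>j. a j + t * (b j - a j)) \<noteq> 0"
    by (simp add: q q')
  moreover have "(\<lambda>a. H a * H' a) \<in> polyfuns Z"
    using H by (auto intro: polys_le_mult)
  ultimately show ?thesis unfolding nonzero_polyfuns_def by blast
qed

lemma nonzero_polyfuns_prod:
  fixes H :: "'i \<Rightarrow> ('j \<Rightarrow> 'k::alg_closed_field) \<Rightarrow> 'k"
  assumes "finite A" "\<And>i. i \<in> A \<Longrightarrow> H i \<in> nonzero_polyfuns Z"
  shows "(\<lambda>a. \<Prod>i\<in>A. H i a) \<in> nonzero_polyfuns Z"
  using assms by (induction A) (auto simp: nonzero_polyfuns_one intro: nonzero_polyfuns_mult)

lemma sum_PiE_insert:
  assumes "z \<notin> Z"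
  shows "(\<Sum>I\<in>(\<Pi>\<^sub>E j\<in>insert z Z. S). f I) = (\<Sum>k\<in>S. \<Sum>I\<in>(\<Pi>\<^sub>E j\<in>Z. S). f (I(z := k)))"
proof -
  have "(\<Sum>I\<in>(\<Pi>\<^sub>E j\<in>insert z Z. S). f I) = (\<Sum>(k, I)\<in>S \<times> (\<Pi>\<^sub>E j\<in>Z. S). f (I(z := k)))"
    unfolding PiE_insert_eq
    by (subst sum.reindex[OF inj_combinator[OF assms]]) (simp add: case_prod_unfold)
  then show ?thesis by (simp add: sum.cartesian_product)
qed

lemma mono_fun_insert:
  assumes "finite Z" "z \<notin> Z"
  shows "mono_fun (insert z Z) y I x = y z x ^ I z * mono_fun Z y I x"
  using assms by (simp add: mono_fun_def)

lemma mono_fun_upd: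
  assumes "finite Z" "z \<notin> Z"
  shows "mono_fun Z y (I(z := k)) x = mono_fun Z y I x"
  unfolding mono_fun_def using assms by (intro prod.cong) auto

text \<open>Polynomials are represented by their functions, and this makes the representation
  faithful. With all variables but \<open>z\<close> fixed, a polynomial in one variable vanishes on
  an infinite field, so its coefficients vanish as polynomial functions of the remaining
  variables.\<close>

lemma poly_fun_eq_0_imp_coeffs_0:
  fixes c :: "('j \<Rightarrow> nat) \<Rightarrow> 'k::alg_closed_field"
  assumes "finite Z" "\<And>a. (\<Sum>I\<in>(\<Pi>\<^sub>E j\<in>Z. {..m}). c I * mono_fun Z (\<lambda>j a. a j) I a) = 0"
    and "I \<in> (\<Pi>\<^sub>E j\<in>Z. {..m})"
  shows "c I = 0"
  using assms
proof (induction Z arbitrary: c I)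
  case empty
  then show ?case by (simp add: mono_fun_def)
next
  case (insert z Z)
  let ?f = "\<lambda>k a. \<Sum>J\<in>(\<Pi>\<^sub>E j\<in>Z. {..m}). c (J(z := k)) * mono_fun Z (\<lambda>j a. a j) J a"
  have eq: "(\<Sum>k\<le>m. ?f k a * t ^ k) = 0" for a t
  proof -
    have upd: "mono_fun Z (\<lambda>j a. a j) J (a(z := t)) = mono_fun Z (\<lambda>j a. a j) J a" for J
      unfolding mono_fun_def using insert.hyps by (intro prod.cong) auto
    show ?thesis
      using insert.prems(1)[of "a(z := t)"] insert.hyps
      by (simp add: upd upd[unfolded fun_upd_def] sum_PiE_insert mono_fun_insert mono_fun_upd sum_distrib_left sum_distrib_right mult_ac)
  qed
  have "?f k a = 0" if "k \<le> m" for k a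
  proof -
    let ?q = "\<Sum>k\<le>m. monom (?f k a) k"
    have "poly ?q t = 0" for t using eq[of a t] by (simp add: poly_sum poly_monom)
    then have "?q = 0" using poly_zero_iff_alg_closed[of ?q] by auto
    then have "coeff ?q k = 0" by simp
    then show ?thesis using that by (simp add: coeff_sum sum.delta)
  qed
  moreover obtain J k where J: "I = J(z := k)" "J \<in> (\<Pi>\<^sub>E j\<in>Z. {..m})" "k \<le> m"
    using insert.prems(2) unfolding PiE_insert_eq by auto
  ultimately have "\<And>a. ?f k a = 0" "J \<in> (\<Pi>\<^sub>E j\<in>Z. {..m})" by blast+
  from insert.IH[of "\<lambda>J. c (J(z := k))", OF this] show ?case unfolding J(1) .
qed

text \<open>Singles out one variable, so that a relation can be read as an equation for it over the
  others.\<close>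

lemma polyfuns_coeffs:
  assumes "finite Z" "z \<notin> Z" "H \<in> polyfuns (insert z Z)"
  shows "\<exists>N h. (\<forall>k. h k \<in> polyfuns Z) \<and> (\<forall>a. H a = (\<Sum>k\<le>N. h k a * a z ^ k))"
proof -
  obtain N where N: "H \<in> polys_le (insert z Z) (\<lambda>j a. a j) N" using assms by auto
  then have "\<exists>h. (\<forall>k. h k \<in> polys_le Z (\<lambda>j a. a j) N) \<and> (\<forall>a. H a = (\<Sum>k\<le>N. h k a * a z ^ k))"
    unfolding polys_le_def[of "insert z Z"]
  proof (induction H rule: fsp.span_induct_alt)
    case base
    then show ?case by (intro exI[of _ "\<lambda>_ _. 0"]) (auto simp: polys_le_const)
  next
    case (step c m f)
    then obtain I h where I: "m = mono_fun (insert z Z) (\<lambda>j a. a j) I" "(\<Sum>l\<in>insert z Z. I l) \<le> N"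
      and h: "\<forall>k. h k \<in> polys_le Z (\<lambda>j a. a j) N" "\<forall>a. f a = (\<Sum>k\<le>N. h k a * a z ^ k)" by auto
    have Iz: "I z \<le> N" "(\<Sum>l\<in>Z. I l) \<le> N" using I(2) assms by auto
    let ?h = "\<lambda>k a. (if k = I z then c else 0) * mono_fun Z (\<lambda>j a. a j) I a + h k a"
    have "?h k \<in> polys_le Z (\<lambda>j a. a j) N" for k
      by (intro polys_le_add polys_le_scale mono_fun_polys_le Iz) (use h in auto)
    moreover have "\<forall>a. (fscale c m + f) a = (\<Sum>k\<le>N. ?h k a * a z ^ k)"
      using Iz by (simp add: h(2) distrib_right sum.distrib I(1) mono_fun_insert assms
        if_distrib[of "\<lambda>u. u * _"] sum.delta cong: if_cong)
    ultimately show ?case by (intro exI[of _ ?h]) simp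
  qed
  then obtain h where h: "\<And>k. h k \<in> polys_le Z (\<lambda>j a. a j) N"
    "\<And>a. H a = (\<Sum>k\<le>N. h k a * a z ^ k)" by auto
  have "h k \<in> polyfuns Z" for k using h(1)[of k] by auto
  with h(2) show ?thesis by auto
qed

subsection \<open>Growth and algebraic relations\<close>

text \<open>Indexed families count repetitions: two equal members are already related, with
  coefficients 1 and -1.\<close>

lemma exists_linear_relation:
  fixes f :: "'i \<Rightarrow> 'x \<Rightarrow> 'k::field"
  assumes "finite E" "finite B" "\<And>i. i \<in> E \<Longrightarrow> f i \<in> fsp.span B" "card E > card B"
  shows "\<exists>c. (\<exists>i\<in>E. c i \<noteq> 0) \<and> (\<forall>x. (\<Sum>i\<in>E. c i * f i x) = 0)"
proof (cases "inj_on f E")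
  case True
  have "fsp.dependent (f ` E)"
    using fsp.independent_span_bound[of B "f ` E"] assms card_image[OF True] by auto
  then obtain u where u: "\<exists>v\<in>f ` E. u v \<noteq> 0" "(\<Sum>v\<in>f ` E. fscale (u v) v) = 0"
    using fsp.dependent_finite[of "f ` E"] assms by auto
  have "(\<Sum>i\<in>E. fscale (u (f i)) (f i)) = 0" using u(2) by (simp add: sum.reindex[OF True])
  then have "(\<Sum>i\<in>E. u (f i) * f i x) = 0" for x
    by (metis (no_types, lifting) fscale_apply sum.cong sum_fun_apply zero_fun_apply)
  with u(1) show ?thesis by (intro exI[of _ "\<lambda>i. u (f i)"]) auto
next
  case False
  then obtain i j where ij: "i \<in> E" "j \<in> E" "i \<noteq> j" "f i = f j" by (auto simp: inj_on_def)
  have "(\<Sum>k\<in>E. ((if k = i then 1 else 0) - (if k = j then 1 else 0)) * f k x) = 0" for x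
    using ij assms(1) by (simp add: left_diff_distrib sum_subtractf if_distrib[of "\<lambda>u. u * _"]
      sum.delta cong: if_cong)
  then show ?thesis
    using ij by (intro exI[of _ "\<lambda>k. (if k = i then 1 else 0) - (if k = j then 1 else 0)"]) auto
qed

text \<open>The spanning set need not lie in \<open>V\<close>. This matters in the Frobenius step,
  whose generators have denominators.\<close>

definition spanned_by_at_most :: "nat \<Rightarrow> ('x \<Rightarrow> 'k::field) set \<Rightarrow> bool" where
  "spanned_by_at_most m V \<longleftrightarrow> (\<exists>B. finite B \<and> card B \<le> m \<and> V \<subseteq> fsp.span B)"

lemma spanned_by_at_most_subset: "spanned_by_at_most m W \<Longrightarrow> V \<subseteq> W \<Longrightarrow> spanned_by_at_most m V"
  unfolding spanned_by_at_most_def by blast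

text \<open>Taking p-th powers is additive and turns scalars into scalars, so it does not increase
  the number of generators.\<close>

lemma frobenius_span:
  fixes f :: "'x \<Rightarrow> 'k::field"
  assumes "prime p" "CHAR('k) = p" "f \<in> fsp.span B"
  shows "(\<lambda>x. f x ^ p) \<in> fsp.span ((\<lambda>b x. b x ^ p) ` B)"
  using assms(3)
proof (induction f rule: fsp.span_induct_alt)
  case base
  have "p > 0" using assms by (simp add: prime_gt_0_nat)
  then have "(\<lambda>x. (0 :: 'x \<Rightarrow> 'k) x ^ p) = 0" by (simp add: fun_eq_iff)
  then show ?case by (simp only: fsp.span_zero)
next
  case (step c a f)
  have "(\<lambda>x. (fscale c a + f) x ^ p) = fscale (c ^ p) (\<lambda>x. a x ^ p) + (\<lambda>x. f x ^ p)"
    using assms(1,2) freshmans_dream[where 'a='k] by (auto simp: fun_eq_iff power_mult_distrib)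
  then show ?case
    using step by (auto simp del: fscale_apply intro!: fsp.span_add fsp.span_scale intro: fsp.span_base)
qed

text \<open>
  A monomial of degree at most \<open>N\<close> is the \<open>p\<close>-th power of a monomial of degree at most
  \<open>N div p\<close> times one of the finitely many monomials with all exponents below \<open>p\<close>.
\<close>

lemma polys_le_frobenius_step:
  fixes y :: "'l \<Rightarrow> 'x \<Rightarrow> 'k::field" and u :: "'m \<Rightarrow> 'x \<Rightarrow> 'k"
  assumes "prime p" "CHAR('k) = p" "finite L" "finite L0" "\<And>x. \<sigma> x \<noteq> 0"
    and pbasis: "\<And>I. I \<in> (\<Pi>\<^sub>E l\<in>L. {..<p}) \<Longrightarrow> \<exists>g. (\<forall>J. g J \<in> polys_le L y C) \<and>
      (\<forall>x. \<sigma> x ^ p * mono_fun L y I x = (\<Sum>J\<in>(\<Pi>\<^sub>E i\<in>L0. {..<p}). mono_fun L0 u J x * g J x ^ p))"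
    and "spanned_by_at_most m (polys_le L y (N div p + C))"
  shows "spanned_by_at_most (p ^ card L0 * m) (polys_le L y N)"
proof -
  obtain B where B: "finite B" "card B \<le> m" "polys_le L y (N div p + C) \<subseteq> fsp.span B"
    using assms(7) by (auto simp: spanned_by_at_most_def)
  let ?J = "\<Pi>\<^sub>E i\<in>L0. {..<p}"
  \<comment> \<open>The restricted part of a monomial is rewritten by \<open>pbasis\<close>, and the
    p-th powers that appear are expanded over the p-th powers of \<open>B\<close>. Dividing by
    \<sigma> ^ p removes the factor introduced by localization.\<close>
  let ?b = "\<lambda>(J, b). \<lambda>x. mono_fun L0 u J x * b x ^ p / \<sigma> x ^ p"
  have p: "p > 0" using assms by (simp add: prime_gt_0_nat)
  have finJ: "finite ?J" using assms by (intro finite_PiE) auto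
  have card: "card (?b ` (?J \<times> B)) \<le> p ^ card L0 * m"
  proof -
    have "card (?b ` (?J \<times> B)) \<le> card (?J \<times> B)" using B finJ by (intro card_image_le) auto
    also have "\<dots> = p ^ card L0 * card B" using assms by (simp add: card_cartesian_product card_PiE)
    finally show ?thesis using B(2) by (meson le_trans mult_le_mono2)
  qed
  have "mono_fun L y I \<in> fsp.span (?b ` (?J \<times> B))" if I: "(\<Sum>l\<in>L. I l) \<le> N" for I
  proof -
    let ?M = "mono_fun L y (\<lambda>l. I l div p)"
    let ?R = "restrict (\<lambda>l. I l mod p) L"
    have "(\<Sum>l\<in>L. I l div p) \<le> N div p"
    proof -
      have "p * (\<Sum>l\<in>L. I l div p) \<le> (\<Sum>l\<in>L. I l)"
        unfolding sum_distrib_left by (intro sum_mono) simp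
      with I have "p * (\<Sum>l\<in>L. I l div p) \<le> N" by linarith
      then show ?thesis using p by (simp add: less_eq_div_iff_mult_less_eq mult.commute)
    qed
    then have M: "?M \<in> polys_le L y (N div p)" by (rule mono_fun_polys_le)
    have "?R \<in> (\<Pi>\<^sub>E l\<in>L. {..<p})" using p by auto
    then obtain g where g: "\<And>J. g J \<in> polys_le L y C"
      "\<And>x. \<sigma> x ^ p * mono_fun L y ?R x = (\<Sum>J\<in>?J. mono_fun L0 u J x * g J x ^ p)"
      using pbasis by blast
    have split: "mono_fun L y I x = ?M x ^ p * mono_fun L y ?R x" for x
    proof -
      have "mono_fun L y I = mono_fun L y (\<lambda>l. p * (I l div p) + ?R l)" by (rule mono_fun_cong) simp
      then show ?thesis by (simp only: mono_fun_add[of L y "\<lambda>l. p * (I l div p)" ?R] mono_fun_mult)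
    qed
    have eq: "mono_fun L y I = (\<Sum>J\<in>?J. (\<lambda>x. mono_fun L0 u J x * (?M x * g J x) ^ p / \<sigma> x ^ p))"
    proof
      fix x
      have "\<sigma> x ^ p * mono_fun L y I x = (\<Sum>J\<in>?J. mono_fun L0 u J x * (?M x * g J x) ^ p)"
        using arg_cong[OF g(2)[of x], of "\<lambda>t. ?M x ^ p * t"]
        by (simp add: split sum_distrib_left power_mult_distrib mult_ac)
      then show "mono_fun L y I x = (\<Sum>J\<in>?J. (\<lambda>x. mono_fun L0 u J x * (?M x * g J x) ^ p / \<sigma> x ^ p)) x"
        using assms(5)[of x] by (simp add: sum_fun_apply sum_divide_distrib[symmetric] field_simps)
    qed
    have "(\<lambda>x. mono_fun L0 u J x * h x ^ p / \<sigma> x ^ p) \<in> fsp.span (?b ` (?J \<times> B))"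
      if J: "J \<in> ?J" and "h \<in> polys_le L y (N div p + C)" for J h
    proof -
      have "h \<in> fsp.span B" using that B by auto
      from frobenius_span[OF assms(1,2) this]
      have hp: "(\<lambda>x. h x ^ p) \<in> fsp.span ((\<lambda>b x. b x ^ p) ` B)" .
      have span:  "(\<lambda>x. mono_fun L0 u J x * f x / \<sigma> x ^ p) \<in> fsp.span (?b ` (?J \<times> B))"
        if "f \<in> fsp.span ((\<lambda>b x. b x ^ p) ` B)" for f
        using that
      proof (induction f rule: fsp.span_induct_alt)
        case base
        then show ?case by (simp del: fscale_apply add: fsp.span_zero zero_fun_def[symmetric])
      next
        case (step c a f)
        then obtain b where b: "b \<in> B" "a = (\<lambda>x. b x ^ p)" by auto
        have "?b (J, b) \<in> fsp.span (?b ` (?J \<times> B))" using b J by (intro fsp.span_base imageI) auto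
        from fsp.span_add[OF fsp.span_scale[OF this, of c] step(2)]
        moreover have "fscale c (?b (J, b)) + (\<lambda>x. mono_fun L0 u J x * f x / \<sigma> x ^ p) =
          (\<lambda>x. mono_fun L0 u J x * (fscale c a + f) x / \<sigma> x ^ p)"
          by (simp add: b fun_eq_iff add_divide_distrib algebra_simps)
        ultimately show ?case by (simp only:)
      qed
      from span[OF hp] show ?thesis .
    qed
    moreover have "(\<lambda>x. ?M x * g J x) \<in> polys_le L y (N div p + C)" for J
      using M g(1) by (rule polys_le_mult)
    ultimately show ?thesis unfolding eq by (intro fsp.span_sum) blast
  qed
  then have "polys_le L y N \<subseteq> fsp.span (?b ` (?J \<times> B))"
    unfolding polys_le_def by (intro fsp.span_minimal) auto
  then show ?thesis
    unfolding spanned_by_at_most_def using card finJ B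
    by (intro exI[of _ "?b ` (?J \<times> B)"]) auto
qed

text \<open>The step is iterated s times, each time at the cost of a factor
  \<open>p ^ card L0\<close>. The slack \<open>2 * C\<close> in the degree reproduces itself:
  halving it, or dividing by a larger p, and adding \<open>C\<close> gives at most
  \<open>2 * C\<close> again.\<close>

lemma polys_le_growth:
  fixes y :: "'l \<Rightarrow> 'x \<Rightarrow> 'k::field" and u :: "'m \<Rightarrow> 'x \<Rightarrow> 'k"
  assumes "prime p" "CHAR('k) = p" "finite L" "finite L0" "\<And>x. \<sigma> x \<noteq> 0"
    and pbasis: "\<And>I. I \<in> (\<Pi>\<^sub>E l\<in>L. {..<p}) \<Longrightarrow> \<exists>g. (\<forall>J. g J \<in> polys_le L y C) \<and>
      (\<forall>x. \<sigma> x ^ p * mono_fun L y I x = (\<Sum>J\<in>(\<Pi>\<^sub>E i\<in>L0. {..<p}). mono_fun L0 u J x * g J x ^ p))"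
  shows "\<exists>D. \<forall>s. spanned_by_at_most (D * p ^ (s * card L0)) (polys_le L y (p ^ s))"
proof -
  obtain B where B: "finite B" "polys_le L y (1 + 2 * C) \<subseteq> fsp.span B"
    using polys_le_finite_dim[OF assms(3)] by blast
  have p: "p \<ge> 2" using assms by (simp add: prime_ge_2_nat)
  have "spanned_by_at_most (card B * p ^ (s * card L0)) (polys_le L y (p ^ s + 2 * C))" for s
  proof (induction s)
    case 0
    then show ?case using B by (auto simp: spanned_by_at_most_def)
  next
    case (Suc s)
    have "(2 * C) div p \<le> C"
      using p by (metis div_le_mono2 nonzero_mult_div_cancel_left zero_less_numeral zero_neq_numeral)
    then have "(p ^ Suc s + 2 * C) div p + C \<le> p ^ s + 2 * C" using p by (simp add: div_mult_self3)
    then have "polys_le L y ((p ^ Suc s + 2 * C) div p + C) \<subseteq> polys_le L y (p ^ s + 2 * C)"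
      using polys_le_mono by blast
    with Suc have "spanned_by_at_most (card B * p ^ (s * card L0))
        (polys_le L y ((p ^ Suc s + 2 * C) div p + C))"
      by (rule spanned_by_at_most_subset)
    from polys_le_frobenius_step[OF assms this] show ?case by (simp add: power_add mult_ac)
  qed
  moreover have "polys_le L y (p ^ s) \<subseteq> polys_le L y (p ^ s + 2 * C)" for s
    by (rule subsetI, rule polys_le_mono[of "p ^ s"]) simp
  ultimately have "spanned_by_at_most (card B * p ^ (s * card L0)) (polys_le L y (p ^ s))" for s
    by (rule spanned_by_at_most_subset)
  then show ?thesis by (intro exI allI)
qed

text \<open>The monomials in the \<open>z j\<close> with exponents up to a fixed fraction of
  \<open>p ^ s\<close> number about \<open>p ^ (s * card Z)\<close>. The available dimension is only
  of order \<open>p ^ (s * r)\<close> with r < card Z, so for large s they are linearly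
  dependent.\<close>

lemma algebraic_relation_of_growth:
  fixes y :: "'l \<Rightarrow> 'x \<Rightarrow> 'k::alg_closed_field"
  assumes "prime p" "\<And>s. spanned_by_at_most (D * p ^ (s * r)) (polys_le L y (p ^ s))"
    and "finite Z" "card Z > r" "\<And>j. j \<in> Z \<Longrightarrow> z j \<in> polys_le L y \<kappa>"
  shows "\<exists>H\<in>nonzero_polyfuns Z. \<forall>x. H (\<lambda>j. z j x) = 0"
proof -
  \<comment> \<open>Monomials with exponents at most \<open>m\<close> have degree at most
    \<open>q * m\<close> in \<open>y\<close>; the summand 1 keeps \<open>q\<close> positive when
    \<kappa> = 0.\<close>
  define q where "q = (\<kappa> + 1) * card Z"
  have q: "q > 0" using assms by (simp add: q_def)
  have p: "p \<ge> 2" using assms by (simp add: prime_ge_2_nat)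
  \<comment> \<open>Since \<open>s < p ^ s\<close>, this choice makes \<open>p ^ s\<close> exceed
    the constant \<open>q ^ card Z * D\<close> that the count has to absorb.\<close>
  define s where "s = q ^ card Z * D"
  define m where "m = p ^ s div q"
  have ps: "s < p ^ s" using p by (intro power_gt_expt) simp
  let ?E = "\<Pi>\<^sub>E j\<in>Z. {..m}"
  obtain B where B: "finite B" "card B \<le> D * p ^ (s * r)" "polys_le L y (p ^ s) \<subseteq> fsp.span B"
    using assms(2)[of s] by (auto simp: spanned_by_at_most_def)
  have finE: "finite ?E" using assms by (intro finite_PiE) auto
  have E: "mono_fun Z z I \<in> fsp.span B" if "I \<in> ?E" for I
  proof -
    have "mono_fun Z z I \<in> polys_le L y (\<Sum>j\<in>Z. I j * \<kappa>)"
      unfolding mono_fun_def using assms by (intro polys_le_prod polys_le_power) auto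
    moreover have "(\<Sum>j\<in>Z. I j * \<kappa>) \<le> p ^ s"
    proof -
      have "(\<Sum>j\<in>Z. I j * \<kappa>) \<le> (\<Sum>j\<in>Z. m * (\<kappa> + 1))"
        using that by (intro sum_mono mult_mono) auto
      also have "\<dots> = q * m" by (simp add: q_def algebra_simps)
      also have "\<dots> \<le> p ^ s" by (simp add: m_def)
      finally show ?thesis .
    qed
    ultimately show ?thesis using polys_le_mono B(3) by blast
  qed
  have "card B < card ?E"
  proof -
    have "p ^ s < q * (m + 1)"
      using q dividend_less_times_div[of q "p ^ s"] by (simp add: m_def)
    then have "(p ^ s) ^ card Z < (q * (m + 1)) ^ card Z"
      using assms by (intro power_strict_mono) auto
    moreover have "(p ^ s) ^ Suc r \<le> (p ^ s) ^ card Z"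
      using assms p by (intro power_increasing) auto
    moreover have "q ^ card Z * (D * p ^ (s * r)) \<le> (p ^ s) ^ Suc r"
      using ps by (simp add: s_def[symmetric] power_mult mult.assoc[symmetric])
    ultimately have "q ^ card Z * (D * p ^ (s * r)) < (q * (m + 1)) ^ card Z" by linarith
    then have "q ^ card Z * (D * p ^ (s * r)) < q ^ card Z * (m + 1) ^ card Z"
      by (simp only: power_mult_distrib)
    then have "D * p ^ (s * r) < (m + 1) ^ card Z" by simp
    then show ?thesis using B(2) assms by (simp add: card_PiE)
  qed
  from exists_linear_relation[OF finE B(1) E this] obtain c
    where "(\<exists>I\<in>?E. c I \<noteq> 0) \<and> (\<forall>x. (\<Sum>I\<in>?E. c I * mono_fun Z z I x) = 0)" by (rule exE)
  then have c: "\<exists>I\<in>?E. c I \<noteq> 0" "\<And>x. (\<Sum>I\<in>?E. c I * mono_fun Z z I x) = 0" by simp_all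
  let ?H = "\<lambda>a. \<Sum>I\<in>?E. c I * mono_fun Z (\<lambda>j a. a j) I a"
  have "?H \<in> polys_le Z (\<lambda>j a. a j) (card Z * m)"
  proof (intro polys_le_sum polys_le_scale mono_fun_polys_le)
    fix I assume "I \<in> ?E"
    then have "(\<Sum>l\<in>Z. I l) \<le> (\<Sum>l\<in>Z. m)" by (intro sum_mono) auto
    then show "(\<Sum>l\<in>Z. I l) \<le> card Z * m" by simp
  qed
  moreover have "\<exists>a. ?H a \<noteq> 0" using poly_fun_eq_0_imp_coeffs_0[where Z = Z and m = m and c = c] assms(3) c(1) by blast
  ultimately have "?H \<in> nonzero_polyfuns Z"
    unfolding nonzero_polyfuns_def by (intro CollectI conjI UN_I[OF UNIV_I])
  moreover have "?H (\<lambda>j. z j x) = 0" for x using c(2)[of x] by (simp add: mono_fun_def)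
  ultimately show ?thesis by (intro bexI[of _ ?H] allI)
qed

subsection \<open>Frobenius and localization\<close>

definition ring_mono :: "'l set \<Rightarrow> ('l \<Rightarrow> 'a::comm_ring_1) \<Rightarrow> ('l \<Rightarrow> nat) \<Rightarrow> 'a" where
  "ring_mono L v I = (\<Prod>l\<in>L. v l ^ I l)"

lemma ring_mono_cong: "(\<And>l. l \<in> L \<Longrightarrow> I l = J l) \<Longrightarrow> ring_mono L v I = ring_mono L v J"
  by (auto simp: ring_mono_def intro!: prod.cong)

lemma ring_mono_add: "ring_mono L v (\<lambda>l. I l + J l) = ring_mono L v I * ring_mono L v J"
  by (simp add: ring_mono_def power_add prod.distrib)

lemma ring_mono_mult: "ring_mono L v (\<lambda>l. p * I l) = ring_mono L v I ^ p"
  by (simp add: ring_mono_def power_mult prod_power_distrib mult.commute[of p])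

lemma ring_mono_unit:
  assumes "finite L" "l \<in> L"
  shows "ring_mono L v (\<lambda>m. if m = l then 1 else 0) = v l"
  using assms by (simp add: ring_mono_def if_distrib[of "\<lambda>n. _ ^ n"] prod.delta cong: if_cong)

text \<open>\<open>K0\<close> plays the role of a perfect field of constants, but is only a subring
  closed under p-th roots: in the application it consists of arbitrary functions of the base point.
  The \<open>w l\<close> are local coordinates, and \<open>L0\<close> selects those that are to span
  the cotangent space.\<close>

locale frobenius_generated =
  fixes K0 :: "'a::comm_ring_1 set" and w :: "'l \<Rightarrow> 'a" and L L0 :: "'l set" and p :: nat
  assumes prime_p: "prime p" and frob: "\<And>a b :: 'a. (a + b) ^ p = a ^ p + b ^ p"
    and K0_1: "1 \<in> K0" and K0_minus_1: "-1 \<in> K0"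
    and K0_add: "\<And>a b. a \<in> K0 \<Longrightarrow> b \<in> K0 \<Longrightarrow> a + b \<in> K0"
    and K0_mult: "\<And>a b. a \<in> K0 \<Longrightarrow> b \<in> K0 \<Longrightarrow> a * b \<in> K0"
    and K0_root: "\<And>a. a \<in> K0 \<Longrightarrow> \<exists>b\<in>K0. a = b ^ p"
    and finite_L: "finite L" and L0_subset: "L0 \<subseteq> L"
begin

lemma p_ge_2: "p \<ge> 2" using prime_p by (simp add: prime_ge_2_nat)

lemma frob_sum: "(\<Sum>i\<in>A. f i :: 'a) ^ p = (\<Sum>i\<in>A. f i ^ p)"
  using p_ge_2 by (induction A rule: infinite_finite_induct) (auto simp: frob power_0_left)

inductive_set T :: "'a set" where
  const: "a \<in> K0 \<Longrightarrow> a \<in> T"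
| var: "l \<in> L \<Longrightarrow> w l \<in> T"
| add: "a \<in> T \<Longrightarrow> b \<in> T \<Longrightarrow> a + b \<in> T"
| mult: "a \<in> T \<Longrightarrow> b \<in> T \<Longrightarrow> a * b \<in> T"

lemma K0_0: "0 \<in> K0" using K0_add[OF K0_1 K0_minus_1] by simp

lemma K0_minus: "a \<in> K0 \<Longrightarrow> -a \<in> K0" using K0_mult[OF K0_minus_1] by force

lemma T_0: "0 \<in> T" and T_1: "1 \<in> T" using K0_0 K0_1 by (auto intro: T.const)

lemma T_minus: "a \<in> T \<Longrightarrow> -a \<in> T" using T.mult[OF T.const[OF K0_minus_1], of a] by simp

lemma T_diff: "a \<in> T \<Longrightarrow> b \<in> T \<Longrightarrow> a - b \<in> T" using T.add[OF _ T_minus] by force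

lemma T_sum: "(\<And>i. i \<in> A \<Longrightarrow> f i \<in> T) \<Longrightarrow> sum f A \<in> T"
  by (induction A rule: infinite_finite_induct) (auto simp: T_0 intro: T.add)

lemma T_prod: "(\<And>i. i \<in> A \<Longrightarrow> f i \<in> T) \<Longrightarrow> prod f A \<in> T"
  by (induction A rule: infinite_finite_induct) (auto simp: T_1 intro: T.mult)

lemma T_power: "a \<in> T \<Longrightarrow> a ^ m \<in> T"
  by (induction m) (auto simp: T_1 intro: T.mult)

lemma T_mono: "(\<And>l. l \<in> M \<Longrightarrow> v l \<in> T) \<Longrightarrow> ring_mono M v I \<in> T"
  unfolding ring_mono_def by (intro T_prod T_power)

text \<open>\<open>\<mm> j\<close> is the \<open>j\<close>-th power of the ideal of \<open>T\<close> generated by the \<open>w l\<close>.\<close>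

primrec \<mm> :: "nat \<Rightarrow> 'a set" where
  "\<mm> 0 = T"
| "\<mm> (Suc j) = {\<Sum>l\<in>L. w l * n l | n. \<forall>l\<in>L. n l \<in> \<mm> j}"

lemma \<mm>_SucI: "(\<And>l. l \<in> L \<Longrightarrow> n l \<in> \<mm> j) \<Longrightarrow> (\<Sum>l\<in>L. w l * n l) \<in> \<mm> (Suc j)" by auto

lemma \<mm>_SucE:
  assumes "a \<in> \<mm> (Suc j)"
  obtains n where "\<And>l. l \<in> L \<Longrightarrow> n l \<in> \<mm> j" "a = (\<Sum>l\<in>L. w l * n l)"
  using assms that unfolding \<mm>.simps by blast

declare \<mm>.simps(2) [simp del]

lemma \<mm>_0: "0 \<in> \<mm> j"
proof (induction j)
  case (Suc j)
  then show ?case using \<mm>_SucI[of "\<lambda>_. 0" j] by simp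
qed (simp add: T_0)

lemma \<mm>_add: "a \<in> \<mm> j \<Longrightarrow> b \<in> \<mm> j \<Longrightarrow> a + b \<in> \<mm> j"
proof (induction j arbitrary: a b)
  case (Suc j)
  obtain n where n: "\<And>l. l \<in> L \<Longrightarrow> n l \<in> \<mm> j" "a = (\<Sum>l\<in>L. w l * n l)"
    using Suc.prems(1) by (rule \<mm>_SucE) blast
  obtain n' where n': "\<And>l. l \<in> L \<Longrightarrow> n' l \<in> \<mm> j" "b = (\<Sum>l\<in>L. w l * n' l)"
    using Suc.prems(2) by (rule \<mm>_SucE) blast
  show ?case
    using \<mm>_SucI[of "\<lambda>l. n l + n' l" j] Suc.IH n n' by (simp add: distrib_left sum.distrib)
qed (simp add: T.add)

lemma \<mm>_T_mult: "a \<in> T \<Longrightarrow> b \<in> \<mm> j \<Longrightarrow> a * b \<in> \<mm> j"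
proof (induction j arbitrary: b)
  case (Suc j)
  obtain n where n: "\<And>l. l \<in> L \<Longrightarrow> n l \<in> \<mm> j" "b = (\<Sum>l\<in>L. w l * n l)"
    using Suc.prems(2) by (rule \<mm>_SucE) blast
  show ?case
    using \<mm>_SucI[of "\<lambda>l. a * n l" j] Suc n by (simp add: sum_distrib_left mult_ac)
qed (simp add: T.mult)

lemma \<mm>_minus: "a \<in> \<mm> j \<Longrightarrow> -a \<in> \<mm> j"
  using \<mm>_T_mult[OF T_minus[OF T_1], of a j] by simp

lemma \<mm>_diff: "a \<in> \<mm> j \<Longrightarrow> b \<in> \<mm> j \<Longrightarrow> a - b \<in> \<mm> j"
  using \<mm>_add[OF _ \<mm>_minus] by force

lemma \<mm>_sum: "(\<And>i. i \<in> A \<Longrightarrow> f i \<in> \<mm> j) \<Longrightarrow> sum f A \<in> \<mm> j"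
  by (induction A rule: infinite_finite_induct) (auto simp: \<mm>_0 intro: \<mm>_add)

lemma \<mm>_mult: "a \<in> \<mm> i \<Longrightarrow> b \<in> \<mm> j \<Longrightarrow> a * b \<in> \<mm> (i + j)"
proof (induction i arbitrary: a)
  case (Suc i)
  obtain n where n: "\<And>l. l \<in> L \<Longrightarrow> n l \<in> \<mm> i" "a = (\<Sum>l\<in>L. w l * n l)"
    using Suc.prems(1) by (rule \<mm>_SucE) blast
  show ?case
    using \<mm>_SucI[of "\<lambda>l. n l * b" "i + j"] Suc.IH[OF _ Suc.prems(2)] n
    by (simp add: sum_distrib_right mult.assoc)
qed (simp add: \<mm>_T_mult)

lemma \<mm>_Suc_subset: "a \<in> \<mm> (Suc j) \<Longrightarrow> a \<in> \<mm> j"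
proof (induction j arbitrary: a)
  case 0
  then obtain n where n: "\<And>l. l \<in> L \<Longrightarrow> n l \<in> \<mm> 0" "a = (\<Sum>l\<in>L. w l * n l)" by (rule \<mm>_SucE) blast
  then show ?case by (auto intro!: T_sum T.mult T.var)
next
  case (Suc j)
  from Suc.prems obtain n where n: "\<And>l. l \<in> L \<Longrightarrow> n l \<in> \<mm> (Suc j)" "a = (\<Sum>l\<in>L. w l * n l)"
    by (rule \<mm>_SucE) blast
  show ?case using \<mm>_SucI[of n j] n Suc.IH by simp
qed

lemma \<mm>_subset_T: "a \<in> \<mm> j \<Longrightarrow> a \<in> T"
  by (induction j arbitrary: a) (auto dest: \<mm>_Suc_subset)

lemma w_in_\<mm>: "l \<in> L \<Longrightarrow> w l \<in> \<mm> 1"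
  using \<mm>_SucI[of "\<lambda>m. if m = l then 1 else 0" 0] finite_L
  by (simp add: T_0 T_1 if_distrib[of "\<lambda>u. _ * u"] sum.delta cong: if_cong)

text \<open>Take the constant term of a polynomial expression in the \<open>w l\<close>: constants
  represent every residue class at the base point.\<close>

lemma T_decomp: "a \<in> T \<Longrightarrow> \<exists>c\<in>K0. a - c \<in> \<mm> 1"
proof (induction rule: T.induct)
  case (const a)
  then show ?case using \<mm>_0 by (intro bexI[of _ a]) auto
next
  case (var l)
  then show ?case using w_in_\<mm> K0_0 by (intro bexI[of _ 0]) auto
next
  case (add a b)
  then obtain c d where c: "c \<in> K0" "d \<in> K0" "a - c \<in> \<mm> 1" "b - d \<in> \<mm> 1" by blast
  then show ?case using \<mm>_add[OF c(3,4)] K0_add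
    by (intro bexI[of _ "c + d"]) (auto simp: algebra_simps)
next
  case (mult a b)
  then obtain c d where c: "c \<in> K0" "d \<in> K0" "a - c \<in> \<mm> 1" "b - d \<in> \<mm> 1" by blast
  have "(a - c) * b + c * (b - d) \<in> \<mm> 1"
    using \<mm>_T_mult[OF mult(2) c(3)] \<mm>_T_mult[OF T.const[OF c(1)] c(4)]
    by (intro \<mm>_add) (simp_all add: mult.commute)
  then show ?case using c K0_mult by (intro bexI[of _ "c * d"]) (auto simp: algebra_simps)
qed

text \<open>The p-th powers of \<open>T\<close> with the selected coordinates adjoined. The goal of
  this part is that \<open>T\<close> and \<open>S\<close> agree after localization.\<close>

inductive_set S :: "'a set" where
  pow: "a \<in> T \<Longrightarrow> a ^ p \<in> S"
| var: "l \<in> L0 \<Longrightarrow> w l \<in> S"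
| add: "a \<in> S \<Longrightarrow> b \<in> S \<Longrightarrow> a + b \<in> S"
| mult: "a \<in> S \<Longrightarrow> b \<in> S \<Longrightarrow> a * b \<in> S"

lemma K0_S: "a \<in> K0 \<Longrightarrow> a \<in> S"
  using K0_root[of a] by (auto intro: S.pow T.const)

lemma S_sum: "(\<And>i. i \<in> A \<Longrightarrow> f i \<in> S) \<Longrightarrow> sum f A \<in> S"
  by (induction A rule: infinite_finite_induct) (auto simp: K0_S K0_0 intro: S.add)

text \<open>Add exponents and carry: the quotient modulo p of each exponent goes into the p-th
  power, the remainder stays below p. Terms with the same remainder are collected into one
  coefficient because Frobenius is additive.\<close>

lemma restricted_monomials_mult:
  assumes v: "\<And>l. l \<in> M \<Longrightarrow> v l \<in> T" and "finite M"
    and a: "a = (\<Sum>J\<in>(\<Pi>\<^sub>E l\<in>M. {..<p}). ring_mono M v J * s J ^ p)" "\<And>J. s J \<in> T"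
    and b: "b = (\<Sum>J\<in>(\<Pi>\<^sub>E l\<in>M. {..<p}). ring_mono M v J * t J ^ p)" "\<And>J. t J \<in> T"
  shows "\<exists>r. (\<forall>J. r J \<in> T) \<and> a * b = (\<Sum>J\<in>(\<Pi>\<^sub>E l\<in>M. {..<p}). ring_mono M v J * r J ^ p)"
proof -
  let ?J = "\<Pi>\<^sub>E l\<in>M. {..<p}"
  let ?q = "\<lambda>(I, J). ring_mono M v (\<lambda>l. (I l + J l) div p)"
  let ?rm = "\<lambda>(I, J). restrict (\<lambda>l. (I l + J l) mod p) M"
  have fin: "finite ?J" using assms by (intro finite_PiE) auto
  have rm: "?rm ` (?J \<times> ?J) \<subseteq> ?J" using p_ge_2 by auto
  have eq: "ring_mono M v I * ring_mono M v J = ?q (I, J) ^ p * ring_mono M v (?rm (I, J))" for I J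
  proof -
    have "ring_mono M v I * ring_mono M v J = ring_mono M v (\<lambda>l. I l + J l)" by (simp add: ring_mono_add)
    also have "\<dots> = ring_mono M v (\<lambda>l. p * ((I l + J l) div p) + ?rm (I, J) l)"
      by (rule ring_mono_cong) simp
    finally show ?thesis
      by (simp only: ring_mono_add[of M v "\<lambda>l. p * ((I l + J l) div p)"] ring_mono_mult split)
  qed
  have term_eq: "(ring_mono M v I * s I ^ p) * (ring_mono M v J * t J ^ p) =
      ring_mono M v (?rm (I, J)) * (?q (I, J) * s I * t J) ^ p" for I J
  proof -
    have "(ring_mono M v I * s I ^ p) * (ring_mono M v J * t J ^ p) =
        (ring_mono M v I * ring_mono M v J) * (s I ^ p * t J ^ p)"
      by (simp only: mult_ac)
    then show ?thesis by (simp only: eq power_mult_distrib mult_ac)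
  qed
  let ?r = "\<lambda>R. \<Sum>x\<in>{x \<in> ?J \<times> ?J. ?rm x = R}. ?q x * s (fst x) * t (snd x)"
  have "a * b = (\<Sum>x\<in>?J \<times> ?J. ring_mono M v (?rm x) * (?q x * s (fst x) * t (snd x)) ^ p)"
    unfolding a b sum_product sum.cartesian_product
    by (intro sum.cong refl) (simp only: case_prod_unfold term_eq[unfolded case_prod_unfold] fst_conv snd_conv)
  also have "\<dots> = (\<Sum>R\<in>?J. \<Sum>x\<in>{x \<in> ?J \<times> ?J. ?rm x = R}. ring_mono M v (?rm x) * (?q x * s (fst x) * t (snd x)) ^ p)"
    using fin rm by (intro sum.group[symmetric]) auto
  also have "\<dots> = (\<Sum>R\<in>?J. ring_mono M v R * ?r R ^ p)"
    unfolding frob_sum sum_distrib_left by (intro sum.cong refl) auto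
  finally have "a * b = (\<Sum>R\<in>?J. ring_mono M v R * ?r R ^ p)" .
  moreover have "?r R \<in> T" for R
    using a b by (auto intro!: T_sum T.mult T_mono v split: prod.split)
  ultimately show ?thesis by (intro exI[of _ ?r]) simp
qed

text \<open>The module over the p-th powers of \<open>T\<close> generated by the monomials with
  exponents below p. A sum of p-th powers is a p-th power, so one \<open>t J\<close> per monomial is
  enough.\<close>

definition restricted :: "'m set \<Rightarrow> ('m \<Rightarrow> 'a) \<Rightarrow> 'a set" where
  "restricted M v = {\<Sum>J\<in>(\<Pi>\<^sub>E l\<in>M. {..<p}). ring_mono M v J * t J ^ p | t. \<forall>J. t J \<in> T}"

lemma restrictedI:
  "(\<And>J. t J \<in> T) \<Longrightarrow> a = (\<Sum>J\<in>(\<Pi>\<^sub>E l\<in>M. {..<p}). ring_mono M v J * t J ^ p) \<Longrightarrow> a \<in> restricted M v"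
  unfolding restricted_def by (intro CollectI exI[of _ t] conjI allI)

lemma restricted_add: "a \<in> restricted M v \<Longrightarrow> b \<in> restricted M v \<Longrightarrow> a + b \<in> restricted M v"
proof -
  assume "a \<in> restricted M v" "b \<in> restricted M v"
  then obtain s t where st: "\<forall>J. s J \<in> T" "\<forall>J. t J \<in> T"
    "a = (\<Sum>J\<in>(\<Pi>\<^sub>E l\<in>M. {..<p}). ring_mono M v J * s J ^ p)"
    "b = (\<Sum>J\<in>(\<Pi>\<^sub>E l\<in>M. {..<p}). ring_mono M v J * t J ^ p)"
    unfolding restricted_def by blast
  have "a + b = (\<Sum>J\<in>(\<Pi>\<^sub>E l\<in>M. {..<p}). ring_mono M v J * (s J + t J) ^ p)"
    by (simp add: st frob distrib_left sum.distrib)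
  moreover have "s J + t J \<in> T" for J using st T.add by blast
  ultimately show ?thesis by (intro restrictedI[of "\<lambda>J. s J + t J"])
qed

lemma restricted_mult:
  assumes "\<And>l. l \<in> M \<Longrightarrow> v l \<in> T" "finite M" "a \<in> restricted M v" "b \<in> restricted M v"
  shows "a * b \<in> restricted M v"
proof -
  obtain s t where st: "\<And>J. s J \<in> T" "\<And>J. t J \<in> T"
    "a = (\<Sum>J\<in>(\<Pi>\<^sub>E l\<in>M. {..<p}). ring_mono M v J * s J ^ p)"
    "b = (\<Sum>J\<in>(\<Pi>\<^sub>E l\<in>M. {..<p}). ring_mono M v J * t J ^ p)"
    using assms(3,4) unfolding restricted_def by blast
  obtain r where "\<forall>J. r J \<in> T" "a * b = (\<Sum>J\<in>(\<Pi>\<^sub>E l\<in>M. {..<p}). ring_mono M v J * r J ^ p)"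
    using restricted_monomials_mult[OF assms(1,2) st(3,1,4,2)] by blast
  then show ?thesis by (intro restrictedI[of r]) auto
qed

lemma restricted_monomial:
  assumes "finite M" "I \<in> (\<Pi>\<^sub>E l\<in>M. {..<p})" "t \<in> T"
  shows "ring_mono M v I * t ^ p \<in> restricted M v"
proof -
  have "finite (\<Pi>\<^sub>E l\<in>M. {..<p})" using assms by (intro finite_PiE) auto
  moreover have "0 ^ p = (0::'a)" using p_ge_2 by (simp add: power_0_left)
  ultimately have "ring_mono M v I * t ^ p =
      (\<Sum>J\<in>(\<Pi>\<^sub>E l\<in>M. {..<p}). ring_mono M v J * (if J = I then t else 0) ^ p)"
    using assms by (simp add: if_distrib[of "\<lambda>u. u ^ p"] if_distrib[of "\<lambda>u. _ * u"] sum.delta cong: if_cong)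
  moreover have "(if J = I then t else 0) \<in> T" for J using assms T_0 by auto
  ultimately show ?thesis by (intro restrictedI[of "\<lambda>J. if J = I then t else 0"])
qed

lemma restricted_pow:
  assumes "finite M" "t \<in> T"
  shows "t ^ p \<in> restricted M v"
proof -
  have "ring_mono M v (restrict (\<lambda>_. 0) M) = 1" by (simp add: ring_mono_def)
  then show ?thesis
    using restricted_monomial[OF assms(1) _ assms(2), of "restrict (\<lambda>_. 0) M" v] p_ge_2 by auto
qed

lemma restricted_var:
  assumes "finite M" "l \<in> M"
  shows "v l \<in> restricted M v"
proof -
  have "ring_mono M v (restrict (\<lambda>m. if m = l then 1 else 0) M) = v l"
    by (subst ring_mono_cong[of M _ "\<lambda>m. if m = l then 1 else 0"]) (simp_all add: ring_mono_unit[OF assms])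
  then show ?thesis
    using restricted_monomial[OF assms(1) _ T_1, of "restrict (\<lambda>m. if m = l then 1 else 0) M" v] p_ge_2
    by auto
qed

lemma T_restricted: "a \<in> T \<Longrightarrow> a \<in> restricted L w"
proof (induction rule: T.induct)
  case (const a)
  then show ?case using K0_root[of a] restricted_pow[OF finite_L] T.const by auto
qed (auto intro: restricted_var restricted_add restricted_mult finite_L T.var)

text \<open>Uncentred coordinates do as well: \<open>u i\<close> and \<open>w i\<close> differ by a
  constant, and constants are p-th powers.\<close>

lemma S_restricted:
  assumes "\<And>i. i \<in> L0 \<Longrightarrow> u i - w i \<in> K0" "a \<in> S"
  shows "a \<in> restricted L0 u"
proof -
  have fin: "finite L0" using finite_L L0_subset finite_subset by blast
  have u: "u l \<in> T" if "l \<in> L0" for l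
    using T.add[OF T.const[OF assms(1)[OF that]] T.var[of l]] that L0_subset by auto
  show ?thesis
    using assms(2)
  proof (induction rule: S.induct)
    case (pow a)
    then show ?case by (rule restricted_pow[OF fin])
  next
    case (var l)
    have "-(u l - w l) \<in> K0" using assms(1)[OF var] by (rule K0_minus)
    then obtain b where b: "b \<in> K0" "-(u l - w l) = b ^ p" using K0_root by blast
    have "u l + b ^ p \<in> restricted L0 u"
      using b restricted_pow[OF fin] var fin by (intro restricted_add restricted_var) (auto intro: T.const)
    then show ?case by (simp flip: b(2))
  qed (use fin u in \<open>auto intro: restricted_add restricted_mult\<close>)
qed

end

text \<open>The assumption says that the classes of the \<open>w i\<close> with
  \<open>i \<in> L0\<close> span the cotangent space \<open>\<mm> 1 / \<mm> 2\<close> over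
  \<open>K0\<close>.\<close>

locale frobenius_rigid = frobenius_generated +
  assumes rigid: "\<And>l. l \<in> L \<Longrightarrow> \<exists>b. (\<forall>i. b i \<in> K0) \<and> w l - (\<Sum>i\<in>L0. b i * w i) \<in> \<mm> 2"
begin

text \<open>Each graded piece of the filtration by powers is generated by products of degree-one
  classes, and by rigidity every degree-one class has a representative in \<open>S\<close>.\<close>

lemma \<mm>_S_decomp: "a \<in> \<mm> (Suc j) \<Longrightarrow> \<exists>s\<in>S \<inter> \<mm> (Suc j). a - s \<in> \<mm> (Suc (Suc j))"
proof (induction j arbitrary: a)
  have lin: "\<exists>s\<in>S \<inter> \<mm> 1. w l - s \<in> \<mm> 2" if l: "l \<in> L" for l
  proof -
    obtain b where b: "\<forall>i. b i \<in> K0" "w l - (\<Sum>i\<in>L0. b i * w i) \<in> \<mm> 2" using rigid[OF l] by blast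
    have "(\<Sum>i\<in>L0. b i * w i) \<in> S" using b K0_S by (intro S_sum S.mult S.var) auto
    moreover have "(\<Sum>i\<in>L0. b i * w i) \<in> \<mm> 1"
      using b L0_subset w_in_\<mm> by (intro \<mm>_sum \<mm>_T_mult T.const) auto
    ultimately show ?thesis using b by blast
  qed
  then obtain s where s: "\<And>l. l \<in> L \<Longrightarrow> s l \<in> S" "\<And>l. l \<in> L \<Longrightarrow> s l \<in> \<mm> 1" "\<And>l. l \<in> L \<Longrightarrow> w l - s l \<in> \<mm> 2"
    by (metis IntE)
  {
    case 0
    then obtain n where n: "\<And>l. l \<in> L \<Longrightarrow> n l \<in> \<mm> 0" "a = (\<Sum>l\<in>L. w l * n l)" by (rule \<mm>_SucE) blast
    have "\<exists>c\<in>K0. n l - c \<in> \<mm> 1" if "l \<in> L" for l using T_decomp[of "n l"] n(1)[OF that] by simp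
    then obtain c where c: "\<And>l. l \<in> L \<Longrightarrow> c l \<in> K0" "\<And>l. l \<in> L \<Longrightarrow> n l - c l \<in> \<mm> 1" by metis
    let ?s = "\<Sum>l\<in>L. s l * c l"
    have "?s \<in> S" using s c K0_S by (intro S_sum S.mult) auto
    moreover have "?s \<in> \<mm> 1" using s c \<mm>_T_mult[OF T.const[OF c(1)] s(2)]
      by (intro \<mm>_sum) (simp add: mult.commute)
    moreover have "a - ?s \<in> \<mm> 2"
    proof -
      have "a - ?s = (\<Sum>l\<in>L. c l * (w l - s l) + w l * (n l - c l))"
        by (simp add: n(2) sum_subtractf[symmetric] algebra_simps)
      also have "\<dots> \<in> \<mm> 2"
        using \<mm>_mult[OF w_in_\<mm> c(2)] \<mm>_T_mult[OF T.const[OF c(1)] s(3)]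
        by (intro \<mm>_sum \<mm>_add) (simp_all add: numeral_2_eq_2)
      finally show ?thesis .
    qed
    ultimately show ?case by (auto simp: numeral_2_eq_2)
  next
    case (Suc j)
    from Suc.prems obtain n where n: "\<And>l. l \<in> L \<Longrightarrow> n l \<in> \<mm> (Suc j)" "a = (\<Sum>l\<in>L. w l * n l)"
      by (rule \<mm>_SucE) blast
    have "\<exists>c\<in>S \<inter> \<mm> (Suc j). n l - c \<in> \<mm> (Suc (Suc j))" if "l \<in> L" for l
      using Suc.IH[OF n(1)[OF that]] .
    then obtain c where c: "\<And>l. l \<in> L \<Longrightarrow> c l \<in> S" "\<And>l. l \<in> L \<Longrightarrow> c l \<in> \<mm> (Suc j)"
      "\<And>l. l \<in> L \<Longrightarrow> n l - c l \<in> \<mm> (Suc (Suc j))" by (metis IntE)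
    let ?s = "\<Sum>l\<in>L. s l * c l"
    have "?s \<in> S" using s c by (intro S_sum S.mult) auto
    moreover have "?s \<in> \<mm> (Suc (Suc j))" using \<mm>_mult[OF s(2) c(2)] by (intro \<mm>_sum) simp
    moreover have "a - ?s \<in> \<mm> (Suc (Suc (Suc j)))"
    proof -
      have "a - ?s = (\<Sum>l\<in>L. (w l - s l) * c l + w l * (n l - c l))"
        by (simp add: n(2) sum_subtractf[symmetric] algebra_simps)
      also have "\<dots> \<in> \<mm> (Suc (Suc (Suc j)))"
        using \<mm>_mult[OF w_in_\<mm> c(3)] \<mm>_mult[OF s(3) c(2)]
        by (intro \<mm>_sum \<mm>_add) (simp_all add: numeral_2_eq_2)
      finally show ?thesis .
    qed
    ultimately show ?case by blast
  }
qed

text \<open>Density of \<open>S\<close> for the \<mm>-adic topology, obtained by correcting the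
  error one degree at a time.\<close>

lemma T_S_decomp: "a \<in> T \<Longrightarrow> \<exists>s\<in>S. a - s \<in> \<mm> j"
proof (induction j)
  case 0
  then show ?case using K0_S[OF K0_0] by (intro bexI[of _ 0]) auto
next
  case (Suc j)
  then obtain s where s: "s \<in> S" "a - s \<in> \<mm> j" by blast
  show ?case
  proof (cases j)
    case 0
    then show ?thesis using T_decomp[OF Suc.prems] K0_S by auto
  next
    case (Suc i)
    then obtain s' where "s' \<in> S" "a - s - s' \<in> \<mm> (Suc j)" using \<mm>_S_decomp[of "a - s" i] s by blast
    then show ?thesis using s S.add by (intro bexI[of _ "s + s'"]) (auto simp: algebra_simps)
  qed
qed

end

section \<open>Frobenius powers of the ideal and Nakayama elimination\<close>

context frobenius_generated
begin

text \<open>The Frobenius power of the ideal \<open>\<mm> 1\<close>, generated by the p-th powers of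
  its generators.\<close>

definition \<mm>_frob :: "'a set" where
  "\<mm>_frob = {\<Sum>l\<in>L. w l ^ p * t l | t. \<forall>l\<in>L. t l \<in> T}"

lemma \<mm>_frob_sum: "(\<And>i. i \<in> A \<Longrightarrow> f i \<in> \<mm>_frob) \<Longrightarrow> sum f A \<in> \<mm>_frob"
proof (induction A rule: infinite_finite_induct)
  case (insert i A)
  then obtain t t' where "\<forall>l\<in>L. t l \<in> T" "f i = (\<Sum>l\<in>L. w l ^ p * t l)"
    "\<forall>l\<in>L. t' l \<in> T" "sum f A = (\<Sum>l\<in>L. w l ^ p * t' l)"
    unfolding \<mm>_frob_def by blast
  then have "sum f (insert i A) = (\<Sum>l\<in>L. w l ^ p * (t l + t' l))" "\<forall>l\<in>L. t l + t' l \<in> T"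
    using insert.hyps by (auto simp: distrib_left sum.distrib intro: T.add)
  then show ?case unfolding \<mm>_frob_def by (intro CollectI exI[of _ "\<lambda>l. t l + t' l"] conjI)
qed (auto simp: \<mm>_frob_def intro!: exI[of _ "\<lambda>_. 0"] T_0)

text \<open>Pigeonhole: a monomial of degree more than \<open>card L * (p - 1)\<close> is divisible by some \<open>w l ^ p\<close>.\<close>

lemma ring_mono_\<mm>_subset_\<mm>_frob:
  assumes "a \<in> \<mm> j" "(\<Sum>l\<in>L. I l) + j > card L * (p - 1)"
  shows "ring_mono L w I * a \<in> \<mm>_frob"
  using assms
\<comment> \<open>Factors \<open>w l\<close> move from \<open>a\<close> into the monomial while the
  total degree stays fixed.\<close>
proof (induction j arbitrary: a I)
  case 0
  have "\<exists>l\<in>L. I l \<ge> p"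
  proof (rule ccontr)
    assume "\<not> ?thesis"
    then have "(\<Sum>l\<in>L. I l) \<le> (\<Sum>l\<in>L. p - 1)" by (intro sum_mono) force
    with 0 show False by simp
  qed
  then obtain l where l: "l \<in> L" "I l \<ge> p" by blast
  let ?I = "\<lambda>m. if m = l then I l - p else I m"
  let ?U = "\<lambda>m. p * (if m = l then 1 else 0)"
  have "ring_mono L w I = ring_mono L w (\<lambda>m. ?U m + ?I m)"
    using l by (intro ring_mono_cong) auto
  also have "\<dots> = w l ^ p * ring_mono L w ?I"
    unfolding ring_mono_add[of L w ?U ?I] ring_mono_mult ring_mono_unit[OF finite_L l(1)] ..
  finally have "ring_mono L w I * a = (\<Sum>m\<in>L. w m ^ p * (if m = l then ring_mono L w ?I * a else 0))"
    using l finite_L by (simp add: if_distrib[of "\<lambda>u. _ * u"] sum.delta mult.assoc cong: if_cong)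
  moreover have "ring_mono L w ?I * a \<in> T" using 0 by (intro T.mult T_mono T.var) auto
  ultimately show ?case
    unfolding \<mm>_frob_def using T_0
    by (intro CollectI exI[of _ "\<lambda>m. if m = l then ring_mono L w ?I * a else 0"]) auto
next
  case (Suc j)
  from Suc.prems(1) obtain n where n: "\<And>l. l \<in> L \<Longrightarrow> n l \<in> \<mm> j" "a = (\<Sum>l\<in>L. w l * n l)"
    by (rule \<mm>_SucE) blast
  have "ring_mono L w I * (w l * n l) \<in> \<mm>_frob" if l: "l \<in> L" for l
  proof -
    let ?U = "\<lambda>m. if m = l then 1 else 0 :: nat"
    have "ring_mono L w (\<lambda>m. I m + ?U m) * n l \<in> \<mm>_frob"
      using Suc.prems(2) l finite_L by (intro Suc.IH n(1)) (auto simp: sum.distrib sum.delta)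
    then show ?thesis
      unfolding ring_mono_add[of L w I ?U] ring_mono_unit[OF finite_L l] by (simp add: mult.assoc)
  qed
  then show ?case unfolding n(2) sum_distrib_left by (intro \<mm>_frob_sum)
qed

text \<open>
  Nakayama's lemma for the submodule \<open>N\<close>, with the determinant replaced by eliminating
  the generators \<open>b i\<close> one at a time.
\<close>

lemma nakayama_elimination:
  assumes N_add: "\<And>a b. a \<in> N \<Longrightarrow> b \<in> N \<Longrightarrow> a + b \<in> N"
    and N_mult: "\<And>a b. a \<in> T \<Longrightarrow> b \<in> N \<Longrightarrow> a ^ p * b \<in> N"
    and "finite E"
    and "\<And>i. i \<in> E \<Longrightarrow> \<exists>\<epsilon>. (\<forall>j\<in>E. \<epsilon> j \<in> \<mm> 1) \<and> b i - (\<Sum>j\<in>E. \<epsilon> j ^ p * b j) \<in> N"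
  shows "\<exists>\<sigma>\<in>T. \<sigma> - 1 \<in> \<mm> 1 \<and> (\<forall>i\<in>E. \<sigma> ^ p * b i \<in> N)"
  using assms(3,4)
proof (induction E)
  case empty
  then show ?case using T_1 \<mm>_0 by (intro bexI[of _ 1]) auto
next
  case (insert e E)
  obtain \<epsilon> where \<epsilon>: "\<And>j. j \<in> insert e E \<Longrightarrow> \<epsilon> j \<in> \<mm> 1" "b e - (\<Sum>j\<in>insert e E. \<epsilon> j ^ p * b j) \<in> N"
    using insert.prems[of e] by auto
  let ?\<tau> = "1 - \<epsilon> e"
  have \<epsilon>T: "\<epsilon> j \<in> T" if "j \<in> insert e E" for j using \<epsilon>(1)[OF that] \<mm>_subset_T by blast
  have \<tau>: "?\<tau> \<in> T" using \<epsilon>T T_1 by (intro T_diff) auto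
  have minus_pow: "(a - c) ^ p = a ^ p - c ^ p" for a c :: 'a
    using frob[of "a - c" c] by simp
  have \<tau>p: "?\<tau> ^ p = 1 - \<epsilon> e ^ p" by (simp add: minus_pow)
  have be: "?\<tau> ^ p * b e - (\<Sum>j\<in>E. \<epsilon> j ^ p * b j) \<in> N"
    using \<epsilon>(2) insert.hyps by (simp add: \<tau>p algebra_simps)
  have "\<exists>\<epsilon>'. (\<forall>j\<in>E. \<epsilon>' j \<in> \<mm> 1) \<and> b i - (\<Sum>j\<in>E. \<epsilon>' j ^ p * b j) \<in> N" if i: "i \<in> E" for i
  proof -
    obtain \<delta> where \<delta>: "\<And>j. j \<in> insert e E \<Longrightarrow> \<delta> j \<in> \<mm> 1" "b i - (\<Sum>j\<in>insert e E. \<delta> j ^ p * b j) \<in> N"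
      using insert.prems[of i] i by auto
    \<comment> \<open>Multiply the relation for \<open>b i\<close> by \<open>?\<tau> ^ p\<close>,
      replace \<open>?\<tau> ^ p * b e\<close> by its expression in the other generators, and move
      \<open>\<epsilon> e ^ p * b i\<close>, the difference between \<open>b i\<close> and
      \<open>?\<tau> ^ p * b i\<close>, into the sum.\<close>
    let ?\<epsilon> = "\<lambda>j. (if j = i then \<epsilon> e else 0) + ?\<tau> * \<delta> j + \<delta> e * \<epsilon> j"
    have "?\<epsilon> j \<in> \<mm> 1" if "j \<in> E" for j
      using \<epsilon>(1)[of e] \<delta>(1)[of j] \<epsilon>(1)[of j] that \<tau> \<mm>_0 \<delta>(1)[of e] \<mm>_subset_T
      by (intro \<mm>_add \<mm>_T_mult) auto
    moreover have "b i - (\<Sum>j\<in>E. ?\<epsilon> j ^ p * b j) =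
      ?\<tau> ^ p * (b i - (\<Sum>j\<in>insert e E. \<delta> j ^ p * b j)) + \<delta> e ^ p * (?\<tau> ^ p * b e - (\<Sum>j\<in>E. \<epsilon> j ^ p * b j))"
    proof -
      have "(\<Sum>j\<in>E. ?\<epsilon> j ^ p * b j) = \<epsilon> e ^ p * b i + ?\<tau> ^ p * (\<Sum>j\<in>E. \<delta> j ^ p * b j) +
          \<delta> e ^ p * (\<Sum>j\<in>E. \<epsilon> j ^ p * b j)"
        using i insert.hyps p_ge_2
        by (simp add: frob power_mult_distrib distrib_right sum.distrib sum_distrib_left mult.assoc
          if_distrib[of "\<lambda>u. u ^ p"] if_distrib[of "\<lambda>u. u * _"] sum.delta power_0_left cong: if_cong)
      then show ?thesis using insert.hyps by (simp add: \<tau>p algebra_simps)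
    qed
    moreover have "\<dots> \<in> N"
      using \<delta>(1)[of e] \<mm>_subset_T by (intro N_add N_mult \<tau> \<delta>(2) be) auto
    ultimately show ?thesis by (intro exI[of _ ?\<epsilon>]) auto
  qed
  from insert.IH[OF this] obtain \<sigma> where \<sigma>: "\<sigma> \<in> T" "\<sigma> - 1 \<in> \<mm> 1" "\<And>i. i \<in> E \<Longrightarrow> \<sigma> ^ p * b i \<in> N"
    by blast
  have "\<sigma> * ?\<tau> \<in> T" using \<sigma> \<tau> by (intro T.mult)
  moreover have "\<sigma> * ?\<tau> - 1 \<in> \<mm> 1"
  proof -
    have "(\<sigma> - 1) - \<sigma> * \<epsilon> e \<in> \<mm> 1" 
      by (rule \<mm>_diff[OF \<sigma>(2) \<mm>_T_mult[OF \<sigma>(1) \<epsilon>(1)]]) simp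
    then show ?thesis by (simp add: algebra_simps)
  qed
  moreover have "(\<sigma> * ?\<tau>) ^ p * b i \<in> N" if "i \<in> insert e E" for i
  proof (cases "i \<in> E")
    case True
    from N_mult[OF \<tau> \<sigma>(3)[OF this]] have "?\<tau> ^ p * (\<sigma> ^ p * b i) \<in> N" .
    then show ?thesis by (simp add: power_mult_distrib mult_ac)
  next
    case False
    \<comment> \<open>\<open>N\<close> is not assumed to contain 0, so the terms are added one by
      one to a given element of \<open>N\<close>.\<close>
    have sum_N: "c + (\<Sum>j\<in>F. \<epsilon> j ^ p * (\<sigma> ^ p * b j)) \<in> N" if "c \<in> N" "F \<subseteq> E" for c F
      using finite_subset[OF that(2) insert.hyps(1)] that
    proof (induction F arbitrary: c)
      case (insert j F)
      have "c + \<epsilon> j ^ p * (\<sigma> ^ p * b j) \<in> N"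
        using insert.prems by (intro N_add N_mult[OF \<epsilon>T \<sigma>(3)]) auto
      from insert.IH[OF this] insert.prems insert.hyps show ?case by (simp add: add.assoc)
    qed simp
    have "\<sigma> ^ p * (?\<tau> ^ p * b e - (\<Sum>j\<in>E. \<epsilon> j ^ p * b j)) \<in> N" using \<sigma> be by (intro N_mult)
    from sum_N[OF this subset_refl] have "(\<sigma> * ?\<tau>) ^ p * b e \<in> N"
      unfolding power_mult_distrib[of \<sigma> ?\<tau>]
      by (simp only: right_diff_distrib[of "\<sigma> ^ p"] sum_distrib_left mult.assoc
        mult.left_commute[of "\<sigma> ^ p" "_ ^ p"] diff_add_cancel)
    then show ?thesis using False that by auto
  qed
  ultimately show ?case by (intro bexI[of _ "\<sigma> * ?\<tau>"]) auto
qed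

end

context frobenius_rigid
begin

text \<open>The restricted monomials generate \<open>T\<close> over its p-th powers. By density each
  of them lies in \<open>S\<close> up to an element of \<open>\<mm>_frob\<close>, that is, up to a
  combination of restricted monomials whose coefficients are p-th powers of elements of
  \<open>\<mm> 1\<close>. This is the hypothesis of the elimination with
  \<open>N = S\<close>.\<close>

theorem localized_p_basis: "\<exists>\<sigma>\<in>T. \<sigma> - 1 \<in> \<mm> 1 \<and> (\<forall>t\<in>T. \<sigma> ^ p * t \<in> S)"
proof -
  let ?E = "\<Pi>\<^sub>E l\<in>L. {..<p}"
  let ?b = "ring_mono L w"
  have fin: "finite ?E" using finite_L by (intro finite_PiE) auto
  have "\<exists>\<epsilon>. (\<forall>J\<in>?E. \<epsilon> J \<in> \<mm> 1) \<and> ?b I - (\<Sum>J\<in>?E. \<epsilon> J ^ p * ?b J) \<in> S" for I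
  proof -
    have "?b I \<in> T" by (intro T_mono T.var)
    \<comment> \<open>One more than the pigeonhole bound, so that the error lies in
      \<open>\<mm>_frob\<close>.\<close>
    then obtain s where s: "s \<in> S" "?b I - s \<in> \<mm> (card L * (p - 1) + 1)" using T_S_decomp by blast
    have "?b (\<lambda>_. 0) * (?b I - s) \<in> \<mm>_frob" using s by (intro ring_mono_\<mm>_subset_\<mm>_frob) auto
    then have "?b I - s \<in> \<mm>_frob" by (simp add: ring_mono_def)
    then obtain t where t: "\<forall>l\<in>L. t l \<in> T" "?b I - s = (\<Sum>l\<in>L. w l ^ p * t l)"
      by (auto simp: \<mm>_frob_def)
    have "\<exists>r. (\<forall>J. r J \<in> T) \<and> t l = (\<Sum>J\<in>?E. ?b J * r J ^ p)" if "l \<in> L" for l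
      using T_restricted[of "t l"] t(1) that unfolding restricted_def by blast
    then obtain r where r: "\<And>l J. l \<in> L \<Longrightarrow> r l J \<in> T" "\<And>l. l \<in> L \<Longrightarrow> t l = (\<Sum>J\<in>?E. ?b J * r l J ^ p)"
      by metis
    let ?\<epsilon> = "\<lambda>J. \<Sum>l\<in>L. w l * r l J"
    have "?b I - s = (\<Sum>J\<in>?E. ?\<epsilon> J ^ p * ?b J)"
      unfolding t(2) frob_sum power_mult_distrib sum_distrib_right
      by (subst sum.swap) (auto intro!: sum.cong simp: r(2) sum_distrib_left mult_ac)
    then have "?b I - (\<Sum>J\<in>?E. ?\<epsilon> J ^ p * ?b J) = s" by (simp add: algebra_simps)
    moreover have "?\<epsilon> J \<in> \<mm> 1" for J using \<mm>_SucI[of "\<lambda>l. r l J" 0] r by simp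
    ultimately show ?thesis using s by (intro exI[of _ ?\<epsilon>]) auto
  qed
  then obtain \<sigma> where \<sigma>: "\<sigma> \<in> T" "\<sigma> - 1 \<in> \<mm> 1" "\<And>I. I \<in> ?E \<Longrightarrow> \<sigma> ^ p * ?b I \<in> S"
    using nakayama_elimination[of S ?E ?b] fin S.add S.mult[OF S.pow] by blast
  have "\<sigma> ^ p * t \<in> S" if t: "t \<in> T" for t
  proof -
    obtain r where r: "\<forall>J. r J \<in> T" "t = (\<Sum>J\<in>?E. ?b J * r J ^ p)"
      using T_restricted[OF t] unfolding restricted_def by blast
    have "\<sigma> ^ p * t = (\<Sum>J\<in>?E. (\<sigma> ^ p * ?b J) * r J ^ p)"
      by (simp add: r(2) sum_distrib_left mult_ac)
    also have "\<dots> \<in> S" using r by (intro S_sum S.mult[OF \<sigma>(3) S.pow]) auto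
    finally show ?thesis .
  qed
  with \<sigma> show ?thesis by blast
qed

end

subsection \<open>Rigid families of functions\<close>

lemma power_fun_apply: "(f ^ n) x = f x ^ n" for f :: "'x \<Rightarrow> 'a::comm_ring_1"
  by (induction n) auto

text \<open>
  The ring is that of functions of a pair \<open>(x, x')\<close>: \<open>x\<close> is a base point, all functions of
  \<open>x\<close> count as constants, and \<open>w l\<close> is the local coordinate \<open>y l\<close> centred at \<open>x\<close>.
\<close>

locale function_family =
  fixes y :: "'l \<Rightarrow> 'x \<Rightarrow> 'k::alg_closed_field" and L L0 :: "'l set" and p :: nat
  assumes prime_p': "prime p" and CHAR_k: "CHAR('k) = p"
    and finite_L': "finite L" and L0_subset': "L0 \<subseteq> L"
begin

definition K0 :: "('x \<Rightarrow> 'x \<Rightarrow> 'k) set" where "K0 = range (\<lambda>\<kappa> x x'. \<kappa> x)"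

definition w :: "'l \<Rightarrow> 'x \<Rightarrow> 'x \<Rightarrow> 'k" where "w l x x' = y l x' - y l x"

lemma K0I: "(\<lambda>x x'. \<kappa> x) \<in> K0" unfolding K0_def by (rule rangeI)

lemma frob_fun: "(a + b) ^ p = a ^ p + b ^ p" for a b :: "'x \<Rightarrow> 'x \<Rightarrow> 'k"
proof -
  have "(s + t) ^ p = s ^ p + t ^ p" for s t :: 'k
    using freshmans_dream[where 'a='k] prime_p' CHAR_k by auto
  then show ?thesis by (simp add: fun_eq_iff power_fun_apply)
qed

sublocale frobenius_generated K0 w L L0 p
proof
  show "prime p" "finite L" "L0 \<subseteq> L" by (fact prime_p' finite_L' L0_subset')+
  show "(a + b) ^ p = a ^ p + b ^ p" for a b :: "'x \<Rightarrow> 'x \<Rightarrow> 'k" by (rule frob_fun)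
  show "1 \<in> K0" using K0I[of "\<lambda>_. 1"] by (simp add: one_fun_def)
  show "-1 \<in> K0" using K0I[of "\<lambda>_. -1"] by (simp add: one_fun_def fun_Compl_def)
  show "a + b \<in> K0" "a * b \<in> K0" if ab: "a \<in> K0" "b \<in> K0" for a b
  proof -
    obtain \<kappa> \<kappa>' where "a = (\<lambda>x x'. \<kappa> x)" "b = (\<lambda>x x'. \<kappa>' x)" using ab unfolding K0_def by blast
    then show "a + b \<in> K0" "a * b \<in> K0"
      using K0I[of "\<lambda>x. \<kappa> x + \<kappa>' x"] K0I[of "\<lambda>x. \<kappa> x * \<kappa>' x"]
      by (simp_all add: plus_fun_def times_fun_def)
  qed
  \<comment> \<open>\<open>K0\<close> contains all functions of x, polynomial or not, so roots may
    be chosen point by point.\<close>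
  show "\<exists>b\<in>K0. a = b ^ p" if a: "a \<in> K0" for a
  proof -
    obtain \<kappa> where \<kappa>: "a = (\<lambda>x x'. \<kappa> x)" using a unfolding K0_def by blast
    have "\<exists>b. b ^ p = \<kappa> x" for x
      using nth_root_exists[of p "\<kappa> x"] prime_p' prime_gt_0_nat by auto
    then obtain \<kappa>' where "\<And>x. \<kappa>' x ^ p = \<kappa> x" by metis
    then have "a = (\<lambda>x x'. \<kappa>' x) ^ p" by (simp add: \<kappa> fun_eq_iff power_fun_apply)
    then show ?thesis using K0I by blast
  qed
qed

lemma y_in_T: "l \<in> L \<Longrightarrow> (\<lambda>x x'. y l x') \<in> T"
proof -
  assume "l \<in> L"
  then have "(\<lambda>x x'. y l x) + w l \<in> T" by (intro T.add T.var T.const K0I)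
  moreover have "(\<lambda>x x'. y l x) + w l = (\<lambda>x x'. y l x')" by (simp add: fun_eq_iff w_def)
  ultimately show ?thesis by simp
qed

lemma ring_mono_apply: "ring_mono M v I x x' = (\<Prod>l\<in>M. v l x x' ^ I l)"
  for v :: "'m \<Rightarrow> 'x \<Rightarrow> 'x \<Rightarrow> 'k"
  unfolding ring_mono_def by (induction M rule: infinite_finite_induct) (auto simp: power_fun_apply)

lemma mono_fun_in_T: "(\<lambda>x x'. mono_fun L y I x') \<in> T"
proof -
  have "ring_mono L (\<lambda>l x x'. y l x') I \<in> T" by (intro T_mono y_in_T)
  moreover have "ring_mono L (\<lambda>l (x :: 'x) x'. y l x') I = (\<lambda>x x'. mono_fun L y I x')"
    by (simp add: fun_eq_iff ring_mono_apply mono_fun_def)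
  ultimately show ?thesis by simp
qed

text \<open>The bound is uniform in the base point: an element of \<open>T\<close> is a single
  expression in the \<open>w l\<close> whose constants vary with x, and its degree in the second
  argument does not.\<close>

lemma T_polys_le: "t \<in> T \<Longrightarrow> \<exists>N. \<forall>x. t x \<in> polys_le L y N"
proof (induction rule: T.induct)
  case (const a)
  then show ?case by (auto simp: K0_def polys_le_const)
next
  case (var l)
  have "w l x \<in> polys_le L y 1" for x
    unfolding w_def using var finite_L by (intro polys_le_diff polys_le_var polys_le_const) auto
  then show ?case by blast
next
  case (add a b)
  then obtain N M where "\<And>x. a x \<in> polys_le L y N" "\<And>x. b x \<in> polys_le L y M" by blast
  then have "a x \<in> polys_le L y (max N M)" "b x \<in> polys_le L y (max N M)" for x
    using polys_le_mono[OF max.cobounded1] polys_le_mono[OF max.cobounded2] by metis+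
  from polys_le_add[OF this] show ?case by (auto simp: plus_fun_def)
next
  case (mult a b)
  then obtain N M where "\<And>x. a x \<in> polys_le L y N" "\<And>x. b x \<in> polys_le L y M" by blast
  from polys_le_mult[OF this] show ?case by (auto simp: times_fun_def)
qed

lemma finite_T_polys_le:
  assumes "finite F" "F \<subseteq> T"
  shows "\<exists>N. \<forall>t\<in>F. \<forall>x. t x \<in> polys_le L y N"
  using assms
proof (induction F)
  case (insert t F)
  then obtain N M where N: "\<forall>t\<in>F. \<forall>x. t x \<in> polys_le L y N" and M: "\<forall>x. t x \<in> polys_le L y M"
    using T_polys_le[of t] by auto
  show ?case
  proof (intro exI ballI allI)
    fix s x assume "s \<in> insert t F"
    then show "s x \<in> polys_le L y (max N M)"
    proof
      assume "s = t"
      then show ?thesis by (simp only: polys_le_mono[OF max.cobounded2 M[rule_format]])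
    next
      assume "s \<in> F"
      then show ?thesis by (rule polys_le_mono[OF max.cobounded1 N[rule_format]])
    qed
  qed
qed simp

lemma \<mm>_1_diagonal: "t \<in> \<mm> 1 \<Longrightarrow> t x x = 0"
proof -
  assume "t \<in> \<mm> 1"
  then have "t \<in> \<mm> (Suc 0)" by simp
  then obtain n where "t = (\<Sum>l\<in>L. w l * n l)" by (rule \<mm>_SucE) blast
  then show ?thesis by (simp add: sum_fun_apply w_def)
qed

text \<open>For a base point x the localized p-basis gives growth of order \<open>card L0\<close> on
  the locus where \<open>\<sigma> x\<close> is nonzero, hence a relation there. Finitely many of
  these loci cover all points, and the relations are multiplied.\<close>

theorem algebraic_relation:
  assumes rigid: "\<And>l. l \<in> L \<Longrightarrow> \<exists>b. (\<forall>i. b i \<in> K0) \<and> w l - (\<Sum>i\<in>L0. b i * w i) \<in> \<mm> 2"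
    and Z: "finite Z" "card Z > card L0" "\<And>j. j \<in> Z \<Longrightarrow> z j \<in> polys_le L y \<kappa>"
  shows "\<exists>H\<in>nonzero_polyfuns Z. \<forall>x. H (\<lambda>j. z j x) = 0"
proof -
  interpret frobenius_rigid K0 w L L0 p by unfold_locales (rule rigid)
  obtain \<sigma> where \<sigma>: "\<sigma> \<in> T" "\<sigma> - 1 \<in> \<mm> 1" "\<And>t. t \<in> T \<Longrightarrow> \<sigma> ^ p * t \<in> S"
    using localized_p_basis by blast
  have \<sigma>_diag: "\<sigma> x x = 1" for x using \<mm>_1_diagonal[OF \<sigma>(2), of x] by simp
  let ?E = "\<Pi>\<^sub>E l\<in>L. {..<p}" and ?J = "\<Pi>\<^sub>E i\<in>L0. {..<p}"
  have fin_L0: "finite L0" using finite_L L0_subset finite_subset by blast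
  have fin: "finite ?E" "finite ?J" using finite_L fin_L0 by (auto intro!: finite_PiE)
  have "\<forall>I. \<exists>g. (\<forall>J. g J \<in> T) \<and> \<sigma> ^ p * (\<lambda>x x'. mono_fun L y I x') =
      (\<Sum>J\<in>?J. ring_mono L0 (\<lambda>i x x'. y i x') J * g J ^ p)"
    (is "\<forall>I. \<exists>g. ?A I g")
  proof
    fix I
    have "(\<lambda>x x'. y i x') - w i = (\<lambda>x x'. y i x)" for i by (simp add: fun_eq_iff w_def)
    then have "(\<lambda>x x'. y i x') - w i \<in> K0" for i using K0I[of "y i"] by simp
    from S_restricted[of "\<lambda>i x x'. y i x'", OF this \<sigma>(3)[OF mono_fun_in_T[of I]]]
    show "\<exists>g. ?A I g"
      unfolding restricted_def by blast
  qed
  from choice[OF this] obtain g where "\<forall>I. ?A I (g I)" by (rule exE)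
  then have g: "\<And>I J. g I J \<in> T" "\<And>I. \<sigma> ^ p * (\<lambda>x x'. mono_fun L y I x') =
      (\<Sum>J\<in>?J. ring_mono L0 (\<lambda>i x x'. y i x') J * g I J ^ p)" by simp_all
  have "finite ((\<lambda>(I, J). g I J) ` (?E \<times> ?J))" "(\<lambda>(I, J). g I J) ` (?E \<times> ?J) \<subseteq> T"
    using fin g(1) by auto
  from finite_T_polys_le[OF this] obtain C
    where C: "\<And>I J x. I \<in> ?E \<Longrightarrow> J \<in> ?J \<Longrightarrow> g I J x \<in> polys_le L y C" by fastforce
  have near: "\<exists>H\<in>nonzero_polyfuns Z. \<forall>x'. \<sigma> x x' \<noteq> 0 \<longrightarrow> H (\<lambda>j. z j x') = 0" for x
  proof -
    \<comment> \<open>Points where the denominator vanishes are sent to the base point, where it is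
      1.\<close>
    define \<rho> where "\<rho> x' = (if \<sigma> x x' \<noteq> 0 then x' else x)" for x'
    have nz: "\<sigma> x (\<rho> x') \<noteq> 0" for x' using \<sigma>_diag[of x] by (simp add: \<rho>_def)
    have pbasis: "\<exists>h. (\<forall>J. h J \<in> polys_le L (\<lambda>l x'. y l (\<rho> x')) C) \<and>
        (\<forall>x'. \<sigma> x (\<rho> x') ^ p * mono_fun L (\<lambda>l x'. y l (\<rho> x')) I x' =
          (\<Sum>J\<in>?J. mono_fun L0 (\<lambda>l x'. y l (\<rho> x')) J x' * h J x' ^ p))"
      if I: "I \<in> ?E" for I
    proof (intro exI conjI allI)
      let ?h = "\<lambda>J x'. if J \<in> ?J then g I J x (\<rho> x') else 0"
      show "?h J \<in> polys_le L (\<lambda>l x'. y l (\<rho> x')) C" for J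
        using polys_le_comp[OF C[OF I, of J x], of \<rho>] by (cases "J \<in> ?J") (simp_all add: polys_le_const)
      show "\<sigma> x (\<rho> x') ^ p * mono_fun L (\<lambda>l x'. y l (\<rho> x')) I x' =
          (\<Sum>J\<in>?J. mono_fun L0 (\<lambda>l x'. y l (\<rho> x')) J x' * ?h J x' ^ p)" for x'
        using fun_cong[OF fun_cong[OF g(2)[of I], of x], of "\<rho> x'"]
        by (simp add: mono_fun_def sum_fun_apply ring_mono_apply power_fun_apply)
    qed
    obtain D where D: "\<And>s. spanned_by_at_most (D * p ^ (s * card L0)) (polys_le L (\<lambda>l x'. y l (\<rho> x')) (p ^ s))"
      using polys_le_growth[OF prime_p CHAR_k finite_L fin_L0 nz pbasis] by blast
    have z: "(\<lambda>x'. z j (\<rho> x')) \<in> polys_le L (\<lambda>l x'. y l (\<rho> x')) \<kappa>" if j: "j \<in> Z" for j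
      by (rule polys_le_comp[OF Z(3)[OF j]])
    obtain H where H: "H \<in> nonzero_polyfuns Z" "\<forall>x'. H (\<lambda>j. z j (\<rho> x')) = 0"
      using algebraic_relation_of_growth[where z = "\<lambda>j x'. z j (\<rho> x')", OF prime_p D Z(1,2) z] by auto
    have "H (\<lambda>j. z j x') = 0" if "\<sigma> x x' \<noteq> 0" for x' using H(2)[rule_format, of x'] that by (simp add: \<rho>_def)
    with H(1) show ?thesis by (intro bexI[of _ H]) auto
  qed
  have "\<forall>x. \<exists>H. H \<in> nonzero_polyfuns Z \<and> (\<forall>x'. \<sigma> x x' \<noteq> 0 \<longrightarrow> H (\<lambda>j. z j x') = 0)"
    using near unfolding Bex_def by (rule allI)
  from choice[OF this] obtain H
    where "\<forall>x. H x \<in> nonzero_polyfuns Z \<and> (\<forall>x'. \<sigma> x x' \<noteq> 0 \<longrightarrow> H x (\<lambda>j. z j x') = 0)" by (rule exE)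
  then have H: "\<And>x. H x \<in> nonzero_polyfuns Z" "\<And>x x'. \<sigma> x x' \<noteq> 0 \<Longrightarrow> H x (\<lambda>j. z j x') = 0"
    by simp_all
  obtain N where N: "\<And>x. \<sigma> x \<in> polys_le L y N" using T_polys_le[OF \<sigma>(1)] by blast
  obtain B where B: "finite B" "polys_le L y N \<subseteq> fsp.span B" using polys_le_finite_dim[OF finite_L] by blast
  \<comment> \<open>All \<open>\<sigma> x\<close> lie in one finite-dimensional space, so finitely
    many span the rest. If all of those vanished at x', so would \<open>\<sigma> x'\<close>, whose
    value at x' is 1.\<close>
  obtain B' where B': "B' \<subseteq> range \<sigma>" "fsp.independent B'" "range \<sigma> \<subseteq> fsp.span B'"
    using fsp.maximal_independent_subset[of "range \<sigma>"] by blast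
  have "finite B'" using fsp.independent_span_bound[OF B(1) B'(2)] B' N B(2) by blast
  then obtain X where X: "finite X" "B' = \<sigma> ` X" using finite_subset_image[OF _ B'(1)] by blast
  have cover: "\<exists>x\<in>X. \<sigma> x x' \<noteq> 0" for x'
  proof (rule ccontr)
    assume "\<not> ?thesis"
    then have zero: "\<And>b. b \<in> B' \<Longrightarrow> b x' = 0" using X by auto
    have "f x' = 0" if "f \<in> fsp.span B'" for f
      using that by (induction f rule: fsp.span_induct_alt) (auto simp: zero)
    then have "\<sigma> x' x' = 0" using B'(3) by auto
    then show False by (simp add: \<sigma>_diag)
  qed
  have "(\<lambda>a. \<Prod>x\<in>X. H x a) \<in> nonzero_polyfuns Z" using X(1) H(1) by (intro nonzero_polyfuns_prod)
  moreover have "(\<Prod>x\<in>X. H x (\<lambda>j. z j x')) = 0" for x'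
    using cover[of x'] H(2) X(1) by (auto simp: prod_zero_iff)
  ultimately show ?thesis by (intro bexI[of _ "\<lambda>a. \<Prod>x\<in>X. H x a"]) auto
qed

end

subsection \<open>Infinitesimal rigidity of ramified maps\<close>

lemma linear_power_dvd_mult_cancel:
  fixes q r :: "'k::field poly"
  assumes "poly r a \<noteq> 0" "[:-a, 1:] ^ m dvd q * r"
  shows "[:-a, 1:] ^ m dvd q"
proof (cases "q = 0")
  case False
  have "r \<noteq> 0" using assms by auto
  then have "order a (q * r) = order a q" using False assms by (simp add: order_mult order_root)
  then show ?thesis using assms(2) False \<open>r \<noteq> 0\<close> by (simp add: order_divides)
qed simp

lemma prod_linear_powers_dvd:
  fixes a :: "'i \<Rightarrow> 'k::field"
  assumes "finite A" "inj_on a A" "\<And>i. i \<in> A \<Longrightarrow> [:-a i, 1:] ^ m i dvd q"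
  shows "(\<Prod>i\<in>A. [:-a i, 1:] ^ m i) dvd q"
  using assms
proof (induction A)
  case (insert i A)
  then obtain r where r: "q = (\<Prod>j\<in>A. [:-a j, 1:] ^ m j) * r" by (auto elim: dvdE)
  have "poly (\<Prod>j\<in>A. [:-a j, 1:] ^ m j) (a i) \<noteq> 0"
    using insert by (auto simp: poly_prod)
  then have "[:-a i, 1:] ^ m i dvd r"
    using linear_power_dvd_mult_cancel[of _ "a i" "m i" r] insert.prems(2)[of i] by (simp add: r mult.commute)
  then show ?case using insert by (simp add: r mult_dvd_mono mult.commute)
qed simp

text \<open>The roots of \<open>F\<close> are split off one at a time; none is a root of
  \<open>G\<close>, so each must be a root of \<open>H\<close>.\<close>

lemma dvd_mult_cancel_no_common_root:
  fixes F G H :: "'k::alg_closed_field poly"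
  assumes "F \<noteq> 0" "\<And>t. poly F t \<noteq> 0 \<or> poly G t \<noteq> 0" "F dvd H * G"
  shows "F dvd H"
  using assms
proof (induction "degree F" arbitrary: F H)
  case 0
  then show ?case by (metis degree_eq_zeroE dvd_field_iff is_unit_const_poly_iff pCons_0_0 unit_imp_dvd)
next
  case (Suc m)
  then obtain t where t: "poly F t = 0" using alg_closed_imp_poly_has_root[of F] by auto
  then obtain F1 where F1: "F = [:-t, 1:] * F1" by (auto simp: poly_eq_0_iff_dvd)
  have "F1 \<noteq> 0" using F1 Suc.prems by auto
  then have deg: "degree F = Suc (degree F1)" unfolding F1 by (subst degree_mult_eq) auto
  have "[:-t, 1:] dvd H * G" using Suc.prems(3) unfolding F1 by (rule dvd_mult_left)
  then have "poly H t = 0" using Suc.prems(2)[of t] t by (simp add: poly_eq_0_iff_dvd[symmetric])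
  then obtain H1 where H1: "H = [:-t, 1:] * H1" by (auto simp: poly_eq_0_iff_dvd)
  have "F1 dvd H1 * G"
    using Suc.prems(3) unfolding F1 H1 mult.assoc by (subst (asm) dvd_mult_cancel_left) auto
  moreover have "poly F1 s \<noteq> 0 \<or> poly G s \<noteq> 0" for s
    using Suc.prems(2)[of s] unfolding F1 poly_mult by auto
  moreover have "m = degree F1" using Suc.hyps(2) deg by simp
  ultimately have "F1 dvd H1" using Suc.hyps(1)[of F1 H1] \<open>F1 \<noteq> 0\<close> by blast
  then show ?case unfolding F1 H1 by (rule mult_dvd_mono[OF dvd_refl])
qed

lemma degree_prod_linear_powers:
  "degree (\<Prod>i\<in>A. [:-a i, 1:] ^ m i) = (\<Sum>i\<in>A. m i)" for a :: "'i \<Rightarrow> 'k::field"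
  by (subst degree_prod_eq_sum_degree) (auto simp: degree_linear_power)

text \<open>
  The Wronskian-like form \<open>N\<close> of a first-order deformation fixing the branch points is divisible
  by \<open>\<Prod>i. (T - a i) ^ (e i - 1)\<close>, of degree \<open>2 d - 2\<close>, and by \<open>T ^ 3\<close> because of the
  normalization at \<open>0\<close>; its degree is at most \<open>2 d\<close>.
\<close>

lemma infinitesimal_rigidity:
  fixes F G F' G' :: "'k::alg_closed_field poly" and d n :: nat and e :: "nat \<Rightarrow> nat"
  assumes deg: "degree F \<le> d" "degree G \<le> d" "degree F' \<le> d" "degree G' \<le> d"
    and cop: "\<And>t. poly F t \<noteq> 0 \<or> poly G t \<noteq> 0" and top: "coeff F d \<noteq> 0 \<or> coeff G d \<noteq> 0"
    and norm: "coeff F 0 = 0" "coeff F 1 = 1" "coeff G 0 = 1"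
    and norm': "coeff F' 0 = 0" "coeff F' 1 = 0" "coeff G' 0 = 0" "coeff G' 1 = coeff F' 2"
    and d: "d > 0" and sum_e: "(\<Sum>i<n. e i - 1) = 2 * d - 2"
    and e: "\<And>i. i < n \<Longrightarrow> e i > 0" "\<And>i. i < n \<Longrightarrow> of_nat (e i) \<noteq> (0 :: 'k)"
    and a: "inj_on a {..<n}" "\<And>i. i < n \<Longrightarrow> a i \<noteq> 0"
    and ram: "\<And>i. i < n \<Longrightarrow> F - smult (u i) (G + smult c F) = [:-a i, 1:] ^ e i * K i"
    and K: "\<And>i. i < n \<Longrightarrow> poly (K i) (a i) \<noteq> 0"
    and ram': "\<And>i. i < n \<Longrightarrow> F' - smult (u i) (G' + smult c F') =
      [:-a i, 1:] ^ e i * K' i - smult (of_nat (e i) * a' i) ([:-a i, 1:] ^ (e i - 1) * K i)"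
  shows "F' = 0" "G' = 0" "\<And>i. i < n \<Longrightarrow> a' i = 0 \<and> K' i = 0"
proof -
  define N where "N = F' * G - F * G'"
  have split_pow: "[:-a i, 1:] ^ e i = [:-a i, 1:] ^ (e i - 1) * [:-a i, 1:]" if "i < n" for i
    using e(1)[OF that] by (metis Suc_diff_1 power_Suc2)
  have "[:-a i, 1:] ^ (e i - 1) dvd N" if i: "i < n" for i
  proof -
    have 1: "[:-a i, 1:] ^ (e i - 1) dvd F - smult (u i) (G + smult c F)"
      unfolding ram[OF i] split_pow[OF i] mult.assoc by (rule dvd_triv_left)
    have 2: "[:-a i, 1:] ^ (e i - 1) dvd F' - smult (u i) (G' + smult c F')"
      unfolding ram'[OF i] split_pow[OF i] mult.assoc by (intro dvd_diff dvd_smult dvd_triv_left)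
    \<comment> \<open>\<open>N\<close> is a determinant, unchanged when \<open>G\<close> is replaced
      by \<open>G + c F\<close> and then \<open>F\<close> by \<open>F - u (G + c F)\<close>, with
      the same row operations on the primed forms.\<close>
    have "N = (F' - smult (u i) (G' + smult c F')) * (G + smult c F) -
        (F - smult (u i) (G + smult c F)) * (G' + smult c F')"
      by (simp add: N_def algebra_simps)
    then show ?thesis using 1 2 by (metis dvd_diff dvd_mult2)
  qed
  then have 1: "(\<Prod>i<n. [:-a i, 1:] ^ (e i - 1)) dvd N" using a by (intro prod_linear_powers_dvd) auto
  \<comment> \<open>For \<open>k = 2\<close> the coefficient reduces to
    \<open>coeff F' 2 - coeff G' 1\<close>, which is why the normalization ties these two
    together.\<close>
  have "coeff N k = 0" if "k < 3" for k
  proof -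
    have "k = 0 \<or> k = 1 \<or> k = 2" using that by auto
    then show ?thesis
      using norm norm' by (auto simp: N_def coeff_mult numeral_2_eq_2)
  qed
  then have 2: "[:-0, 1:] ^ 3 dvd N" by (simp add: monom_1_dvd_iff' monom_altdef[symmetric, of 1, simplified])
  have dvd: "[:-0, 1:] ^ 3 * (\<Prod>i<n. [:-a i, 1:] ^ (e i - 1)) dvd N"
  proof -
    obtain r where r: "N = r * (\<Prod>i<n. [:-a i, 1:] ^ (e i - 1))" using 1 by (metis dvdE mult.commute)
    have "poly (\<Prod>i<n. [:-a i, 1:] ^ (e i - 1)) 0 \<noteq> 0" using a(2) by (simp add: poly_prod)
    from linear_power_dvd_mult_cancel[OF this 2[unfolded r]] show ?thesis
      unfolding r by (rule mult_dvd_mono[OF _ dvd_refl])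
  qed
  have "N = 0"
  proof (rule ccontr)
    assume "N \<noteq> 0"
    from dvd_imp_degree_le[OF dvd this]
    have "3 + (2 * d - 2) \<le> degree N"
      by (subst (asm) degree_mult_eq) (auto simp: degree_prod_linear_powers sum_e[unfolded One_nat_def] degree_linear_power simp del: minus_zero)
    moreover have "degree N \<le> d + d"
      unfolding N_def using deg by (intro degree_diff_le order.trans[OF degree_mult_le]) auto
    ultimately show False using d by simp
  qed
  then have eq: "F' * G = F * G'" by (simp add: N_def)
  have nz: "F \<noteq> 0" "G \<noteq> 0" using norm by auto
  have "F dvd F' * G" "G dvd G' * F" by (simp_all add: eq) (simp flip: eq add: mult.commute)
  then have dvds: "F dvd F'" "G dvd G'"
    using cop nz dvd_mult_cancel_no_common_root[of F G F'] dvd_mult_cancel_no_common_root[of G F G'] by blast+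
  have const_mult: "\<exists>t. B = smult t A" if AB: "A dvd B" "degree B \<le> d" "coeff A d \<noteq> 0" for A B :: "'k poly"
  proof (cases "B = 0")
    case False
    obtain q where q: "B = A * q" using AB(1) by (auto elim: dvdE)
    have "degree A \<ge> d" using AB(3) by (rule le_degree)
    moreover have "A \<noteq> 0" "q \<noteq> 0" using False q by auto
    then have "degree B = degree A + degree q" using q by (simp add: degree_mult_eq)
    ultimately have "degree q = 0" using AB(2) by simp
    then obtain t where "q = [:t:]" by (rule degree_eq_zeroE)
    then show ?thesis using q by (intro exI[of _ t]) simp
  qed (auto intro: exI[of _ 0])
  \<comment> \<open>Only a form of full degree d forces its multiple of degree at most d to be a
    scalar one. \<open>top\<close> provides such a form, the normalization makes the scalar 0, and
    \<open>F' G = F G'\<close> settles the other form.\<close>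
  have F'G': "F' = 0 \<and> G' = 0"
    using top
  proof
    assume "coeff F d \<noteq> 0"
    then obtain t where t: "F' = smult t F" using const_mult dvds deg by blast
    have "t = 0" using norm(2) norm'(2) by (simp add: t)
    then show ?thesis using t eq nz by simp
  next
    assume "coeff G d \<noteq> 0"
    then obtain t where t: "G' = smult t G" using const_mult dvds deg by blast
    have "t = 0" using norm(3) norm'(3) by (simp add: t)
    then show ?thesis using t eq nz by simp
  qed
  then show "F' = 0" "G' = 0" by auto
  show "a' i = 0 \<and> K' i = 0" if i: "i < n" for i
  proof -
    have "[:-a i, 1:] ^ e i * K' i = smult (of_nat (e i) * a' i) ([:-a i, 1:] ^ (e i - 1) * K i)"
      using ram'[OF i] F'G' by simp
    then have "[:-a i, 1:] ^ (e i - 1) * ([:-a i, 1:] * K' i) =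
        [:-a i, 1:] ^ (e i - 1) * smult (of_nat (e i) * a' i) (K i)"
      by (simp only: split_pow[OF i] mult.assoc mult_smult_right)
    then have eq: "[:-a i, 1:] * K' i = smult (of_nat (e i) * a' i) (K i)"
      by (simp only: mult_cancel_left) (metis pCons_eq_0_iff power_not_zero zero_neq_one)
    from arg_cong[OF this, of "\<lambda>q. poly q (a i)"] have "of_nat (e i) * a' i * poly (K i) (a i) = 0" by simp
    \<comment> \<open>Tameness: \<open>e i\<close> is invertible in k, so the ramification point
      cannot move while the map stays fixed to first order.\<close>
    then have "a' i = 0" using K[OF i] e(2)[OF i] by simp
    moreover have "[:-a i, 1:] * K' i = 0" unfolding eq \<open>a' i = 0\<close> by simp
    then have "K' i = 0" unfolding mult_eq_0_iff by simp
    ultimately show ?thesis by simp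
  qed
qed

text \<open>Turns a vanishing criterion into explicit coefficients. If some \<open>v0\<close> is
  dual to \<open>g i\<close> and killed by the other functionals, subtracting
  \<open>f v0 * g i\<close> removes \<open>g i\<close>; if there is none, \<open>g i\<close> already
  vanishes on the common kernel of the others.\<close>

lemma functional_in_span:
  fixes f :: "('l \<Rightarrow> 'k::field) \<Rightarrow> 'k"
  assumes "finite J"
    and "\<And>v v'. f (\<lambda>l. v l + v' l) = f v + f v'" "\<And>t v. f (\<lambda>l. t * v l) = t * f v"
    and "\<And>j v v'. j \<in> J \<Longrightarrow> g j (\<lambda>l. v l + v' l) = g j v + g j v'"
    and "\<And>j t v. j \<in> J \<Longrightarrow> g j (\<lambda>l. t * v l) = t * g j v"
    and "\<And>v. (\<And>j. j \<in> J \<Longrightarrow> g j v = 0) \<Longrightarrow> f v = 0"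
  shows "\<exists>c. \<forall>v. f v = (\<Sum>j\<in>J. c j * g j v)"
  using assms
proof (induction J arbitrary: f)
  case (insert i J)
  show ?case
  proof (cases "\<exists>v0. g i v0 = 1 \<and> (\<forall>j\<in>J. g j v0 = 0)")
    case True
    then obtain v0 where v0: "g i v0 = 1" "\<And>j. j \<in> J \<Longrightarrow> g j v0 = 0" by blast
    let ?f = "\<lambda>v. f v - f v0 * g i v"
    have "\<exists>c. \<forall>v. ?f v = (\<Sum>j\<in>J. c j * g j v)"
    proof (rule insert.IH)
      fix v assume v: "\<And>j. j \<in> J \<Longrightarrow> g j v = 0"
      let ?v = "\<lambda>l. v l + (- g i v) * v0 l"
      have "f ?v = 0"
      proof (rule insert.prems(5))
        fix j assume "j \<in> insert i J"
        then show "g j ?v = 0"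
          using insert.prems(3)[of j v "\<lambda>l. (- g i v) * v0 l"] insert.prems(4)[of j "- g i v" v0] v v0
          by auto
      qed
      then show "?f v = 0"
        using insert.prems(1)[of v "\<lambda>l. (- g i v) * v0 l"] insert.prems(2)[of "- g i v" v0] by simp
    next
      show "?f (\<lambda>l. v l + v' l) = ?f v + ?f v'" for v v'
        using insert.prems(1) insert.prems(3)[of i] by (simp add: algebra_simps)
      show "?f (\<lambda>l. t * v l) = t * ?f v" for t v
        using insert.prems(2) insert.prems(4)[of i] by (simp add: algebra_simps)
    qed (use insert.prems in auto)
    then obtain c where c: "\<And>v. ?f v = (\<Sum>j\<in>J. c j * g j v)" by blast
    have "f v = (\<Sum>j\<in>insert i J. (if j = i then f v0 else c j) * g j v)" for v
    proof -
      have "(\<Sum>j\<in>J. (if j = i then f v0 else c j) * g j v) = (\<Sum>j\<in>J. c j * g j v)"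
        using insert.hyps by (intro sum.cong) auto
      then show ?thesis using c[of v] insert.hyps by (simp add: algebra_simps)
    qed
    then show ?thesis by (intro exI[of _ "\<lambda>j. if j = i then f v0 else c j"] allI)
  next
    case False
    have "\<exists>c. \<forall>v. f v = (\<Sum>j\<in>J. c j * g j v)"
    proof (rule insert.IH)
      fix v assume v: "\<And>j. j \<in> J \<Longrightarrow> g j v = 0"
      have "g i v = 0"
      proof (rule ccontr)
        assume "g i v \<noteq> 0"
        then have "g i (\<lambda>l. inverse (g i v) * v l) = 1" "\<forall>j\<in>J. g j (\<lambda>l. inverse (g i v) * v l) = 0"
          using insert.prems(4) v by auto
        with False show False by blast
      qed
      then show "f v = 0" using insert.prems(5) v by blast
    qed (use insert.prems in auto)
    then obtain c where c: "\<And>v. f v = (\<Sum>j\<in>J. c j * g j v)" by blast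
    have "f v = (\<Sum>j\<in>insert i J. (if j = i then 0 else c j) * g j v)" for v
    proof -
      have "(\<Sum>j\<in>J. (if j = i then 0 else c j) * g j v) = (\<Sum>j\<in>J. c j * g j v)"
        using insert.hyps by (intro sum.cong) auto
      then show ?thesis using c[of v] insert.hyps by simp
    qed
    then show ?thesis by (intro exI[of _ "\<lambda>j. if j = i then 0 else c j"] allI)
  qed
qed auto

subsection \<open>The family of normalized ramified maps\<close>

text \<open>The difference of the ramification equations at two points, with the first-order terms
  on the left and the second-order terms on the right. The factor
  \<open>s - smult \<delta> s' + smult \<epsilon> q\<close> is the expansion of the power of T - a
  at the displaced point.\<close>

lemma taylor_ram_eq:
  fixes f g f' g' s s' k k' q :: "'k::comm_ring_1 poly"
  assumes "f - smult u (g + smult c f) = s * k"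
    and "f' - smult (u + \<nu>) (g' + smult c f') = (s - smult \<delta> s' + smult \<epsilon> q) * k'"
  shows "(f' - f) - smult u ((g' - g) + smult c (f' - f)) - smult \<nu> (g + smult c f) - s * (k' - k)
      + smult \<delta> (s' * k) =
    smult \<nu> ((g' - g) + smult c (f' - f)) - smult \<delta> (s' * (k' - k)) + smult \<epsilon> (q * (k + (k' - k)))"
    (is "?l = ?r")
proof -
  have "?l - ?r = (f' - smult (u + \<nu>) (g' + smult c f') - (s - smult \<delta> s' + smult \<epsilon> q) * k') -
      (f - smult u (g + smult c f) - s * k)"
    by (simp add: algebra_simps smult_add_right smult_diff_right smult_add_left)
  also have "\<dots> = 0" unfolding assms by simp
  finally show ?thesis by simp
qed

text \<open>The points, branch points and cofactors are coordinates along with the forms, so that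
  prescribed ramification becomes a system of polynomial equations that can be
  differentiated.\<close>

datatype coord = CU nat | CA nat | CF nat | CG nat | CK nat nat

text \<open>\<open>EQ i k\<close> is the k-th coefficient of the i-th ramification equation,
  \<open>EF0\<close> to \<open>EG1\<close> are the normalizations, and \<open>EU i\<close> equates a
  branch point with its representative. \<open>ER i\<close> is no equation of the family: it stands
  for the parameter \<open>u i\<close> with i in \<open>R\<close>.\<close>

datatype equation = EQ nat nat | EF0 | EF1 | EG0 | EG1 | EU nat | ER nat

text \<open>
  A family, parametrized by \<open>'x\<close>, of normalized maps \<open>[F : G]\<close> with ramification points \<open>a i\<close>
  and branch points \<open>u i\<close> in the target coordinate \<open>F / (G + c F)\<close>. Every branch point coincides
  with one indexed by \<open>R\<close>, so that \<open>card R\<close> bounds the dimension of the family.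
\<close>

locale ramified_family =
  fixes p n d :: nat and e :: "nat \<Rightarrow> nat"
    and a u :: "nat \<Rightarrow> 'x \<Rightarrow> 'k::alg_closed_field"
    and F G :: "'x \<Rightarrow> 'k poly" and K :: "nat \<Rightarrow> 'x \<Rightarrow> 'k poly" and c :: 'k
    and R :: "nat set" and r :: "nat \<Rightarrow> nat"
  assumes prime: "prime p" and CHAR_p: "CHAR('k) = p"
    and d_pos: "d > 0" and sum_e: "(\<Sum>i<n. e i - 1) = 2 * d - 2"
    and e_pos: "\<And>i. i < n \<Longrightarrow> e i > 0" and e_coprime: "\<And>i. i < n \<Longrightarrow> coprime (e i) p"
    and deg_F: "\<And>x. degree (F x) \<le> d" and deg_G: "\<And>x. degree (G x) \<le> d"
    and deg_K: "\<And>i x. i < n \<Longrightarrow> degree (K i x) \<le> d"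
    and no_common_root: "\<And>x t. poly (F x) t \<noteq> 0 \<or> poly (G x) t \<noteq> 0"
    and top: "\<And>x. coeff (F x) d \<noteq> 0 \<or> coeff (G x) d \<noteq> 0"
    and norm: "\<And>x. coeff (F x) 0 = 0" "\<And>x. coeff (F x) 1 = 1" "\<And>x. coeff (G x) 0 = 1"
      "\<And>x. coeff (G x) 1 = coeff (F x) 2"
    and a_inj: "\<And>x. inj_on (\<lambda>i. a i x) {..<n}" and a_nz: "\<And>i x. i < n \<Longrightarrow> a i x \<noteq> 0"
    and ram: "\<And>i x. i < n \<Longrightarrow>
      F x - smult (u i x) (G x + smult c (F x)) = [:-a i x, 1:] ^ e i * K i x"
    and K_nz: "\<And>i x. i < n \<Longrightarrow> poly (K i x) (a i x) \<noteq> 0"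
    and R: "R \<subseteq> {..<n}" and r: "\<And>i. i < n \<Longrightarrow> r i \<in> R" "\<And>i. i < n \<Longrightarrow> u i = u (r i)"
begin

fun y :: "coord \<Rightarrow> 'x \<Rightarrow> 'k" where
  "y (CU i) x = u i x"
| "y (CA i) x = a i x"
| "y (CF k) x = coeff (F x) k"
| "y (CG k) x = coeff (G x) k"
| "y (CK i k) x = coeff (K i x) k"

definition L :: "coord set" where
  "L = CU ` {..<n} \<union> CA ` {..<n} \<union> CF ` {..d} \<union> CG ` {..d} \<union> (\<lambda>(i, k). CK i k) ` ({..<n} \<times> {..d})"

lemma in_L [simp]:
  "CU i \<in> L \<longleftrightarrow> i < n" "CA i \<in> L \<longleftrightarrow> i < n" "CF k \<in> L \<longleftrightarrow> k \<le> d" "CG k \<in> L \<longleftrightarrow> k \<le> d"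
  "CK i k \<in> L \<longleftrightarrow> i < n \<and> k \<le> d"
  by (auto simp: L_def)

sublocale function_family y L "CU ` R" p
proof
  show "finite L" by (simp add: L_def)
  show "CU ` R \<subseteq> L" using R by auto
qed (fact prime CHAR_p)+

section \<open>The linearized equations and their injectivity\<close>

definition poly_of :: "(nat \<Rightarrow> coord) \<Rightarrow> (coord \<Rightarrow> 'k) \<Rightarrow> 'k poly" where
  "poly_of C v = (\<Sum>k\<le>d. monom (v (C k)) k)"

lemma coeff_poly_of: "coeff (poly_of C v) k = (if k \<le> d then v (C k) else 0)"
  by (simp add: poly_of_def coeff_sum sum.delta)

lemma degree_poly_of: "degree (poly_of C v) \<le> d"
  by (rule degree_le) (simp add: coeff_poly_of)

lemma poly_of_add: "poly_of C (\<lambda>l. v l + v' l) = poly_of C v + poly_of C v'"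
  by (simp add: poly_of_def add_monom[symmetric] sum.distrib)

lemma poly_of_scale: "poly_of C (\<lambda>l. t * v l) = smult t (poly_of C v)"
  by (rule poly_eqI) (simp add: coeff_poly_of)

text \<open>The derivative of the equation \<open>ram\<close> at \<open>x\<close> in the direction \<open>v\<close>.\<close>

definition lin_ram :: "'x \<Rightarrow> nat \<Rightarrow> (coord \<Rightarrow> 'k) \<Rightarrow> 'k poly" where
  "lin_ram x i v = poly_of CF v - smult (u i x) (poly_of CG v + smult c (poly_of CF v))
     - smult (v (CU i)) (G x + smult c (F x)) - [:-a i x, 1:] ^ e i * poly_of (CK i) v
     + smult (of_nat (e i) * v (CA i)) ([:-a i x, 1:] ^ (e i - 1) * K i x)"

text \<open>In \<open>EG1\<close> the coefficient is read from \<open>poly_of\<close>, so that it is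
  0 when d = 1, where \<open>CF 2\<close> is not a coordinate of the family.\<close>

fun lin :: "'x \<Rightarrow> equation \<Rightarrow> (coord \<Rightarrow> 'k) \<Rightarrow> 'k" where
  "lin x (EQ i k) v = coeff (lin_ram x i v) k"
| "lin x EF0 v = v (CF 0)"
| "lin x EF1 v = v (CF 1)"
| "lin x EG0 v = v (CG 0)"
| "lin x EG1 v = v (CG 1) - coeff (poly_of CF v) 2"
| "lin x (EU i) v = v (CU i) - v (CU (r i))"
| "lin x (ER i) v = v (CU i)"

lemma lin_add: "lin x j (\<lambda>l. v l + v' l) = lin x j v + lin x j v'"
  by (cases j) (simp_all add: lin_ram_def poly_of_add algebra_simps smult_add_right smult_add_left)

lemma lin_scale: "lin x j (\<lambda>l. t * v l) = t * lin x j v"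
  by (cases j) (simp_all add: lin_ram_def poly_of_scale algebra_simps smult_add_right smult_diff_right)

definition D :: nat where "D = d + (\<Sum>i<n. e i)"

definition J :: "equation set" where
  "J = (\<lambda>(i, k). EQ i k) ` ({..<n} \<times> {..D}) \<union> {EF0, EF1, EG0, EG1} \<union> EU ` {..<n}"

lemma degree_lin_ram:
  assumes "i < n"
  shows "degree (lin_ram x i v) \<le> D"
proof -
  have e: "e i \<le> (\<Sum>i<n. e i)" using assms by (intro member_le_sum) auto
  have "degree ([:-a i x, 1:] ^ e i * poly_of (CK i) v) \<le> D"
    using degree_poly_of[of "CK i" v] e
    by (intro order.trans[OF degree_mult_le]) (simp add: D_def degree_linear_power)
  moreover have "degree ([:-a i x, 1:] ^ (e i - 1) * K i x) \<le> D"
    using deg_K[OF assms, of x] e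
    by (intro order.trans[OF degree_mult_le]) (simp add: D_def degree_linear_power)
  moreover have "degree (poly_of C v) \<le> D" for C using degree_poly_of[of C v] by (simp add: D_def)
  moreover have "degree (F x) \<le> D" "degree (G x) \<le> D" using deg_F[of x] deg_G[of x] by (simp_all add: D_def)
  ultimately show ?thesis
    unfolding lin_ram_def
    by (intro degree_add_le degree_diff_le order.trans[OF degree_smult_le]) auto
qed

text \<open>A tangent vector is determined by its components along \<open>R\<close>: the equations
  \<open>EU\<close> carry vanishing from \<open>R\<close> to all branch points, and then
  \<open>infinitesimal_rigidity\<close> applies with the components of \<open>v\<close> as the
  deformation.\<close>

lemma lin_injective:
  assumes J: "\<And>j. j \<in> J \<Longrightarrow> lin x j v = 0" and R0: "\<And>i. i \<in> R \<Longrightarrow> v (CU i) = 0" and "l \<in> L"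
  shows "v l = 0"
proof -
  have U: "v (CU i) = 0" if "i < n" for i
    using J[of "EU i"] that R0[OF r(1)[OF that]] by (simp add: J_def)
  have lr: "lin_ram x i v = 0" if i: "i < n" for i
  proof (rule poly_eqI)
    fix k
    show "coeff (lin_ram x i v) k = coeff 0 k"
    proof (cases "k \<le> D")
      case True
      then have "EQ i k \<in> J" using i by (auto simp: J_def)
      then show ?thesis using J by fastforce
    next
      case False
      then show ?thesis using degree_lin_ram[OF i, of x v] by (simp add: coeff_eq_0)
    qed
  qed
  have ram': "poly_of CF v - smult (u i x) (poly_of CG v + smult c (poly_of CF v)) =
      [:-a i x, 1:] ^ e i * poly_of (CK i) v -
      smult (of_nat (e i) * v (CA i)) ([:-a i x, 1:] ^ (e i - 1) * K i x)" if i: "i < n" for i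
    using lr[OF i] unfolding lin_ram_def U[OF i] by (simp add: algebra_simps)
  have e_nz: "of_nat (e i) \<noteq> (0 :: 'k)" if i: "i < n" for i
  proof
    assume "of_nat (e i) = (0 :: 'k)"
    then have "p dvd e i" using CHAR_p by (simp add: of_nat_eq_0_iff_char_dvd)
    then show False using e_coprime[OF i] prime by (metis coprime_absorb_right not_prime_unit)
  qed
  have norm': "coeff (poly_of CF v) 0 = 0" "coeff (poly_of CF v) 1 = 0" "coeff (poly_of CG v) 0 = 0"
      "coeff (poly_of CG v) 1 = coeff (poly_of CF v) 2"
    using J[of EF0] J[of EF1] J[of EG0] J[of EG1] d_pos by (simp_all add: J_def coeff_poly_of)
  note rig = infinitesimal_rigidity[OF deg_F deg_G degree_poly_of degree_poly_of no_common_root top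
    norm(1-3) norm' d_pos sum_e e_pos e_nz a_inj a_nz ram K_nz ram']
  have "v l = 0" if "l = C k" "k \<le> d" "poly_of C v = 0" for C k
    using coeff_poly_of[of C v k] that by simp
  moreover have "poly_of CF v = 0" "poly_of CG v = 0" using rig(1,2) by blast+
  moreover have "v (CA i) = 0" "poly_of (CK i) v = 0" if "i < n" for i using rig(3) that by blast+
  ultimately show ?thesis using \<open>l \<in> L\<close> U by (cases l) auto
qed

text \<open>Smallness of polynomials, measured coefficientwise; orders add under
  multiplication.\<close>

definition pm :: "nat \<Rightarrow> ('x \<Rightarrow> 'x \<Rightarrow> 'k poly) set" where
  "pm j = {g. \<forall>k. (\<lambda>x x'. coeff (g x x') k) \<in> \<mm> j}"

lemma pm_add: "g \<in> pm j \<Longrightarrow> h \<in> pm j \<Longrightarrow> (\<lambda>x x'. g x x' + h x x') \<in> pm j"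
  unfolding pm_def using \<mm>_add by (fastforce simp: plus_fun_def)

lemma pm_diff: "g \<in> pm j \<Longrightarrow> h \<in> pm j \<Longrightarrow> (\<lambda>x x'. g x x' - h x x') \<in> pm j"
  unfolding pm_def using \<mm>_diff by (fastforce simp: fun_diff_def)

lemma pm_mult:
  assumes "g \<in> pm i" "h \<in> pm j"
  shows "(\<lambda>x x'. g x x' * h x x') \<in> pm (i + j)"
  unfolding pm_def
proof (intro CollectI allI)
  fix k
  have "(\<Sum>m\<le>k. (\<lambda>x x'. coeff (g x x') m) * (\<lambda>x x'. coeff (h x x') (k - m))) \<in> \<mm> (i + j)"
    using assms by (intro \<mm>_sum \<mm>_mult) (auto simp: pm_def)
  moreover have "(\<Sum>m\<le>k. (\<lambda>x x'. coeff (g x x') m) * (\<lambda>x x'. coeff (h x x') (k - m))) =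
      (\<lambda>x x'. coeff (g x x' * h x x') k)"
    by (simp add: fun_eq_iff sum_fun_apply coeff_mult)
  ultimately show "(\<lambda>x x'. coeff (g x x' * h x x') k) \<in> \<mm> (i + j)" by simp
qed

lemma pm_smult:
  assumes "t \<in> \<mm> i" "g \<in> pm j"
  shows "(\<lambda>x x'. smult (t x x') (g x x')) \<in> pm (i + j)"
  using assms \<mm>_mult[OF assms(1)] by (auto simp: pm_def times_fun_def)

lemma pm_const: "(\<lambda>x x'. q x) \<in> pm 0"
  using K0I T.const by (auto simp: pm_def)

lemma pm_subset: "g \<in> pm j \<Longrightarrow> g \<in> pm 0"
  using \<mm>_subset_T by (auto simp: pm_def)

lemma pm_coeff: "g \<in> pm j \<Longrightarrow> (\<lambda>x x'. coeff (g x x') k) \<in> \<mm> j" by (simp add: pm_def)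

lemma difference_in_pm:
  assumes "\<And>k x. k \<le> d \<Longrightarrow> y (C k) x = coeff (q x) k" "\<And>k. k \<le> d \<Longrightarrow> C k \<in> L" "\<And>x. degree (q x) \<le> d"
  shows "(\<lambda>x x'. q x' - q x) \<in> pm 1"
  unfolding pm_def
proof (intro CollectI allI)
  fix k
  show "(\<lambda>x x'. coeff (q x' - q x) k) \<in> \<mm> 1"
  proof (cases "k \<le> d")
    case True
    then have "(\<lambda>x x'. coeff (q x' - q x) k) = w (C k)" by (simp add: w_def fun_eq_iff assms)
    then show ?thesis using w_in_\<mm> assms(2)[OF True] by simp
  next
    case False
    then have "coeff (q x) k = 0" for x using assms(3)[of x] by (simp add: coeff_eq_0)
    then have "(\<lambda>x x'. coeff (q x' - q x) k) = 0" by (simp add: fun_eq_iff)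
    then show ?thesis using \<mm>_0 by simp
  qed
qed

lemma poly_of_w:
  assumes "\<And>k x. k \<le> d \<Longrightarrow> y (C k) x = coeff (q x) k" "\<And>x. degree (q x) \<le> d"
  shows "poly_of C (\<lambda>l. w l x x') = q x' - q x"
proof (rule poly_eqI)
  fix k
  show "coeff (poly_of C (\<lambda>l. w l x x')) k = coeff (q x' - q x) k"
    using assms(2)[of x] assms(2)[of x'] by (auto simp: coeff_poly_of w_def assms(1) coeff_eq_0)
qed

text \<open>Taylor expansion in the root to second order. Only the existence of a remainder with
  coefficients in \<open>T\<close> matters, so induction on \<open>m\<close> replaces the binomial
  formula. The truncated \<open>m - 1\<close> at \<open>m = 0\<close> comes with the coefficient
  0.\<close>

lemma linear_power_expansion:
  assumes "i < n"
  shows "\<exists>Q\<in>pm 0. \<forall>x x'. [:-a i x', 1:] ^ m = [:-a i x, 1:] ^ m -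
    smult (of_nat m * w (CA i) x x') ([:-a i x, 1:] ^ (m - 1)) + smult (w (CA i) x x' ^ 2) (Q x x')"
proof (induction m)
  case 0
  show ?case using pm_const[of "\<lambda>_. 0"] by (intro bexI[of _ "\<lambda>_ _. 0"]) auto
next
  case (Suc m)
  let ?\<delta> = "w (CA i)"
  obtain Q where Q: "Q \<in> pm 0" "\<And>x x'. [:-a i x', 1:] ^ m = [:-a i x, 1:] ^ m -
    smult (of_nat m * ?\<delta> x x') ([:-a i x, 1:] ^ (m - 1)) + smult (?\<delta> x x' ^ 2) (Q x x')" using Suc by blast
  let ?Q = "\<lambda>x x'. smult (of_nat m) ([:-a i x, 1:] ^ (m - 1)) + ([:-a i x, 1:] * Q x x' - smult (?\<delta> x x') (Q x x'))"
  have \<delta>: "?\<delta> \<in> \<mm> 0" using assms by (auto intro: T.var)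
  have "?Q \<in> pm 0"
    using pm_mult[OF pm_const[of "\<lambda>x. [:-a i x, 1:]"] Q(1)] pm_smult[OF \<delta> Q(1)]
    by (intro pm_add pm_diff pm_const) simp_all
  moreover have "[:-a i x', 1:] ^ Suc m = [:-a i x, 1:] ^ Suc m -
    smult (of_nat (Suc m) * ?\<delta> x x') ([:-a i x, 1:] ^ (Suc m - 1)) + smult (?\<delta> x x' ^ 2) (?Q x x')" for x x'
  proof -
    define s where "s = [:-a i x, 1:]"
    define t where "t = ?\<delta> x x'"
    have s': "[:-a i x', 1:] = s - [:t:]" by (simp add: s_def t_def w_def)
    have "(s - [:t:]) ^ Suc m = (s - [:t:]) * (s ^ m - smult (of_nat m * t) (s ^ (m - 1)) + smult (t ^ 2) (Q x x'))"
      using Q(2)[of x' x] unfolding s' by (simp add: s_def[symmetric] t_def[symmetric])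
    also have "\<dots> = s * s ^ m - smult (of_nat m * t) (s * s ^ (m - 1)) + smult (t ^ 2) (s * Q x x')
       - smult t (s ^ m) + smult (t * (of_nat m * t)) (s ^ (m - 1)) - smult (t * t ^ 2) (Q x x')"
      by (simp add: algebra_simps smult_add_right smult_diff_right)
    also have "smult (of_nat m * t) (s * s ^ (m - 1)) = smult (of_nat m * t) (s ^ m)"
      by (cases m) auto
    finally show ?thesis
      unfolding s' s_def[symmetric] t_def[symmetric]
      by (simp add: algebra_simps smult_add_right smult_diff_right smult_add_left power2_eq_square)
  qed
  ultimately show ?case by (intro bexI[of _ ?Q] allI)
qed

text \<open>The ramification equation holds exactly at x and at x', so in the difference the linear
  part equals a sum of terms that are products of at least two increments.\<close>

lemma lin_ram_in_\<mm>_2: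
  assumes i: "i < n"
  shows "(\<lambda>x x'. lin_ram x i (\<lambda>l. w l x x')) \<in> pm 2"
proof -
  let ?\<delta> = "w (CA i)" and ?\<nu> = "w (CU i)"
  let ?dF = "\<lambda>x x'. F x' - F x" and ?dG = "\<lambda>x x'. G x' - G x" and ?dK = "\<lambda>x x'. K i x' - K i x"
  have dF: "?dF \<in> pm 1" by (rule difference_in_pm[of CF]) (auto simp: deg_F)
  have dG: "?dG \<in> pm 1" by (rule difference_in_pm[of CG]) (auto simp: deg_G)
  have dK: "?dK \<in> pm 1" by (rule difference_in_pm[of "CK i"]) (auto simp: deg_K i)
  have \<delta>: "?\<delta> \<in> \<mm> 1" and \<nu>: "?\<nu> \<in> \<mm> 1" using i by (auto intro!: w_in_\<mm> simp del: One_nat_def)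
  obtain Q where Q: "Q \<in> pm 0" "\<And>x x'. [:-a i x', 1:] ^ e i = [:-a i x, 1:] ^ e i -
    smult (of_nat (e i) * ?\<delta> x x') ([:-a i x, 1:] ^ (e i - 1)) + smult (?\<delta> x x' ^ 2) (Q x x')"
    using linear_power_expansion[OF i] by blast
  have eq: "lin_ram x i (\<lambda>l. w l x x') = smult (?\<nu> x x') (?dG x x' + smult c (?dF x x'))
     - smult (of_nat (e i) * ?\<delta> x x') ([:-a i x, 1:] ^ (e i - 1) * ?dK x x')
     + smult (?\<delta> x x' ^ 2) (Q x x' * (K i x + ?dK x x'))" for x x'
  proof -
    have "poly_of CF (\<lambda>l. w l x x') = ?dF x x'" by (rule poly_of_w) (auto simp: deg_F)
    moreover have "poly_of CG (\<lambda>l. w l x x') = ?dG x x'" by (rule poly_of_w) (auto simp: deg_G)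
    moreover have "poly_of (CK i) (\<lambda>l. w l x x') = ?dK x x'" by (rule poly_of_w) (auto simp: deg_K i)
    moreover have u': "u i x' = u i x + ?\<nu> x x'" by (simp add: w_def)
    moreover have "F x - smult (u i x) (G x + smult c (F x)) = [:-a i x, 1:] ^ e i * K i x" by (rule ram[OF i])
    moreover have "F x' - smult (u i x + ?\<nu> x x') (G x' + smult c (F x')) = ([:-a i x, 1:] ^ e i -
        smult (of_nat (e i) * ?\<delta> x x') ([:-a i x, 1:] ^ (e i - 1)) + smult (?\<delta> x x' ^ 2) (Q x x')) * K i x'"
      unfolding Q(2)[of x' x, symmetric] u'[symmetric] by (rule ram[OF i])
    ultimately show ?thesis unfolding lin_ram_def by (simp only: taylor_ram_eq)
  qed
  have c_dF: "(\<lambda>x x'. smult c (?dF x x')) \<in> pm 1"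
    using pm_smult[OF _ dF, of "\<lambda>_ _. c" 0] K0I[of "\<lambda>_. c"] T.const by auto
  have "(\<lambda>x x'. smult (?\<nu> x x') (?dG x x' + smult c (?dF x x'))) \<in> pm (1 + 1)"
    by (intro pm_smult \<nu> pm_add dG c_dF)
  moreover have "(\<lambda>x x'. smult (of_nat (e i) * ?\<delta> x x') ([:-a i x, 1:] ^ (e i - 1) * ?dK x x')) \<in> pm (1 + (0 + 1))"
  proof (intro pm_smult pm_mult pm_const dK)
    show "(\<lambda>x x'. of_nat (e i) * ?\<delta> x x') \<in> \<mm> 1"
      using \<mm>_T_mult[OF T.const[OF K0I[of "\<lambda>_. of_nat (e i)"]] \<delta>] by (simp add: times_fun_def)
  qed
  moreover have "(\<lambda>x x'. smult (?\<delta> x x' ^ 2) (Q x x' * (K i x + ?dK x x'))) \<in> pm (2 + (0 + 0))"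
  proof (intro pm_smult pm_mult Q(1) pm_add pm_const)
    show "(\<lambda>x x'. ?\<delta> x x' ^ 2) \<in> \<mm> 2"
      using \<mm>_mult[OF \<delta> \<delta>] by (simp add: times_fun_def power2_eq_square numeral_2_eq_2)
    show "?dK \<in> pm 0" using pm_subset[OF dK] .
  qed
  ultimately show ?thesis unfolding eq by (intro pm_add pm_diff) (simp_all add: numeral_2_eq_2)
qed

text \<open>Apart from \<open>EQ\<close>, the equations in \<open>J\<close> are affine linear, so
  differences of coordinates satisfy the linearized ones exactly.\<close>

lemma lin_w_in_\<mm>_2:
  assumes "j \<in> J"
  shows "(\<lambda>x x'. lin x j (\<lambda>l. w l x x')) \<in> \<mm> 2"
proof -
  consider (ram) i k where "j = EQ i k" "i < n" | (zero) "\<And>x x'. lin x j (\<lambda>l. w l x x') = 0"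
  proof -
    have "coeff (F x) 2 = 0" if "\<not> 2 \<le> d" for x using deg_F[of x] that by (simp add: coeff_eq_0)
    then have "(\<exists>i k. j = EQ i k \<and> i < n) \<or> (\<forall>x x'. lin x j (\<lambda>l. w l x x') = 0)"
      using assms d_pos norm by (auto simp: J_def w_def coeff_poly_of r(2)[symmetric])
    then show thesis using that by blast
  qed
  then show ?thesis
  proof cases
    case ram
    then show ?thesis using pm_coeff[OF lin_ram_in_\<mm>_2] by simp
  next
    case zero
    then show ?thesis using \<mm>_0[of 2] by (simp add: zero_fun_def)
  qed
qed

text \<open>By injectivity and duality each coordinate is, at every x, a combination of the
  linearized equations and the coordinates \<open>CU i\<close> with i in \<open>R\<close>. Evaluated
  on the differences \<open>w\<close>, the equations contribute only second-order terms.\<close>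

lemma family_rigid:
  assumes "l \<in> L"
  shows "\<exists>b. (\<forall>i. b i \<in> K0) \<and> w l - (\<Sum>i\<in>CU ` R. b i * w i) \<in> \<mm> 2"
proof -
  have fin: "finite (J \<union> ER ` R)" using R finite_subset by (auto simp: J_def)
  have "\<forall>x. \<exists>g. \<forall>v. v l = (\<Sum>j\<in>J \<union> ER ` R. g j * lin x j v)"
  proof
    fix x
    show "\<exists>g. \<forall>v. v l = (\<Sum>j\<in>J \<union> ER ` R. g j * lin x j v)"
    proof (rule functional_in_span[OF fin])
      fix v assume v: "\<And>j. j \<in> J \<union> ER ` R \<Longrightarrow> lin x j v = 0"
      show "v l = 0" using lin_injective[of x v l] v assms by fastforce
    qed (auto simp: lin_add lin_scale)
  qed
  from choice[OF this] obtain g where g: "\<And>x v. v l = (\<Sum>j\<in>J \<union> ER ` R. g x j * lin x j v)" by auto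
  \<comment> \<open>\<open>b\<close> must be defined on all coordinates; \<open>EF0\<close> is a
    default outside \<open>CU\<close>.\<close>
  let ?b = "\<lambda>m. (\<lambda>x x'. g x (case m of CU i \<Rightarrow> ER i | _ \<Rightarrow> EF0))"
  have "w l - (\<Sum>m\<in>CU ` R. ?b m * w m) = (\<Sum>j\<in>J. (\<lambda>x x'. g x j) * (\<lambda>x x'. lin x j (\<lambda>l. w l x x')))"
  proof (intro ext)
    fix x x'
    have "J \<inter> ER ` R = {}" by (auto simp: J_def)
    then have "w l x x' = (\<Sum>j\<in>J. g x j * lin x j (\<lambda>l. w l x x')) + (\<Sum>j\<in>ER ` R. g x j * lin x j (\<lambda>l. w l x x'))"
      using g[of "\<lambda>l. w l x x'" x] fin by (simp add: sum.union_disjoint)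
    moreover have "(\<Sum>j\<in>ER ` R. g x j * lin x j (\<lambda>l. w l x x')) = (\<Sum>i\<in>R. g x (ER i) * w (CU i) x x')"
      by (subst sum.reindex) (auto simp: inj_on_def)
    moreover have "(\<Sum>m\<in>CU ` R. ?b m * w m) x x' = (\<Sum>i\<in>R. g x (ER i) * w (CU i) x x')"
      by (subst sum.reindex) (auto simp: inj_on_def sum_fun_apply)
    ultimately show "(w l - (\<Sum>m\<in>CU ` R. ?b m * w m)) x x' =
        (\<Sum>j\<in>J. (\<lambda>x x'. g x j) * (\<lambda>x x'. lin x j (\<lambda>l. w l x x'))) x x'"
      by (simp add: sum_fun_apply)
  qed
  moreover have "\<dots> \<in> \<mm> 2" by (intro \<mm>_sum \<mm>_T_mult T.const K0I lin_w_in_\<mm>_2)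
  moreover have "?b m \<in> K0" for m by (rule K0I)
  ultimately show ?thesis by (intro exI[of _ ?b]) simp
qed

theorem family_relation:
  assumes "finite Z" "card Z > card R" "\<And>j. j \<in> Z \<Longrightarrow> \<exists>l\<in>L. z j = y l"
  shows "\<exists>H\<in>nonzero_polyfuns Z. \<forall>x. H (\<lambda>j. z j x) = 0"
proof (rule algebraic_relation[OF family_rigid assms(1)])
  have "card (CU ` R) = card R" by (rule card_image) (simp add: inj_on_def)
  then show "card (CU ` R) < card Z" using assms(2) by simp
  show "z j \<in> polys_le L y 1" if "j \<in> Z" for j
    using assms(3)[OF that] polys_le_var[OF finite_L, of _ 1 y] by auto
qed

end

subsection \<open>Generic finiteness of normalized maps\<close>

text \<open>
  The four conditions on low coefficients say that \<open>F / G = T + O(T\<^sup>3)\<close> at the unramified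
  point \<open>0\<close>; this singles out one map in each class modulo automorphisms of the target.
\<close>

definition normal_pairs ::
    "nat \<Rightarrow> nat \<Rightarrow> (nat \<Rightarrow> nat) \<Rightarrow> (nat \<Rightarrow> 'k::field) \<Rightarrow> ('k poly \<times> 'k poly) set" where
  "normal_pairs d n e a = {(F, G). degree F \<le> d \<and> degree G \<le> d \<and>
     (\<forall>t. poly F t \<noteq> 0 \<or> poly G t \<noteq> 0) \<and> (coeff F d \<noteq> 0 \<or> coeff G d \<noteq> 0) \<and>
     coeff F 0 = 0 \<and> coeff F 1 = 1 \<and> coeff G 0 = 1 \<and> coeff G 1 = coeff F 2 \<and>
     (\<forall>i<n. smult (poly G (a i)) F - smult (poly F (a i)) G \<noteq> 0 \<and>
        order (a i) (smult (poly G (a i)) F - smult (poly F (a i)) G) = e i)}"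

text \<open>The constant \<open>c\<close> is such that the target coordinate \<open>F / (G + c F)\<close> is finite at all \<open>a i\<close>.\<close>

definition normal_points ::
    "nat \<Rightarrow> nat \<Rightarrow> (nat \<Rightarrow> nat) \<Rightarrow> 'k::field \<Rightarrow> ((nat \<Rightarrow> 'k) \<times> 'k poly \<times> 'k poly) set" where
  "normal_points d n e c = {(a, F, G). inj_on a {..<n} \<and> (\<forall>i<n. a i \<noteq> 0) \<and>
     (F, G) \<in> normal_pairs d n e a \<and> (\<forall>i<n. poly G (a i) + c * poly F (a i) \<noteq> 0)}"

fun branch_pt :: "'k::field \<Rightarrow> nat \<Rightarrow> (nat \<Rightarrow> 'k) \<times> 'k poly \<times> 'k poly \<Rightarrow> 'k" where
  "branch_pt c i (a, F, G) = poly F (a i) / (poly G (a i) + c * poly F (a i))"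

text \<open>The cases \<open>CU\<close> and \<open>CK\<close> are default values; relations are
  sought only among the other coordinates.\<close>

fun point_coord :: "coord \<Rightarrow> (nat \<Rightarrow> 'k::field) \<times> 'k poly \<times> 'k poly \<Rightarrow> 'k" where
  "point_coord (CA i) (a, F, G) = a i"
| "point_coord (CF k) (a, F, G) = coeff F k"
| "point_coord (CG k) (a, F, G) = coeff G k"
| "point_coord (CU i) x = 0"
| "point_coord (CK i k) x = 0"

lemma polyfuns_cong:
  assumes "finite Z" "H \<in> polyfuns Z" "\<And>j. j \<in> Z \<Longrightarrow> f j = g j"
  shows "H f = H g"
proof -
  obtain N where N: "H \<in> polys_le Z (\<lambda>j a. a j) N" using assms(2) by auto
  have mono: "mono_fun Z (\<lambda>j a. a j) I f = mono_fun Z (\<lambda>j a. a j) I g" for I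
    unfolding mono_fun_def using assms(3) by (intro prod.cong) auto
  obtain c' where "H = (\<lambda>x. \<Sum>I\<in>(\<Pi>\<^sub>E l\<in>Z. {..N}). c' I * mono_fun Z (\<lambda>j a. a j) I x)"
    using polys_le_explicit[OF assms(1) N] by (rule exE)
  then show ?thesis by (simp add: mono)
qed

text \<open>Up to the nonzero scalar \<open>poly G (a i) + c * poly F (a i)\<close>, the left side
  is the form \<open>G(a_i) F - F(a_i) G\<close>, whose order at \<open>a i\<close> is exactly
  \<open>e i\<close>.\<close>

lemma ramification_factor:
  fixes F G :: "'k::field poly"
  assumes "(a, F, G) \<in> normal_points d n e c" "i < n"
  shows "\<exists>K. F - smult (branch_pt c i (a, F, G)) (G + smult c F) = [:-a i, 1:] ^ e i * K \<and>
    poly K (a i) \<noteq> 0 \<and> degree K \<le> d"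
proof -
  let ?D = "smult (poly G (a i)) F - smult (poly F (a i)) G"
  define h where "h = poly G (a i) + c * poly F (a i)"
  have h: "h \<noteq> 0" and D: "?D \<noteq> 0" "order (a i) ?D = e i" and deg: "degree F \<le> d" "degree G \<le> d"
    using assms by (auto simp: normal_points_def normal_pairs_def h_def)
  obtain q where q: "?D = [:-a i, 1:] ^ e i * q" "\<not> [:-a i, 1:] dvd q"
    using order_decomp[OF D(1), of "a i"] D(2) by auto
  have "F - smult (branch_pt c i (a, F, G)) (G + smult c F) = smult (inverse h) ?D"
  proof -
    have "smult h (F - smult (branch_pt c i (a, F, G)) (G + smult c F)) =
        smult h F - smult (poly F (a i)) (G + smult c F)"
      using h by (simp add: smult_diff_right h_def[symmetric])
    also have "\<dots> = ?D" by (simp add: h_def smult_add_left smult_add_right mult.commute)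
    finally have "smult (inverse h) (smult h (F - smult (branch_pt c i (a, F, G)) (G + smult c F))) =
        smult (inverse h) ?D" by simp
    then show ?thesis using h by simp
  qed
  then have eq: "F - smult (branch_pt c i (a, F, G)) (G + smult c F) = [:-a i, 1:] ^ e i * smult (inverse h) q"
    by (simp add: q(1))
  have "q \<noteq> 0" using q(2) by auto
  then have "degree ?D = e i + degree q"
    unfolding q(1) by (subst degree_mult_eq) (auto simp: degree_linear_power)
  moreover have "degree ?D \<le> d" using deg by (intro degree_diff_le order.trans[OF degree_smult_le])
  ultimately have "degree (smult (inverse h) q) \<le> d" using degree_smult_le[of "inverse h" q] by linarith
  moreover have "poly (smult (inverse h) q) (a i) \<noteq> 0"
    using q(2) h by (simp add: poly_eq_0_iff_dvd)
  ultimately show ?thesis using eq by blast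
qed

lemma normal_points_relation:
  fixes X :: "((nat \<Rightarrow> 'k::alg_closed_field) \<times> 'k poly \<times> 'k poly) set"
  assumes p: "prime p" "CHAR('k) = p" and d: "d > 0" and sum_e: "(\<Sum>i<n. e i - 1) = 2 * d - 2"
    and e: "\<And>i. i < n \<Longrightarrow> e i > 0" "\<And>i. i < n \<Longrightarrow> coprime (e i) p"
    and X: "X \<subseteq> normal_points d n e c"
    and R: "R \<subseteq> {..<n}" "\<And>i. i < n \<Longrightarrow> r i \<in> R"
      "\<And>i x. i < n \<Longrightarrow> x \<in> X \<Longrightarrow> branch_pt c i x = branch_pt c (r i) x"
    and Z: "finite Z" "card Z > card R" "\<And>j. j \<in> Z \<Longrightarrow> z j \<in> CA ` {..<n} \<union> CF ` {..d} \<union> CG ` {..d}"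
  shows "\<exists>H\<in>nonzero_polyfuns Z. \<forall>x\<in>X. H (\<lambda>j. point_coord (z j) x) = 0"
proof (cases "X = {}")
  case True
  then show ?thesis using nonzero_polyfuns_one by blast
next
  case False
  then obtain x0 where x0: "x0 \<in> X" by blast
  \<comment> \<open>The locale needs a family over a whole type, so points outside \<open>X\<close>
    are replaced by one fixed point of \<open>X\<close>.\<close>
  define \<rho> where "\<rho> x = (if x \<in> X then x else x0)" for x
  have \<rho>: "\<rho> x \<in> X" for x using x0 by (simp add: \<rho>_def)
  define a F G where "a i x = fst (\<rho> x) i" and "F x = fst (snd (\<rho> x))" and "G x = snd (snd (\<rho> x))"
    for i :: nat and x
  have \<rho>_eq: "\<rho> x = (\<lambda>i. a i x, F x, G x)" for x by (simp add: a_def F_def G_def)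
  have np: "(\<lambda>i. a i x, F x, G x) \<in> normal_points d n e c" for x
    using \<rho>[of x] X unfolding \<rho>_eq by auto
  define u where "u i x = branch_pt c (if i < n then i else 0) (\<rho> x)" for i x
  have "\<forall>ix. \<exists>K. fst ix < n \<longrightarrow>
    F (snd ix) - smult (u (fst ix) (snd ix)) (G (snd ix) + smult c (F (snd ix))) =
      [:-a (fst ix) (snd ix), 1:] ^ e (fst ix) * K \<and>
    poly K (a (fst ix) (snd ix)) \<noteq> 0 \<and> degree K \<le> d"
    using ramification_factor[OF np] by (auto simp: u_def \<rho>_eq)
  from choice[OF this] obtain K' where K': "\<And>i x. i < n \<Longrightarrow>
    F x - smult (u i x) (G x + smult c (F x)) = [:-a i x, 1:] ^ e i * K' (i, x) \<and>
    poly (K' (i, x)) (a i x) \<noteq> 0 \<and> degree (K' (i, x)) \<le> d" by fastforce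
  have np': "inj_on (\<lambda>i. a i x) {..<n}" "\<forall>i<n. a i x \<noteq> 0" "degree (F x) \<le> d" "degree (G x) \<le> d"
    "poly (F x) t \<noteq> 0 \<or> poly (G x) t \<noteq> 0" "coeff (F x) d \<noteq> 0 \<or> coeff (G x) d \<noteq> 0"
    "coeff (F x) 0 = 0" "coeff (F x) 1 = 1" "coeff (G x) 0 = 1" "coeff (G x) 1 = coeff (F x) 2" for x t
    using np[of x] by (auto simp: normal_points_def normal_pairs_def)
  have r_lt: "r i < n" if "i < n" for i using R(1,2) that by auto
  interpret ramified_family p n d e a u F G "\<lambda>i x. K' (i, x)" c R r
  proof
    show "u i = u (r i)" if "i < n" for i
      using R(3)[OF that \<rho>] that r_lt[OF that] by (auto simp: u_def fun_eq_iff)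
  qed (use p d sum_e e np' R K' in auto)
  define z' where "z' j = y (z j)" for j
  have "\<exists>l\<in>L. z' j = y l" if "j \<in> Z" for j using Z(3)[OF that] by (intro bexI[of _ "z j"]) (auto simp: z'_def)
  from family_relation[OF Z(1,2) this] obtain H
    where H: "H \<in> nonzero_polyfuns Z" "\<forall>x. H (\<lambda>j. z' j x) = 0" by (rule bexE)
  have "H (\<lambda>j. point_coord (z j) x) = 0" if x: "x \<in> X" for x
  proof -
    have x_eq: "x = (\<lambda>i. a i x, F x, G x)" using \<rho>_eq[of x] x by (simp add: \<rho>_def)
    have "point_coord (z j) x = z' j x" if "j \<in> Z" for j
    proof -
      have "point_coord (z j) (\<lambda>i. a i x, F x, G x) = z' j x" using Z(3)[OF that] by (auto simp: z'_def)
      then show ?thesis by (simp only: x_eq[symmetric])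
    qed
    then have "H (\<lambda>j. point_coord (z j) x) = H (\<lambda>j. z' j x)" 
      using H(1) unfolding nonzero_polyfuns_def by (intro polyfuns_cong[where H = H, OF Z(1)]) simp_all
    then show ?thesis using H(2) by simp
  qed
  with H(1) show ?thesis by (intro bexI[of _ H]) auto
qed

text \<open>Any coefficient of \<open>H\<close> in the last variable that is not identically zero
  serves as \<open>h\<close>: where it does not vanish, \<open>H\<close> is a nonzero polynomial in
  \<open>t\<close>.\<close>

lemma finite_values_of_relation:
  fixes H :: "(nat \<Rightarrow> 'k::alg_closed_field) \<Rightarrow> 'k"
  assumes "H \<in> nonzero_polyfuns (insert n {..<n})"
  shows "\<exists>h\<in>nonzero_polyfuns {..<n}. \<forall>a. h a \<noteq> 0 \<longrightarrow> finite {t. H (a(n := t)) = 0}"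
proof -
  have "H \<in> polyfuns (insert n {..<n})" using assms by (simp add: nonzero_polyfuns_def)
  then obtain N h where h: "\<And>k. h k \<in> polyfuns {..<n}" "\<And>a. H a = (\<Sum>k\<le>N. h k a * a n ^ k)"
    using polyfuns_coeffs[of "{..<n}" n H] by auto
  obtain a0 where "H a0 \<noteq> 0" using assms by (auto simp: nonzero_polyfuns_def)
  then have "\<exists>k\<le>N. h k a0 \<noteq> 0" unfolding h(2) by (metis (no_types, lifting) atMost_iff mult_zero_left sum.neutral)
  then obtain k where k: "k \<le> N" "h k a0 \<noteq> 0" by blast
  have "finite {t. H (a(n := t)) = 0}" if "h k a \<noteq> 0" for a
  proof -
    let ?q = "\<Sum>k\<le>N. monom (h k a) k"
    have "h k (a(n := t)) = h k a" for k t 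
      by (rule polyfuns_cong[where Z = "{..<n}" and H = "h k", OF _ h(1)]) simp_all
    then have "H (a(n := t)) = poly ?q t" for t by (simp add: h(2) poly_sum poly_monom)
    moreover have "coeff ?q k \<noteq> 0" using k that by (simp add: coeff_sum sum.delta)
    then have "?q \<noteq> 0" by auto
    then have "finite {t. poly ?q t = 0}" by (rule poly_roots_finite)
    ultimately show ?thesis by simp
  qed
  moreover have "h k \<in> nonzero_polyfuns {..<n}" using h(1)[of k] k unfolding nonzero_polyfuns_def by blast
  ultimately show ?thesis by (intro bexI[of _ "h k"]) auto
qed

lemma finite_polys_of_finite_coeffs:
  assumes "\<And>q. q \<in> Q \<Longrightarrow> degree q \<le> d" "\<And>k. k \<le> d \<Longrightarrow> finite ((\<lambda>q. coeff q k) ` Q)"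
  shows "finite (Q :: 'k::comm_monoid_add poly set)"
proof (rule finite_surj)
  show "finite (\<Pi>\<^sub>E k\<in>{..d}. (\<lambda>q. coeff q k) ` Q)" using assms(2) by (intro finite_PiE) auto
  show "Q \<subseteq> (\<lambda>f. \<Sum>k\<le>d. monom (f k) k) ` (\<Pi>\<^sub>E k\<in>{..d}. (\<lambda>q. coeff q k) ` Q)"
  proof
    fix q assume q: "q \<in> Q"
    have "q = (\<Sum>k\<le>d. monom (restrict (coeff q) {..d} k) k)"
      using poly_as_sum_of_monoms'[OF assms(1)[OF q]] by simp
    moreover have "restrict (coeff q) {..d} \<in> (\<Pi>\<^sub>E k\<in>{..d}. (\<lambda>q. coeff q k) ` Q)" using q by auto
    ultimately show "q \<in> (\<lambda>f. \<Sum>k\<le>d. monom (f k) k) ` (\<Pi>\<^sub>E k\<in>{..d}. (\<lambda>q. coeff q k) ` Q)" by blast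
  qed
qed

text \<open>Each index excludes at most one value of c, because \<open>F\<close> and
  \<open>G\<close> have no common root.\<close>

lemma exists_affine_coordinate:
  fixes F G :: "'k::field poly"
  assumes "finite C" "card C > n" "\<And>t. poly F t \<noteq> 0 \<or> poly G t \<noteq> 0"
  shows "\<exists>c\<in>C. \<forall>i<n. poly G (a i) + c * poly F (a i) \<noteq> 0"
proof (rule ccontr)
  assume neg: "\<not> ?thesis"
  have "C \<subseteq> (\<lambda>i. - poly G (a i) / poly F (a i)) ` {..<n}"
  proof
    fix c assume "c \<in> C"
    then obtain i where i: "i < n" "poly G (a i) + c * poly F (a i) = 0" using neg by blast
    then have "poly F (a i) \<noteq> 0" using assms(3)[of "a i"] by auto
    moreover have "c * poly F (a i) = - poly G (a i)" using i(2) by (simp add: eq_neg_iff_add_eq_0 add.commute)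
    ultimately have "c = - poly G (a i) / poly F (a i)" by (metis nonzero_eq_divide_eq)
    then show "c \<in> (\<lambda>i. - poly G (a i) / poly F (a i)) ` {..<n}" using i by blast
  qed
  then have "card C \<le> card ((\<lambda>i. - poly G (a i) / poly F (a i)) ` {..<n})" by (intro card_mono) auto
  also have "\<dots> \<le> n" using card_image_le[of "{..<n}"] by simp
  finally show False using assms(2) by simp
qed

theorem normal_pairs_generic:
  fixes p n d :: nat
  assumes p: "prime p" "CHAR('k::alg_closed_field) = p" and d: "d > 0"
    and sum_e: "(\<Sum>i<n. e i - 1) = 2 * d - 2"
    and e: "\<And>i. i < n \<Longrightarrow> e i > 0" "\<And>i. i < n \<Longrightarrow> coprime (e i) p"
  shows "\<exists>H\<in>nonzero_polyfuns {..<n}. \<forall>a :: nat \<Rightarrow> 'k.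
    inj_on a {..<n} \<and> (\<forall>i<n. a i \<noteq> 0) \<and> H a \<noteq> 0 \<longrightarrow> finite (normal_pairs d n e a) \<and>
      (\<forall>F G i j. (F, G) \<in> normal_pairs d n e a \<and> i < n \<and> j < n \<and> i \<noteq> j \<longrightarrow>
        poly F (a i) * poly G (a j) \<noteq> poly F (a j) * poly G (a i))"
proof -
  obtain C :: "'k set" where C: "finite C" "card C = Suc n"
    using infinite_arbitrarily_large[OF infinite_UNIV_alg_closed] by blast
  let ?Q = "CF ` {..d} \<union> CG ` {..d}"
  let ?P = "{(i, j). i < n \<and> j < n \<and> i \<noteq> j}"
  have "\<forall>cq. \<exists>h. h \<in> nonzero_polyfuns {..<n} \<and> (snd cq \<in> ?Q \<longrightarrow> (\<forall>a. h a \<noteq> 0 \<longrightarrow>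
      finite (point_coord (snd cq) ` {(a', F, G) \<in> normal_points d n e (fst cq :: 'k). a' = a})))"
    (is "\<forall>cq. \<exists>h. ?A cq h")
  proof
    fix cq :: "'k \<times> coord"
    show "\<exists>h. ?A cq h"
    proof (cases "snd cq \<in> ?Q")
      case True
      \<comment> \<open>The extra index \<open>n\<close> carries the coefficient whose values are to
        be shown finite in number.\<close>
      let ?z = "\<lambda>j. if j = n then snd cq else CA j"
      have "\<exists>H\<in>nonzero_polyfuns (insert n {..<n}). \<forall>x\<in>normal_points d n e (fst cq).
          H (\<lambda>j. point_coord (?z j) x) = 0"
        by (rule normal_points_relation[OF p d sum_e e subset_refl, of "{..<n}" "\<lambda>i. i"])
           (use True in auto)
      then obtain H where H: "H \<in> nonzero_polyfuns (insert n {..<n})"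
        "\<And>x. x \<in> normal_points d n e (fst cq) \<Longrightarrow> H (\<lambda>j. point_coord (?z j) x) = 0" by blast
      obtain h where h: "h \<in> nonzero_polyfuns {..<n}"
        "\<And>a. h a \<noteq> 0 \<Longrightarrow> finite {t. H (a(n := t)) = 0}"
        using finite_values_of_relation[OF H(1)] by blast
      have sub: "point_coord (snd cq) ` {(a', F, G) \<in> normal_points d n e (fst cq). a' = a} \<subseteq> {t. H (a(n := t)) = 0}" for a
      proof
        fix t assume "t \<in> point_coord (snd cq) ` {(a', F, G) \<in> normal_points d n e (fst cq). a' = a}"
        then obtain F G where x: "(a, F, G) \<in> normal_points d n e (fst cq)" "t = point_coord (snd cq) (a, F, G)"
          by auto
        have "(\<lambda>j. point_coord (?z j) (a, F, G)) = a(n := t)" by (auto simp: x(2))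
        then show "t \<in> {t. H (a(n := t)) = 0}" using H(2)[OF x(1)] by simp
      qed
      show ?thesis by (intro exI[of _ h] conjI impI allI h(1) finite_subset[OF sub h(2)])
    next
      case False
      then show ?thesis
        by (intro exI[of _ "\<lambda>_. 1"] conjI nonzero_polyfuns_one impI) (erule notE, assumption)
    qed
  qed
  from choice[OF this] obtain h where h0: "\<forall>cq. ?A cq (h cq)" by (rule exE)
  have h1: "h cq \<in> nonzero_polyfuns {..<n}" for cq using h0 by (elim allE conjE)
  have h2: "finite (point_coord q ` {(a', F, G) \<in> normal_points d n e c. a' = a})"
    if "q \<in> ?Q" "h (c, q) a \<noteq> 0" for c q a
    using spec[OF h0, of "(c, q)"] that unfolding fst_conv snd_conv by (elim conjE) (drule mp, assumption, drule spec, drule mp)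
  have "\<forall>cp. \<exists>g. g \<in> nonzero_polyfuns {..<n} \<and> (snd cp \<in> ?P \<longrightarrow> (\<forall>(a, F, G)\<in>normal_points d n e (fst cp :: 'k).
      branch_pt (fst cp) (fst (snd cp)) (a, F, G) = branch_pt (fst cp) (snd (snd cp)) (a, F, G) \<longrightarrow> g a = 0))"
    (is "\<forall>cp. \<exists>g. ?B cp g")
  proof
    fix cp :: "'k \<times> nat \<times> nat"
    obtain c i j where cp: "cp = (c, i, j)" by (cases cp) auto
    show "\<exists>g. ?B cp g"
    proof (cases "snd cp \<in> ?P")
      case True
      then have ij: "i < n" "j < n" "i \<noteq> j" by (auto simp: cp)
      let ?X = "{x \<in> normal_points d n e c. branch_pt c i x = branch_pt c j x}"
      have "\<exists>H\<in>nonzero_polyfuns {..<n}. \<forall>x\<in>?X. H (\<lambda>j. point_coord (CA j) x) = 0"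
      \<comment> \<open>Coincidence of the two branch points is encoded by dropping \<open>j\<close>
        from \<open>R\<close> and representing it by \<open>i\<close>.\<close>
      proof (rule normal_points_relation[where z = CA and X = ?X and c = c and R = "{..<n} - {j}"
            and r = "\<lambda>m. if m = j then i else m", OF p d sum_e e])
        show "card ({..<n} - {j}) < card {..<n}" using ij by (intro psubset_card_mono) auto
        show "?X \<subseteq> normal_points d n e c" by blast
        show "branch_pt c m x = branch_pt c (if m = j then i else m) x" if "x \<in> ?X" for m x
          using that by simp
      qed (use ij in simp_all)
      then obtain H where H: "H \<in> nonzero_polyfuns {..<n}"
        "\<And>x. x \<in> ?X \<Longrightarrow> H (\<lambda>j. point_coord (CA j) x) = 0" by blast
      have "H a = 0" if "(a, F, G) \<in> ?X" for a F G using H(2)[OF that] by simp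
      then show ?thesis using H(1) by (intro exI[of _ H]) (auto simp: cp)
    next
      case False
      then show ?thesis
        by (intro exI[of _ "\<lambda>_. 1"] conjI nonzero_polyfuns_one impI) (erule notE, assumption)
    qed
  qed
  from choice[OF this] obtain g where g0: "\<forall>cp. ?B cp (g cp)" by (rule exE)
  have g1: "g cp \<in> nonzero_polyfuns {..<n}" for cp using g0 by (elim allE conjE)
  have g2: "g (c, i, j) a = 0" if "i < n" "j < n" "i \<noteq> j" "(a, F, G) \<in> normal_points d n e c"
      "branch_pt c i (a, F, G) = branch_pt c j (a, F, G)" for c i j a F G
  proof -
    have "\<forall>(a, F, G)\<in>normal_points d n e c. branch_pt c i (a, F, G) = branch_pt c j (a, F, G) \<longrightarrow> g (c, i, j) a = 0"
      using spec[OF g0, of "(c, i, j)"] that(1-3) by simp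
    from bspec[OF this that(4)] show ?thesis using that(5) by simp
  qed
  have finP: "finite ?P" by (rule finite_subset[of _ "{..<n} \<times> {..<n}"]) auto
  \<comment> \<open>One factor for each target coordinate c combined with a coefficient of the
    forms, and one for each c combined with a pair of indices.\<close>
  let ?H = "\<lambda>a. (\<Prod>cq\<in>C \<times> ?Q. h cq a) * (\<Prod>cp\<in>C \<times> ?P. g cp a)"
  show ?thesis
  proof (intro bexI[of _ ?H] allI impI conjI)
    show "?H \<in> nonzero_polyfuns {..<n}"
      using C(1) finP h1 g1 by (intro nonzero_polyfuns_mult nonzero_polyfuns_prod) auto
  next
    fix a :: "nat \<Rightarrow> 'k"
    assume a: "inj_on a {..<n} \<and> (\<forall>i<n. a i \<noteq> 0) \<and> ?H a \<noteq> 0"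
    have fin: "finite (C \<times> ?Q)" "finite (C \<times> ?P)" using C(1) finP by auto
    have cover: "\<exists>c\<in>C. (a, F, G) \<in> normal_points d n e c" if FG: "(F, G) \<in> normal_pairs d n e a" for F G
    proof -
      have "\<exists>c\<in>C. \<forall>i<n. poly G (a i) + c * poly F (a i) \<noteq> 0"
        using FG C by (intro exists_affine_coordinate) (auto simp: normal_pairs_def)
      then show ?thesis using FG a by (auto simp: normal_points_def)
    qed
    {
      have finQ: "finite (point_coord q ` {(a', F, G) \<in> normal_points d n e c. a' = a})" if "c \<in> C" "q \<in> ?Q" for c q
      proof (rule h2[OF that(2)])
        show "h (c, q) a \<noteq> 0" using a fin that by (auto simp: prod_zero_iff)
      qed
      define S where "S c = {(F, G). (a, F, G) \<in> normal_points d n e c}" for c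
      have "finite (S c)" if c: "c \<in> C" for c
      proof -
        have "finite (fst ` S c)"
        proof (rule finite_polys_of_finite_coeffs)
          show "degree q \<le> d" if "q \<in> fst ` S c" for q
            using that by (auto simp: S_def normal_points_def normal_pairs_def)
          fix k assume "k \<le> d"
          then have "finite (point_coord (CF k) ` {(a', F, G) \<in> normal_points d n e c. a' = a})"
            using c by (intro finQ) auto
          then show "finite ((\<lambda>q. coeff q k) ` fst ` S c)"
            by (rule finite_subset[rotated]) (force simp: S_def image_iff)
        qed
        moreover have "finite (snd ` S c)"
        proof (rule finite_polys_of_finite_coeffs)
          show "degree q \<le> d" if "q \<in> snd ` S c" for q
            using that by (auto simp: S_def normal_points_def normal_pairs_def)
          fix k assume "k \<le> d"
          then have "finite (point_coord (CG k) ` {(a', F, G) \<in> normal_points d n e c. a' = a})"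
            using c by (intro finQ) auto
          then show "finite ((\<lambda>q. coeff q k) ` snd ` S c)"
            by (rule finite_subset[rotated]) (force simp: S_def image_iff)
        qed
        ultimately have "finite (fst ` S c \<times> snd ` S c)" by simp
        then show ?thesis by (rule finite_subset[rotated]) (force simp: image_iff)
      qed
      then have "finite (\<Union>c\<in>C. S c)" using C(1) by blast
      moreover have "normal_pairs d n e a \<subseteq> (\<Union>c\<in>C. S c)"
        using cover unfolding S_def by auto
      ultimately show "finite (normal_pairs d n e a)" by (rule finite_subset[rotated])
    }
    fix F G i j assume FG: "(F, G) \<in> normal_pairs d n e a \<and> i < n \<and> j < n \<and> i \<noteq> j"
    then obtain c where c: "c \<in> C" "(a, F, G) \<in> normal_points d n e c" using cover by blast
    show "poly F (a i) * poly G (a j) \<noteq> poly F (a j) * poly G (a i)"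
    proof
      assume eq: "poly F (a i) * poly G (a j) = poly F (a j) * poly G (a i)"
      have "poly G (a i) + c * poly F (a i) \<noteq> 0" "poly G (a j) + c * poly F (a j) \<noteq> 0"
        using c FG by (auto simp: normal_points_def)
      then have "branch_pt c i (a, F, G) = branch_pt c j (a, F, G)"
        using eq by (simp add: frac_eq_eq algebra_simps)
      then have "g (c, i, j) a = 0" using FG c by (intro g2[of i j a F G c]) auto
      then show False using a fin c FG by (auto simp: prod_zero_iff) blast
    qed
  qed
qed

subsection \<open>Morphisms of the projective line\<close>

lemma proj_pt_eq_iff:
  assumes "(x, y) \<noteq> (0, 0)" "(x', y') \<noteq> (0, 0)"
  shows "proj_pt x y = proj_pt x' y' \<longleftrightarrow> x * y' = x' * (y :: 'k::field)"
proof -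
  have refl: "proportional v v" if "v \<noteq> (0, 0)" for v :: "'k \<times> 'k"
    using that unfolding proportional_def by (intro conjI exI[of _ 1]) auto
  have "proj_pt x y = proj_pt x' y' \<longleftrightarrow> proportional (x, y) (x', y')"
    using Quotient3_rel[OF Quotient3_proj_line, of "(x, y)" "(x', y')"] refl assms
    by (simp add: proj_pt_def)
  also have "\<dots> \<longleftrightarrow> x * y' = x' * y"
  proof
    assume "x * y' = x' * y"
    show "proportional (x, y) (x', y')"
    proof (cases "x = 0")
      case True
      then have "y \<noteq> 0" "x' = 0" "y' \<noteq> 0" using assms \<open>x * y' = x' * y\<close> by auto
      then show ?thesis unfolding proportional_def using True by (intro conjI exI[of _ "y' / y"]) auto
    next
      case False
      then have "x' \<noteq> 0" using assms(2) \<open>x * y' = x' * y\<close> by auto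
      then show ?thesis unfolding proportional_def using False assms \<open>x * y' = x' * y\<close>
        by (intro conjI exI[of _ "x' / x"]) (auto simp: field_simps)
    qed
  qed (auto simp: proportional_def)
  finally show ?thesis .
qed

lemma proj_pt_cases:
  obtains x y where "(x, y) \<noteq> (0, 0)" "P = proj_pt x (y :: 'k::field)"
proof -
  obtain x y where xy: "rep_proj_line P = (x, y)" by (cases "rep_proj_line P")
  have "proportional (rep_proj_line P) (rep_proj_line P)" using Quotient3_rep_reflp[OF Quotient3_proj_line] .
  then have "(x, y) \<noteq> (0, 0)" by (simp add: proportional_def xy)
  moreover have "P = proj_pt x y"
    using Quotient3_abs_rep[OF Quotient3_proj_line, of P] by (simp add: proj_pt_def xy)
  ultimately show thesis by (rule that)
qed

lemma proportional_pairs: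
  fixes x y x' y' :: "'k::field"
  assumes "(x, y) \<noteq> (0, 0)" "(x', y') \<noteq> (0, 0)" "x * y' = x' * y"
  obtains \<mu> where "\<mu> \<noteq> 0" "x = \<mu> * x'" "y = \<mu> * y'"
proof (cases "x' = 0")
  case True
  then have "y' \<noteq> 0" "x = 0" "y \<noteq> 0" using assms by auto
  then show thesis using that[of "y / y'"] True by auto
next
  case False
  then have "x \<noteq> 0" using assms by auto
  then show thesis using that[of "x / x'"] False assms(3) by (auto simp: field_simps)
qed

lemma eval_form_eq:
  assumes "degree H \<le> d" "y \<noteq> 0"
  shows "eval_form d H x y = y ^ d * poly H (x / y)"
proof -
  have "poly H (x / y) = (\<Sum>i\<le>d. coeff H i * (x / y) ^ i)"
    using arg_cong[OF poly_as_sum_of_monoms'[OF assms(1)], of "\<lambda>q. poly q (x / y)"]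
    by (simp add: poly_sum poly_monom)
  then have "y ^ d * poly H (x / y) = (\<Sum>i\<le>d. y ^ d * (coeff H i * (x / y) ^ i))"
    by (simp add: sum_distrib_left)
  also have "\<dots> = (\<Sum>i\<le>d. coeff H i * x ^ i * y ^ (d - i))"
    using assms(2) by (intro sum.cong refl) (simp add: power_divide power_diff field_simps)
  finally show ?thesis by (simp add: eval_form_def)
qed

lemma eval_form_0: "eval_form d H x 0 = coeff H d * x ^ d"
proof -
  have "eval_form d H x 0 = (\<Sum>i\<le>d. if i = d then coeff H i * x ^ i else 0)"
    unfolding eval_form_def by (intro sum.cong refl) (auto simp: power_0_left)
  then show ?thesis by (simp add: sum.delta)
qed

lemma eval_form_1: "degree H \<le> d \<Longrightarrow> eval_form d H x 1 = poly H x"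
  by (simp add: eval_form_eq)

lemma eval_form_add: "eval_form d (H + H') x y = eval_form d H x y + eval_form d H' x y"
  by (simp add: eval_form_def sum.distrib algebra_simps)

lemma eval_form_smult: "eval_form d (smult t H) x y = t * eval_form d H x y"
  by (simp add: eval_form_def sum_distrib_left mult.assoc)

lemma eval_form_sum: "eval_form d (\<Sum>i\<in>A. H i) x y = (\<Sum>i\<in>A. eval_form d (H i) x y)"
  by (induction A rule: infinite_finite_induct) (auto simp: eval_form_add, simp_all add: eval_form_def)

lemma coeff_mult_top:
  assumes "degree H \<le> d" "degree H' \<le> d'"
  shows "coeff (H * H') (d + d') = coeff H d * coeff H' d'"
proof -
  have "coeff (H * H') (d + d') = (\<Sum>i\<le>d + d'. if i = d then coeff H d * coeff H' d' else 0)"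
    unfolding coeff_mult
  proof (intro sum.cong refl)
    fix i assume "i \<in> {..d + d'}"
    show "coeff H i * coeff H' (d + d' - i) = (if i = d then coeff H d * coeff H' d' else 0)"
    proof (cases i d rule: linorder_cases)
      case less
      then have "degree H' < d + d' - i" using assms(2) by simp
      then show ?thesis using less by (simp add: coeff_eq_0)
    next
      case greater
      then have "degree H < i" using assms(1) by simp
      then show ?thesis using greater by (simp add: coeff_eq_0)
    qed simp
  qed
  then show ?thesis by simp
qed

lemma eval_form_mult:
  assumes "degree H \<le> d" "degree H' \<le> d'"
  shows "eval_form (d + d') (H * H') x y = eval_form d H x y * eval_form d' H' x y"
proof (cases "y = 0")
  case True
  then show ?thesis by (simp add: eval_form_0 coeff_mult_top[OF assms] power_add)
next
  case False
  have "degree (H * H') \<le> d + d'" using assms by (intro order.trans[OF degree_mult_le]) simp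
  then show ?thesis using False assms by (simp add: eval_form_eq power_add)
qed

lemma degree_power_le': "degree H \<le> d \<Longrightarrow> degree (H ^ m) \<le> m * d" for H :: "'k::field poly"
  using degree_power_le[of H m] by (meson le_trans mult_le_mono1 mult.commute[THEN eq_refl])

lemma eval_form_power:
  assumes "degree H \<le> d"
  shows "eval_form (m * d) (H ^ m) x y = eval_form d H x y ^ m"
proof (induction m)
  case 0
  then show ?case by (simp add: eval_form_def)
next
  case (Suc m)
  then show ?case using eval_form_mult[OF assms degree_power_le'[OF assms, of m]] by simp
qed

lemma given_by_formsD:
  assumes "given_by_forms f d F G"
  shows "degree F \<le> d" "degree G \<le> d" "poly F t \<noteq> 0 \<or> poly G t \<noteq> 0" "coeff F d \<noteq> 0 \<or> coeff G d \<noteq> 0"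
    "f (proj_pt t 1) = proj_pt (poly F t) (poly G t)"
proof -
  show deg: "degree F \<le> d" "degree G \<le> d" using assms by (auto simp: given_by_forms_def)
  have *: "(eval_form d F x y, eval_form d G x y) \<noteq> (0, 0) \<and>
      f (proj_pt x y) = proj_pt (eval_form d F x y) (eval_form d G x y)" if "(x, y) \<noteq> (0, 0)" for x y
    using assms that unfolding given_by_forms_def by blast
  show "poly F t \<noteq> 0 \<or> poly G t \<noteq> 0" "f (proj_pt t 1) = proj_pt (poly F t) (poly G t)"
    using *[of t 1] deg by (auto simp: eval_form_1)
  show "coeff F d \<noteq> 0 \<or> coeff G d \<noteq> 0" using *[of 1 0] by (auto simp: eval_form_0)
qed

text \<open>Without a common zero at infinity, one of the two forms has a nonzero coefficient in
  degree d.\<close>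

lemma given_by_forms_degree:
  assumes "given_by_forms f d F G"
  shows "d = max (degree F) (degree G)"
  using given_by_formsD(1,2,4)[OF assms] le_degree[of F d] le_degree[of G d] by (auto simp: max_def)

lemma root_free_const:
  fixes G :: "'k::alg_closed_field poly"
  assumes "\<And>t. poly G t \<noteq> 0"
  obtains g where "g \<noteq> 0" "G = [:g:]"
proof -
  have "degree G = 0" using alg_closed_imp_poly_has_root[of G] assms by blast
  then obtain g where "G = [:g:]" by (rule degree_eq_zeroE)
  then show thesis using that assms[of 0] by simp
qed

text \<open>Comparing values at finite points gives \<open>F * G' = F' * G\<close>; the quotient of
  the two pairs is then a polynomial without roots, hence a constant. So properties defined through
  some choice of forms can be tested on any given one.\<close>

lemma given_by_forms_unique:
  fixes f :: "'k::alg_closed_field proj_line \<Rightarrow> 'k proj_line"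
  assumes "given_by_forms f d F G" "given_by_forms f d' F' G'"
  obtains c where "c \<noteq> 0" "F' = smult c F" "G' = smult c G" "d' = d"
proof -
  note D = given_by_formsD[OF assms(1)] and D' = given_by_formsD[OF assms(2)]
  have "poly (F * G' - F' * G) t = 0" for t
  proof -
    have "proj_pt (poly F t) (poly G t) = proj_pt (poly F' t) (poly G' t)" using D(5) D'(5) by metis
    then show ?thesis using D(3)[of t] D'(3)[of t] by (subst (asm) proj_pt_eq_iff) auto
  qed
  then have eq: "F * G' = F' * G" using poly_zero_iff_alg_closed[of "F * G' - F' * G"] by auto
  have "\<exists>c. c \<noteq> 0 \<and> F' = smult c F \<and> G' = smult c G"
  proof (cases "F = 0")
    case True
    then obtain g where g: "g \<noteq> 0" "G = [:g:]" using root_free_const[of G] D(3) by auto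
    then have "F' = 0" using eq True by simp
    then obtain g' where g': "g' \<noteq> 0" "G' = [:g':]" using root_free_const[of G'] D'(3) by auto
    show ?thesis using g g' True \<open>F' = 0\<close> by (intro exI[of _ "g' / g"]) auto
  next
    case False
    have "F dvd F' * G" by (simp add: eq[symmetric])
    then have "F dvd F'" using dvd_mult_cancel_no_common_root[OF False] D(3) by blast
    then obtain q where q: "F' = F * q" by (elim dvdE)
    then have "F * (G' - G * q) = 0" using eq by (simp add: algebra_simps)
    then have q': "G' = G * q" using False by simp
    have "poly q t \<noteq> 0" for t using D'(3)[of t] by (auto simp: q q')
    then obtain c where c: "c \<noteq> 0" "q = [:c:]" using root_free_const[of q] by blast
    then show ?thesis using q q' by (intro exI[of _ c]) auto
  qed
  then obtain c where c: "c \<noteq> 0" "F' = smult c F" "G' = smult c G" by blast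
  moreover have "d' = d"
    using given_by_forms_degree[OF assms(1)] given_by_forms_degree[OF assms(2)] c by simp
  ultimately show thesis using that by blast
qed

lemma given_by_forms_comp:
  assumes "given_by_forms \<alpha> m A B" "given_by_forms f d F G"
  shows "\<exists>A' B'. given_by_forms (\<alpha> \<circ> f) (m * d) A' B'"
proof -
  \<comment> \<open>\<open>S A\<close> is the result of substituting the forms \<open>F\<close> and
    \<open>G\<close> into the form \<open>A\<close> of degree m.\<close>
  define S where "S A = (\<Sum>i\<le>m. smult (coeff A i) (F ^ i * G ^ (m - i)))" for A
  have deg: "degree F \<le> d" "degree G \<le> d" using given_by_formsD[OF assms(2)] by auto
  have deg_term: "degree (F ^ i * G ^ (m - i)) \<le> m * d" if "i \<le> m" for i
  proof -
    have "degree (F ^ i * G ^ (m - i)) \<le> i * d + (m - i) * d"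
      using degree_power_le'[OF deg(1), of i] degree_power_le'[OF deg(2), of "m - i"]
      by (intro order.trans[OF degree_mult_le]) simp
    then show ?thesis using that by (simp add: distrib_right[symmetric])
  qed
  have degS: "degree (S A) \<le> m * d" for A
    unfolding S_def using deg_term by (intro degree_sum_le) (auto intro: order.trans[OF degree_smult_le])
  have evalS: "eval_form (m * d) (S A) x y = eval_form m A (eval_form d F x y) (eval_form d G x y)" for A x y
  proof -
    have "eval_form (m * d) (F ^ i * G ^ (m - i)) x y = eval_form d F x y ^ i * eval_form d G x y ^ (m - i)"
      if "i \<le> m" for i
    proof -
      have "m * d = i * d + (m - i) * d" using that by (simp add: distrib_right[symmetric])
      then show ?thesis
        using eval_form_mult[OF degree_power_le'[OF deg(1), of i] degree_power_le'[OF deg(2), of "m - i"]]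
        by (simp add: eval_form_power deg)
    qed
    then show ?thesis
      unfolding S_def eval_form_sum eval_form_smult by (simp add: eval_form_def[of m] mult.assoc)
  qed
  have "given_by_forms (\<alpha> \<circ> f) (m * d) (S A) (S B)"
    unfolding given_by_forms_def
  proof (intro conjI degS allI impI)
    fix x y :: 'a assume "(x, y) \<noteq> (0, 0)"
    then have f: "(eval_form d F x y, eval_form d G x y) \<noteq> (0, 0)"
      "f (proj_pt x y) = proj_pt (eval_form d F x y) (eval_form d G x y)"
      using assms(2) unfolding given_by_forms_def by blast+
    from f(1) have \<alpha>: "(eval_form m A (eval_form d F x y) (eval_form d G x y),
        eval_form m B (eval_form d F x y) (eval_form d G x y)) \<noteq> (0, 0)"
      "\<alpha> (proj_pt (eval_form d F x y) (eval_form d G x y)) =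
        proj_pt (eval_form m A (eval_form d F x y) (eval_form d G x y))
          (eval_form m B (eval_form d F x y) (eval_form d G x y))"
      using assms(1) unfolding given_by_forms_def by blast+
    show "(eval_form (m * d) (S A) x y, eval_form (m * d) (S B) x y) \<noteq> (0, 0)"
      using \<alpha>(1) by (simp only: evalS not_False_eq_True)
    show "(\<alpha> \<circ> f) (proj_pt x y) = proj_pt (eval_form (m * d) (S A) x y) (eval_form (m * d) (S B) x y)"
      using f(2) \<alpha>(2) by (simp only: evalS comp_apply)
  qed
  then show ?thesis by blast
qed

section \<open>Automorphisms of the projective line\<close>

lemma is_morphism_comp: "is_morphism \<alpha> \<Longrightarrow> is_morphism \<beta> \<Longrightarrow> is_morphism (\<alpha> \<circ> \<beta>)"
  unfolding is_morphism_def morphism_of_degree_def using given_by_forms_comp by blast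

lemma proj_line_Aut_comp:
  assumes "\<alpha> \<in> proj_line_Aut" "\<beta> \<in> proj_line_Aut"
  shows "\<alpha> \<circ> \<beta> \<in> proj_line_Aut"
proof -
  obtain \<alpha>' \<beta>' where *: "is_morphism \<alpha>" "is_morphism \<alpha>'" "\<alpha> \<circ> \<alpha>' = id" "\<alpha>' \<circ> \<alpha> = id"
    "is_morphism \<beta>" "is_morphism \<beta>'" "\<beta> \<circ> \<beta>' = id" "\<beta>' \<circ> \<beta> = id"
    using assms by (auto simp: proj_line_Aut_def)
  have "(\<alpha> \<circ> \<beta>) \<circ> (\<beta>' \<circ> \<alpha>') = \<alpha> \<circ> (\<beta> \<circ> \<beta>') \<circ> \<alpha>'" by (simp add: comp_assoc)
  moreover have "(\<beta>' \<circ> \<alpha>') \<circ> (\<alpha> \<circ> \<beta>) = \<beta>' \<circ> (\<alpha>' \<circ> \<alpha>) \<circ> \<beta>" by (simp add: comp_assoc)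
  ultimately have "(\<alpha> \<circ> \<beta>) \<circ> (\<beta>' \<circ> \<alpha>') = id" "(\<beta>' \<circ> \<alpha>') \<circ> (\<alpha> \<circ> \<beta>) = id" by (simp_all add: *)
  then show ?thesis
    unfolding proj_line_Aut_def using * is_morphism_comp by blast
qed

lemma proj_line_Aut_inverse:
  assumes "\<alpha> \<in> proj_line_Aut"
  obtains \<beta> where "\<beta> \<in> proj_line_Aut" "\<alpha> \<circ> \<beta> = id" "\<beta> \<circ> \<alpha> = id"
  using assms by (auto simp: proj_line_Aut_def)

text \<open>For a nonzero determinant the value does not depend on the representative picked by
  \<open>SOME\<close>; this is \<open>mobius_proj_pt\<close>.\<close>

definition mobius :: "'k::field \<Rightarrow> 'k \<Rightarrow> 'k \<Rightarrow> 'k \<Rightarrow> 'k proj_line \<Rightarrow> 'k proj_line" where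
  "mobius k l m n P = (case SOME v. v \<noteq> (0, 0) \<and> P = proj_pt (fst v) (snd v) of
     (x, y) \<Rightarrow> proj_pt (k * x + l * y) (m * x + n * y))"

lemma mobius_nonzero:
  fixes k l m n :: "'k::field"
  assumes "k * n - l * m \<noteq> 0" "(x, y) \<noteq> (0, 0)"
  shows "(k * x + l * y, m * x + n * y) \<noteq> (0, 0)"
proof
  assume "(k * x + l * y, m * x + n * y) = (0, 0)"
  then have eq: "k * x + l * y = 0" "m * x + n * y = 0" by auto
  have "(k * n - l * m) * x = n * (k * x + l * y) - l * (m * x + n * y)" by (simp add: algebra_simps)
  moreover have "(k * n - l * m) * y = k * (m * x + n * y) - m * (k * x + l * y)" by (simp add: algebra_simps)
  ultimately show False using assms eq by simp
qed

lemma mobius_proj_pt: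
  fixes k l m n :: "'k::field"
  assumes "k * n - l * m \<noteq> 0" "(x, y) \<noteq> (0, 0)"
  shows "mobius k l m n (proj_pt x y) = proj_pt (k * x + l * y) (m * x + n * y)"
proof -
  define v where "v = (SOME v. v \<noteq> (0, 0) \<and> proj_pt x y = proj_pt (fst v) (snd v))"
  have "v \<noteq> (0, 0) \<and> proj_pt x y = proj_pt (fst v) (snd v)"
    unfolding v_def by (rule someI[of _ "(x, y)"]) (use assms in auto)
  then obtain x' y' where v: "v = (x', y')" "(x', y') \<noteq> (0, 0)" "proj_pt x y = proj_pt x' y'"
    by (cases v) auto
  obtain \<mu> where \<mu>: "\<mu> \<noteq> 0" "x = \<mu> * x'" "y = \<mu> * y'"
    using proportional_pairs[OF assms(2) v(2)] v(3) proj_pt_eq_iff[OF assms(2) v(2)] by blast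
  have "proj_pt (k * x' + l * y') (m * x' + n * y') = proj_pt (k * x + l * y) (m * x + n * y)"
    by (subst proj_pt_eq_iff[OF mobius_nonzero[OF assms(1) v(2)] mobius_nonzero[OF assms]])
       (simp add: \<mu> algebra_simps)
  then show ?thesis unfolding mobius_def v_def[symmetric] by (simp add: v(1))
qed

lemma given_by_forms_mobius_comp:
  fixes k l m n :: "'k::field"
  assumes det: "k * n - l * m \<noteq> 0" and f: "given_by_forms f d F G"
  shows "given_by_forms (mobius k l m n \<circ> f) d (smult k F + smult l G) (smult m F + smult n G)"
  unfolding given_by_forms_def
proof (intro conjI allI impI)
  show "degree (smult k F + smult l G) \<le> d" "degree (smult m F + smult n G) \<le> d"
    using given_by_formsD(1,2)[OF f] by (auto intro!: degree_add_le order.trans[OF degree_smult_le])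
  fix x y :: 'k assume "(x, y) \<noteq> (0, 0)"
  then have f': "(eval_form d F x y, eval_form d G x y) \<noteq> (0, 0)"
    "f (proj_pt x y) = proj_pt (eval_form d F x y) (eval_form d G x y)"
    using f unfolding given_by_forms_def by blast+
  show "(eval_form d (smult k F + smult l G) x y, eval_form d (smult m F + smult n G) x y) \<noteq> (0, 0)"
    unfolding eval_form_add eval_form_smult by (rule mobius_nonzero[OF det f'(1)])
  show "(mobius k l m n \<circ> f) (proj_pt x y) =
      proj_pt (eval_form d (smult k F + smult l G) x y) (eval_form d (smult m F + smult n G) x y)"
    unfolding eval_form_add eval_form_smult comp_apply f'(2) by (rule mobius_proj_pt[OF det f'(1)])
qed

lemma is_morphism_mobius:
  fixes k l m n :: "'k::field"
  assumes "k * n - l * m \<noteq> 0"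
  shows "is_morphism (mobius k l m n)"
proof -
  have "given_by_forms (mobius k l m n) 1 [:l, k:] [:n, m:]"
    unfolding given_by_forms_def
  proof (intro conjI allI impI)
    fix x y :: 'k assume xy: "(x, y) \<noteq> (0, 0)"
    have ev: "eval_form 1 [:b, a:] x y = a * x + b * y" for a b
      by (simp add: eval_form_def)
    show "(eval_form 1 [:l, k:] x y, eval_form 1 [:n, m:] x y) \<noteq> (0, 0)"
      unfolding ev by (rule mobius_nonzero[OF assms xy])
    show "mobius k l m n (proj_pt x y) = proj_pt (eval_form 1 [:l, k:] x y) (eval_form 1 [:n, m:] x y)"
      unfolding ev by (rule mobius_proj_pt[OF assms xy])
  qed simp_all
  then show ?thesis unfolding is_morphism_def morphism_of_degree_def by blast
qed

text \<open>The composite multiplies both homogeneous coordinates by the determinant.\<close>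

lemma mobius_adjugate:
  fixes k l m n :: "'k::field"
  assumes det: "k * n - l * m \<noteq> 0"
  shows "mobius k l m n \<circ> mobius n (-l) (-m) k = id"
proof
  fix P :: "'k proj_line"
  obtain x y where xy: "(x, y) \<noteq> (0, 0)" "P = proj_pt x y" by (rule proj_pt_cases)
  have det': "n * k - (-l) * (-m) \<noteq> 0" using det by (simp add: mult.commute)
  have nz: "(n * x + (-l) * y, (-m) * x + k * y) \<noteq> (0, 0)" by (rule mobius_nonzero[OF det' xy(1)])
  have "(mobius k l m n \<circ> mobius n (-l) (-m) k) P =
      proj_pt (k * (n * x + (-l) * y) + l * ((-m) * x + k * y)) (m * (n * x + (-l) * y) + n * ((-m) * x + k * y))"
    unfolding xy(2) comp_apply mobius_proj_pt[OF det' xy(1)] mobius_proj_pt[OF det nz] ..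
  also have "\<dots> = proj_pt x y"
    by (subst proj_pt_eq_iff[OF mobius_nonzero[OF det nz] xy(1)]) (simp add: algebra_simps)
  finally show "(mobius k l m n \<circ> mobius n (-l) (-m) k) P = id P" by (simp add: xy(2))
qed

lemma mobius_in_Aut:
  fixes k l m n :: "'k::field"
  assumes det: "k * n - l * m \<noteq> 0"
  shows "mobius k l m n \<in> proj_line_Aut"
proof -
  have det': "n * k - (-l) * (-m) \<noteq> 0" using det by (simp add: mult.commute)
  have "mobius n (-l) (-m) k \<circ> mobius k l m n = id" using mobius_adjugate[OF det'] by simp
  then show ?thesis
    unfolding proj_line_Aut_def
    using is_morphism_mobius[OF det] is_morphism_mobius[OF det'] mobius_adjugate[OF det] by blast
qed

subsection \<open>Separability and the Wronskian\<close>

text \<open>The derivation d/dt of the function field, given by the quotient rule; independence of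
  the chosen fraction is \<open>fract_deriv_Fract\<close>.\<close>

definition fract_deriv :: "'k::field poly fract \<Rightarrow> 'k poly fract" where
  "fract_deriv q = (SOME r. \<exists>a b. b \<noteq> 0 \<and> q = Fract a b \<and> r = Fract (pderiv a * b - a * pderiv b) (b * b))"

lemma fract_deriv_Fract:
  fixes a b :: "'k::field poly"
  assumes "b \<noteq> 0"
  shows "fract_deriv (Fract a b) = Fract (pderiv a * b - a * pderiv b) (b * b)"
proof -
  have "\<exists>c d. d \<noteq> 0 \<and> Fract a b = Fract c d \<and> fract_deriv (Fract a b) = Fract (pderiv c * d - c * pderiv d) (d * d)"
    unfolding fract_deriv_def by (rule someI_ex) (use assms in blast)
  then obtain c d where cd: "d \<noteq> 0" "Fract a b = Fract c d"
    "fract_deriv (Fract a b) = Fract (pderiv c * d - c * pderiv d) (d * d)" by blast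
  have eq: "a * d = c * b" using cd assms by (simp add: eq_fract)
  from arg_cong[OF this, of pderiv] have eq': "pderiv a * d + a * pderiv d = pderiv c * b + c * pderiv b"
    by (simp add: pderiv_mult algebra_simps)
  have "(pderiv c * d - c * pderiv d) * (b * b) = (pderiv c * b + c * pderiv b) * (b * d) - (c * b) * (pderiv b * d + b * pderiv d)"
    by (simp add: algebra_simps)
  also have "\<dots> = (pderiv a * d + a * pderiv d) * (b * d) - (a * d) * (pderiv b * d + b * pderiv d)"
    by (simp only: eq eq')
  also have "\<dots> = (pderiv a * b - a * pderiv b) * (d * d)" by (simp add: algebra_simps)
  finally show ?thesis unfolding cd(3) using cd(1) assms by (simp add: eq_fract)
qed

lemma fract_deriv_add: "fract_deriv (q + r) = fract_deriv q + fract_deriv (r :: 'k::field poly fract)"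
proof -
  obtain a b c d where "q = Fract a b" "b \<noteq> 0" "r = Fract c d" "d \<noteq> 0" by (metis Fract_cases)
  then show ?thesis by (simp add: fract_deriv_Fract eq_fract pderiv_mult pderiv_add algebra_simps)
qed

lemma fract_deriv_mult:
  "fract_deriv (q * r) = fract_deriv q * r + q * fract_deriv (r :: 'k::field poly fract)"
proof -
  obtain a b c d where "q = Fract a b" "b \<noteq> 0" "r = Fract c d" "d \<noteq> 0" by (metis Fract_cases)
  then show ?thesis by (simp add: fract_deriv_Fract eq_fract pderiv_mult algebra_simps)
qed

lemma fract_deriv_const: "fract_deriv (Fract [:c:] 1) = 0"
  by (simp add: fract_deriv_Fract pderiv_pCons Zero_fract_def eq_fract)

lemma fract_deriv_0: "fract_deriv 0 = 0"
  using fract_deriv_const[of 0] by (simp add: Zero_fract_def)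

lemma fract_deriv_divide:
  assumes "fract_deriv q = 0" "fract_deriv r = 0" "r \<noteq> 0"
  shows "fract_deriv (q / r) = 0"
proof -
  have "fract_deriv (q / r * r) = fract_deriv (q / r) * r + q / r * fract_deriv r" by (rule fract_deriv_mult)
  then show ?thesis using assms by simp
qed

lemma fract_deriv_eval_const_poly:
  assumes "fract_deriv \<phi> = 0"
  shows "fract_deriv (eval_const_poly a \<phi>) = 0"
proof (induction a)
  case 0
  then show ?case by (simp add: eval_const_poly_def fract_deriv_0)
next
  case (pCons c a)
  have "eval_const_poly (pCons c a) \<phi> = Fract [:c:] 1 + \<phi> * eval_const_poly a \<phi>"
    by (simp add: eval_const_poly_def map_poly_pCons Zero_fract_def)
  then show ?case using pCons assms by (simp add: fract_deriv_add fract_deriv_mult fract_deriv_const)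
qed

lemma fract_deriv_poly:
  assumes "\<And>i. fract_deriv (coeff m i) = 0"
  shows "fract_deriv (poly m u) = poly (pderiv m) u * fract_deriv u"
  using assms
proof (induction m)
  case 0
  then show ?case by (simp add: fract_deriv_0)
next
  case (pCons c m)
  have "fract_deriv c = 0" using pCons.prems[of 0] by simp
  moreover have "fract_deriv (coeff m i) = 0" for i using pCons.prems[of "Suc i"] by simp
  ultimately show ?case using pCons.IH
    by (simp add: fract_deriv_add fract_deriv_mult pderiv_pCons algebra_simps)
qed

text \<open>If the Wronskian vanished, d/dt would kill F / G and with it the whole generated
  subfield. Differentiating \<open>m(t) = 0\<close> for a polynomial \<open>m\<close> over that
  subfield then gives \<open>m'(t) = 0\<close>, so \<open>m\<close> and its derivative share the
  root t.\<close>

lemma separable_wronskian: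
  fixes F G :: "'k::field poly"
  assumes "G \<noteq> 0" "separable_over (generated_subfield (Fract F G)) (Fract [:0, 1:] 1)"
  shows "pderiv F * G - F * pderiv G \<noteq> 0"
proof
  assume W: "pderiv F * G - F * pderiv G = 0"
  let ?u = "Fract [:0, 1:] 1 :: 'k poly fract"
  have "fract_deriv (Fract F G) = 0" using W assms(1) by (simp add: fract_deriv_Fract Zero_fract_def eq_fract)
  then have L: "fract_deriv r = 0" if "r \<in> generated_subfield (Fract F G)" for r
    using that fract_deriv_divide fract_deriv_eval_const_poly unfolding generated_subfield_def by blast
  obtain m where m: "\<And>i. coeff m i \<in> generated_subfield (Fract F G)" "coprime m (pderiv m)" "poly m ?u = 0"
    using assms(2) by (auto simp: separable_over_def)
  have u: "fract_deriv ?u = 1" by (simp add: fract_deriv_Fract pderiv_pCons One_fract_def one_pCons)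
  have "poly (pderiv m) ?u = 0"
    using fract_deriv_poly[of m ?u] L m(1) m(3) u by (simp add: fract_deriv_0)
  then have "[:- ?u, 1:] dvd m" "[:- ?u, 1:] dvd pderiv m" using m(3) by (simp_all add: poly_eq_0_iff_dvd)
  then have "is_unit [:- ?u, 1:]" using m(2) by (simp add: coprime_common_divisor)
  then show False by (simp add: is_unit_pCons_iff)
qed

subsection \<open>Normal form at an unramified point\<close>

definition wronskian :: "'k::field poly \<Rightarrow> 'k poly \<Rightarrow> 'k poly" where
  "wronskian F G = pderiv F * G - F * pderiv G"

lemma degree_pderiv_le: "degree (pderiv q) \<le> degree q - 1" for q :: "'k::field poly"
  by (rule degree_le) (auto simp: coeff_pderiv coeff_eq_0)

text \<open>The obvious bound 2d - 1 improves by one: subtracting a multiple of \<open>G\<close>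
  from \<open>F\<close> keeps the Wronskian and brings the degree of one entry below d.\<close>

lemma wronskian_degree:
  fixes F G :: "'k::field poly"
  assumes "degree F \<le> d" "degree G \<le> d" "d > 0"
  shows "degree (wronskian F G) \<le> 2 * d - 2"
proof -
  have aux: "degree (wronskian A B) \<le> 2 * d - 2" if A: "degree A \<le> d - 1" and B: "degree B \<le> d" for A B :: "'k poly"
  proof -
    have "degree (pderiv A * B) \<le> 2 * d - 2"
    proof (cases "degree A = 0")
      case True
      then have "pderiv A = 0" by (metis degree_eq_zeroE pderiv_singleton)
      then show ?thesis by simp
    next
      case False
      then have "degree (pderiv A) \<le> d - 2" "d \<ge> 2" using degree_pderiv_le[of A] A by linarith+
      then show ?thesis using degree_mult_le[of "pderiv A" B] B by linarith
    qed
    moreover have "degree (A * pderiv B) \<le> 2 * d - 2"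
      using degree_mult_le[of A "pderiv B"] degree_pderiv_le[of B] A B by linarith
    ultimately show ?thesis unfolding wronskian_def by (rule degree_diff_le)
  qed
  show ?thesis
  proof (cases "coeff G d = 0")
    case True
    have "degree G \<le> d - 1"
    proof (rule degree_le, intro allI impI)
      fix i assume "d - 1 < i"
      then show "coeff G i = 0" using True assms(2) by (cases "i = d") (simp_all add: coeff_eq_0)
    qed
    from aux[OF this assms(1)] have "degree (- wronskian G F) \<le> 2 * d - 2" by simp
    moreover have "- wronskian G F = wronskian F G" by (simp add: wronskian_def mult.commute)
    ultimately show ?thesis by simp
  next
    case False
    let ?A = "F - smult (coeff F d / coeff G d) G"
    have "degree ?A \<le> d - 1"
    proof (rule degree_le, intro allI impI)
      fix i assume "d - 1 < i"
      then show "coeff ?A i = 0" using False assms(1,2) by (cases "i = d") (simp_all add: coeff_eq_0)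
    qed
    from aux[OF this assms(2)] have "degree (wronskian ?A G) \<le> 2 * d - 2" .
    moreover have "wronskian ?A G = wronskian F G"
      by (simp add: wronskian_def pderiv_diff pderiv_smult algebra_simps)
    ultimately show ?thesis by simp
  qed
qed

lemma linear_power_dvd_pderiv:
  assumes "[:-a, 1:] ^ e dvd q"
  shows "[:-a, 1:] ^ (e - 1) dvd pderiv (q :: 'k::field poly)"
proof (cases e)
  case (Suc m)
  obtain r where "q = [:-a, 1:] ^ Suc m * r" using assms unfolding Suc by (elim dvdE)
  then have "pderiv q = [:-a, 1:] ^ m * ([:-a, 1:] * pderiv r + smult (of_nat (Suc m)) (pderiv [:-a, 1:] * r))"
    by (simp only: pderiv_mult pderiv_power_Suc) (simp add: algebra_simps)
  then show ?thesis using Suc by simp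
qed simp

text \<open>Put D = G(a) F - F(a) G. The Wronskians of D with \<open>G\<close> and with
  \<open>F\<close> are G(a) and F(a) times that of \<open>F\<close> and \<open>G\<close>, one of
  these scalars is nonzero, and the power divides both D and its derivative.\<close>

lemma ramification_dvd_wronskian:
  fixes F G :: "'k::field poly"
  assumes "poly F a \<noteq> 0 \<or> poly G a \<noteq> 0"
    and "[:-a, 1:] ^ e dvd smult (poly G a) F - smult (poly F a) G"
  shows "[:-a, 1:] ^ (e - 1) dvd wronskian F G"
proof -
  let ?D = "smult (poly G a) F - smult (poly F a) G"
  have dvd: "[:-a, 1:] ^ (e - 1) dvd ?D" using assms(2) by (meson diff_le_self dvd_trans le_imp_power_dvd)
  have dvd': "[:-a, 1:] ^ (e - 1) dvd pderiv ?D" using assms(2) by (rule linear_power_dvd_pderiv)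
  have "[:-a, 1:] ^ (e - 1) dvd pderiv ?D * H - ?D * pderiv H" for H
    by (rule dvd_diff[OF dvd_mult2[OF dvd'] dvd_mult2[OF dvd]])
  moreover have "pderiv ?D * G - ?D * pderiv G = smult (poly G a) (wronskian F G)"
    by (simp add: wronskian_def pderiv_diff pderiv_smult algebra_simps smult_diff_right)
  moreover have "pderiv ?D * F - ?D * pderiv F = smult (poly F a) (wronskian F G)"
    by (simp add: wronskian_def pderiv_diff pderiv_smult algebra_simps smult_diff_right)
  ultimately have "[:-a, 1:] ^ (e - 1) dvd smult (poly G a) (wronskian F G)"
    "[:-a, 1:] ^ (e - 1) dvd smult (poly F a) (wronskian F G)" by metis+
  then show ?thesis using assms(1) by (auto simp: dvd_smult_iff)
qed

lemma wronskian_nonzero_imp_independent: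
  fixes F G :: "'k::field poly"
  assumes "wronskian F G \<noteq> 0" "s \<noteq> 0 \<or> t \<noteq> 0"
  shows "smult s F - smult t G \<noteq> 0"
proof
  assume "smult s F - smult t G = 0"
  then have eq: "smult s F = smult t G" by simp
  then have eq': "smult s (pderiv F) = smult t (pderiv G)" by (metis pderiv_smult)
  have "smult s (wronskian F G) = smult s (pderiv F) * G - smult s F * pderiv G"
    by (simp add: wronskian_def smult_diff_right)
  then have 1: "smult s (wronskian F G) = 0" unfolding eq eq' by (simp add: mult.commute)
  have "smult t (wronskian F G) = pderiv F * smult t G - F * smult t (pderiv G)"
    by (simp add: wronskian_def smult_diff_right)
  then have 2: "smult t (wronskian F G) = 0" unfolding eq[symmetric] eq'[symmetric] by (simp add: mult.commute)
  show False using 1 2 assms by simp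
qed

lemma separable_morphism_wronskian:
  fixes f :: "'k::alg_closed_field proj_line \<Rightarrow> 'k proj_line"
  assumes "separable_morphism f" "given_by_forms f d F G"
  shows "wronskian F G \<noteq> 0"
proof -
  obtain d' F' G' where f': "given_by_forms f d' F' G'" "G' \<noteq> 0"
    "\<And>u. separable_over (generated_subfield (Fract F' G')) u"
    using assms(1) unfolding separable_morphism_def by blast
  obtain c where c: "c \<noteq> 0" "F' = smult c F" "G' = smult c G" by (rule given_by_forms_unique[OF assms(2) f'(1)])
  have "wronskian F' G' \<noteq> 0" unfolding wronskian_def by (rule separable_wronskian[OF f'(2,3)])
  moreover have "wronskian F' G' = smult (c * c) (wronskian F G)"
    by (simp add: c wronskian_def pderiv_smult smult_diff_right)
  ultimately show ?thesis by auto
qed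

text \<open>The definition allows any forms for \<open>f\<close> and any homogeneous coordinates for
  the point and its image. All choices differ by nonzero scalars, which do not affect the
  order.\<close>

lemma ramified_to_order_forms:
  fixes f :: "'k::alg_closed_field proj_line \<Rightarrow> 'k proj_line"
  assumes "ramified_to_order f (proj_pt a 1) e" "given_by_forms f d F G"
  shows "order a (smult (poly G a) F - smult (poly F a) G) = e"
proof -
  obtain d' F' G' x y \<alpha> \<beta> where f': "given_by_forms f d' F' G'" "(x, y) \<noteq> (0, 0)" "proj_pt a 1 = proj_pt x y"
    "(\<alpha>, \<beta>) \<noteq> (0, 0)" "f (proj_pt a 1) = proj_pt \<alpha> \<beta>"
    "form_order d' (smult \<beta> F' - smult \<alpha> G') x y = e"
    using assms(1) unfolding ramified_to_order_def by blast
  obtain c where c: "c \<noteq> 0" "F' = smult c F" "G' = smult c G" "d' = d"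
    by (rule given_by_forms_unique[OF assms(2) f'(1)])
  have "a * y = x * 1" using f'(2,3) by (subst (asm) proj_pt_eq_iff) auto
  then have xy: "y \<noteq> 0" "x / y = a" using f'(2) by (auto simp: field_simps)
  have nz: "(poly F a, poly G a) \<noteq> (0, 0)" using given_by_formsD(3)[OF assms(2), of a] by auto
  have "proj_pt (poly F a) (poly G a) = proj_pt \<alpha> \<beta>" using given_by_formsD(5)[OF assms(2), of a] f'(5) by simp
  then have "poly F a * \<beta> = \<alpha> * poly G a" using proj_pt_eq_iff[OF nz f'(4)] by simp
  then obtain \<mu> where \<mu>: "\<mu> \<noteq> 0" "poly F a = \<mu> * \<alpha>" "poly G a = \<mu> * \<beta>"
    using proportional_pairs[OF nz f'(4)] by blast
  have "smult (poly G a) F - smult (poly F a) G = smult (\<mu> / c) (smult \<beta> F' - smult \<alpha> G')"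
    using c(1) by (simp add: \<mu>(2,3) c smult_diff_right)
  then have "order a (smult (poly G a) F - smult (poly F a) G) = order a (smult \<beta> F' - smult \<alpha> G')"
    using \<mu>(1) c(1) by (simp add: order_smult)
  also have "\<dots> = e" using f'(6) xy by (simp add: form_order_def)
  finally show ?thesis .
qed

theorem ramified_map_normal_form:
  fixes f :: "'k::alg_closed_field proj_line \<Rightarrow> 'k proj_line" and d n :: nat
  assumes f: "f \<in> ramified_maps d n e P" and P: "\<And>i. i < n \<Longrightarrow> P i = proj_pt (a i) 1"
    and a: "inj_on a {..<n}" "\<And>i. i < n \<Longrightarrow> a i \<noteq> 0"
    and d: "d > 0" and sum_e: "(\<Sum>i<n. e i - 1) = 2 * d - 2"
  shows "\<exists>\<alpha>\<in>proj_line_Aut. \<exists>F G. (F, G) \<in> normal_pairs d n e a \<and> given_by_forms (\<alpha> \<circ> f) d F G"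
proof -
  obtain F G where FG: "given_by_forms f d F G" and sep: "separable_morphism f"
    and ram: "\<And>i. i < n \<Longrightarrow> ramified_to_order f (proj_pt (a i) 1) (e i)"
    using f P unfolding ramified_maps_def morphism_of_degree_def by force
  note D = given_by_formsD[OF FG]
  let ?D = "\<lambda>i. smult (poly G (a i)) F - smult (poly F (a i)) G"
  have W: "wronskian F G \<noteq> 0" by (rule separable_morphism_wronskian[OF sep FG])
  have D_nz: "?D i \<noteq> 0" for i using wronskian_nonzero_imp_independent[OF W] D(3)[of "a i"] by blast
  have D_ord: "order (a i) (?D i) = e i" if "i < n" for i by (rule ramified_to_order_forms[OF ram[OF that] FG])
  have "[:-a i, 1:] ^ (e i - 1) dvd wronskian F G" if "i < n" for i
    using order_1[of "a i" "?D i"] D_ord[OF that] D(3) by (intro ramification_dvd_wronskian) auto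
  then have "(\<Prod>i<n. [:-a i, 1:] ^ (e i - 1)) dvd wronskian F G"
    using a(1) by (intro prod_linear_powers_dvd) auto
  then obtain q where q: "wronskian F G = (\<Prod>i<n. [:-a i, 1:] ^ (e i - 1)) * q" by (elim dvdE)
  have "degree (wronskian F G) = (2 * d - 2) + degree q"
    unfolding q using W q by (subst degree_mult_eq) (auto simp: degree_prod_linear_powers sum_e[unfolded One_nat_def])
  \<comment> \<open>The ramification at the \<open>a i\<close> exhausts the degree of the Wronskian,
    whose only roots are therefore among the nonzero \<open>a i\<close>.\<close>
  then have "degree q = 0" using wronskian_degree[OF D(1,2) d] by simp
  then obtain \<kappa> where "q = [:\<kappa>:]" by (rule degree_eq_zeroE)
  then have "poly (wronskian F G) 0 = (\<Prod>i<n. (- a i) ^ (e i - 1)) * \<kappa>" "\<kappa> \<noteq> 0"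
    using W q by (auto simp: poly_prod)
  then have "poly (wronskian F G) 0 \<noteq> 0" using a(2) by simp
  define \<Delta> where "\<Delta> = coeff F 1 * coeff G 0 - coeff F 0 * coeff G 1"
  have \<Delta>: "\<Delta> \<noteq> 0"
    using \<open>poly (wronskian F G) 0 \<noteq> 0\<close> by (simp add: \<Delta>_def wronskian_def poly_0_coeff_0 coeff_pderiv coeff_mult)
  \<comment> \<open>Here \<Delta> is the value of the Wronskian at 0. \<open>k\<close> and
    \<open>l\<close> make the numerator T + O(T^2), and the first summands of \<open>m\<close> and
    \<open>h\<close> make the denominator 1 + O(T^2). Adding \<open>coeff Fn 2\<close> times the
    numerator to the denominator then cancels the quadratic term of the quotient.\<close>
  define k where "k = coeff G 0 / \<Delta>"
  define l where "l = - coeff F 0 / \<Delta>"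
  define Fn where "Fn = smult k F + smult l G"
  define m where "m = - coeff G 1 / \<Delta> + coeff Fn 2 * k"
  define h where "h = coeff F 1 / \<Delta> + coeff Fn 2 * l"
  define Gn where "Gn = smult m F + smult h G"
  have "k * h - l * m = k * (coeff F 1 / \<Delta>) - l * (- coeff G 1 / \<Delta>)"
    unfolding h_def m_def by (simp add: algebra_simps)
  also have "\<dots> = (coeff F 1 * coeff G 0 - coeff F 0 * coeff G 1) / (\<Delta> * \<Delta>)"
    by (simp add: k_def l_def diff_divide_distrib mult_ac)
  also have "\<dots> = 1 / \<Delta>" using \<Delta> unfolding \<Delta>_def[symmetric] by simp
  finally have det: "k * h - l * m \<noteq> 0" using \<Delta> by simp
  have gf: "given_by_forms (mobius k l m h \<circ> f) d Fn Gn"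
    unfolding Fn_def Gn_def by (rule given_by_forms_mobius_comp[OF det FG])
  have Fn01: "coeff Fn 0 = 0" "coeff Fn 1 = 1"
  proof -
    have "coeff Fn 1 = (coeff F 1 * coeff G 0 - coeff F 0 * coeff G 1) / \<Delta>"
      by (simp add: Fn_def k_def l_def diff_divide_distrib mult.commute)
    then show "coeff Fn 1 = 1" using \<Delta> unfolding \<Delta>_def[symmetric] by simp
  qed (simp add: Fn_def k_def l_def)
  have Gn_eq: "Gn = smult (- coeff G 1 / \<Delta>) F + smult (coeff F 1 / \<Delta>) G + smult (coeff Fn 2) Fn"
    by (rule poly_eqI) (simp add: Gn_def m_def h_def Fn_def algebra_simps)
  have Gn01: "coeff Gn 0 = 1" "coeff Gn 1 = coeff Fn 2"
  proof -
    have "coeff Gn 0 = (coeff F 1 * coeff G 0 - coeff F 0 * coeff G 1) / \<Delta>"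
      using Fn01 by (simp add: Gn_eq diff_divide_distrib mult.commute)
    then show "coeff Gn 0 = 1" using \<Delta> unfolding \<Delta>_def[symmetric] by simp
    show "coeff Gn 1 = coeff Fn 2" using Fn01 by (simp add: Gn_eq)
  qed
  have wedge: "smult (poly Gn (a i)) Fn - smult (poly Fn (a i)) Gn = smult (k * h - l * m) (?D i)" for i
    by (simp add: Fn_def Gn_def smult_diff_right smult_add_right algebra_simps smult_add_left smult_diff_left)
  have wedge_nz: "smult (poly Gn (a i)) Fn - smult (poly Fn (a i)) Gn \<noteq> 0" for i
    unfolding wedge using D_nz[of i] det unfolding smult_eq_0_iff by blast
  have wedge_order: "order (a i) (smult (poly Gn (a i)) Fn - smult (poly Fn (a i)) Gn) = e i" if "i < n" for i
    unfolding wedge order_smult[OF det] by (rule D_ord[OF that])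
  have "(Fn, Gn) \<in> normal_pairs d n e a"
    using given_by_formsD[OF gf] Fn01 Gn01 wedge_nz wedge_order unfolding normal_pairs_def by blast
  then show ?thesis using gf mobius_in_Aut[OF det] by blast
qed

text \<open>Two maps with a common normal form differ by an automorphism of the target, so a choice
  of normal forms separates the classes.\<close>

lemma ramified_map_classes_finite:
  fixes P :: "nat \<Rightarrow> 'k::alg_closed_field proj_line"
  assumes "finite N" "\<And>f. f \<in> ramified_maps d n e P \<Longrightarrow>
    \<exists>\<alpha>\<in>proj_line_Aut. \<exists>F G. (F, G) \<in> N \<and> given_by_forms (\<alpha> \<circ> f) d F G"
  shows "finite (ramified_map_classes d n e P)"
proof -
  let ?M = "ramified_maps d n e P"
  have "\<forall>f. \<exists>FG. f \<in> ?M \<longrightarrow> FG \<in> N \<and> (\<exists>\<alpha>\<in>proj_line_Aut. given_by_forms (\<alpha> \<circ> f) d (fst FG) (snd FG))"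
    using assms(2) by fastforce
  then obtain \<Phi> where \<Phi>: "\<And>f. f \<in> ?M \<Longrightarrow> \<Phi> f \<in> N"
    "\<And>f. f \<in> ?M \<Longrightarrow> \<exists>\<alpha>\<in>proj_line_Aut. given_by_forms (\<alpha> \<circ> f) d (fst (\<Phi> f)) (snd (\<Phi> f))" by metis
  have class_subset: "image_aut_rel ?M `` {f} \<subseteq> image_aut_rel ?M `` {g}"
    if fg: "f \<in> ?M" "g \<in> ?M" "\<Phi> f = \<Phi> g" for f g
  proof
    fix h assume "h \<in> image_aut_rel ?M `` {f}"
    then obtain \<gamma> where \<gamma>: "h \<in> ?M" "\<gamma> \<in> proj_line_Aut" "h = \<gamma> \<circ> f" by (auto simp: image_aut_rel_def)
    obtain \<alpha> \<beta> where \<alpha>: "\<alpha> \<in> proj_line_Aut" "given_by_forms (\<alpha> \<circ> f) d (fst (\<Phi> f)) (snd (\<Phi> f))"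
      and \<beta>: "\<beta> \<in> proj_line_Aut" "given_by_forms (\<beta> \<circ> g) d (fst (\<Phi> f)) (snd (\<Phi> f))"
      using \<Phi>(2)[OF fg(1)] \<Phi>(2)[OF fg(2)] fg(3) by auto
    have "(\<alpha> \<circ> f) Q = (\<beta> \<circ> g) Q" for Q
    proof -
      obtain x y where xy: "(x, y) \<noteq> (0, 0)" "Q = proj_pt x y" by (rule proj_pt_cases)
      then show ?thesis using \<alpha>(2) \<beta>(2) unfolding given_by_forms_def by metis
    qed
    then have eq: "\<alpha> \<circ> f = \<beta> \<circ> g" by (rule ext)
    obtain \<alpha>' where \<alpha>': "\<alpha>' \<in> proj_line_Aut" "\<alpha>' \<circ> \<alpha> = id" using \<alpha>(1) by (rule proj_line_Aut_inverse)
    have "h = \<gamma> \<circ> (\<alpha>' \<circ> \<alpha>) \<circ> f" by (simp add: \<alpha>' \<gamma>)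
    also have "\<dots> = (\<gamma> \<circ> \<alpha>' \<circ> \<beta>) \<circ> g" using eq by (simp add: comp_assoc)
    finally have "h = (\<gamma> \<circ> \<alpha>' \<circ> \<beta>) \<circ> g" .
    moreover have "\<gamma> \<circ> \<alpha>' \<circ> \<beta> \<in> proj_line_Aut" by (intro proj_line_Aut_comp \<gamma> \<alpha>' \<beta>)
    ultimately show "h \<in> image_aut_rel ?M `` {g}" using fg(2) \<gamma>(1) by (auto simp: image_aut_rel_def)
  qed
  then have class_eq: "image_aut_rel ?M `` {f} = image_aut_rel ?M `` {g}" if "f \<in> ?M" "g \<in> ?M" "\<Phi> f = \<Phi> g" for f g
    using that by (intro equalityI) auto
  let ?rep = "\<lambda>FG. image_aut_rel ?M `` {SOME f. f \<in> ?M \<and> \<Phi> f = FG}"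
  have "ramified_map_classes d n e P \<subseteq> ?rep ` N"
  proof
    fix C assume "C \<in> ramified_map_classes d n e P"
    then obtain f where f: "f \<in> ?M" "C = image_aut_rel ?M `` {f}"
      by (auto simp: ramified_map_classes_def quotient_def)
    have "(SOME g. g \<in> ?M \<and> \<Phi> g = \<Phi> f) \<in> ?M \<and> \<Phi> (SOME g. g \<in> ?M \<and> \<Phi> g = \<Phi> f) = \<Phi> f"
      by (rule someI[of _ f]) (use f in simp)
    then have "C = ?rep (\<Phi> f)" unfolding f(2) using f(1) by (intro class_eq) auto
    then show "C \<in> ?rep ` N" using \<Phi>(1)[OF f(1)] by blast
  qed
  then show ?thesis using assms(1) by (meson finite_imageI finite_subset)
qed

subsection \<open>Zariski open sets from polynomial functions\<close>

text \<open>\<open>H\<close> is homogenized in degree \<open>N + 1\<close>, not \<open>N\<close>, in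
  each pair of variables: the extra factor \<open>y i\<close> makes the form vanish as soon as some
  point is at infinity, so the open set consists of affine points.\<close>

lemma nonvanishing_open:
  fixes H :: "(nat \<Rightarrow> 'k::alg_closed_field) \<Rightarrow> 'k"
  assumes "H \<in> nonzero_polyfuns {..<n}"
  obtains U where "zariski_open n U" "U \<noteq> {}"
    "\<And>P. P \<in> U \<Longrightarrow> \<exists>a. H a \<noteq> 0 \<and> (\<forall>i<n. P i = proj_pt (a i) 1)"
proof -
  obtain N where "H \<in> polys_le {..<n} (\<lambda>j a. a j) N" using assms by (auto simp: nonzero_polyfuns_def)
  then obtain c where c: "H = (\<lambda>a. \<Sum>I\<in>(\<Pi>\<^sub>E i\<in>{..<n}. {..N}). c I * mono_fun {..<n} (\<lambda>j a. a j) I a)"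
    using polys_le_explicit[of "{..<n}" H "\<lambda>j a. a j" N] by auto
  obtain a0 where a0: "H a0 \<noteq> 0" using assms by (auto simp: nonzero_polyfuns_def)
  let ?E = "\<Pi>\<^sub>E i\<in>{..<n}. {..N}" and ?E' = "\<Pi>\<^sub>E i\<in>{..<n}. {..N + 1}"
  define m :: "nat \<Rightarrow> nat" where "m i = N + 1" for i
  define c' where "c' I = (if I \<in> ?E then c I else 0)" for I
  have eval: "eval_multiform n m c' x y = (\<Sum>I\<in>?E. c I * (\<Prod>i<n. x i ^ I i * y i ^ (N + 1 - I i)))" for x y
  proof -
    have "?E \<subseteq> ?E'" by (intro PiE_mono) auto
    moreover have "finite ?E'" by (intro finite_PiE) auto
    ultimately show ?thesis
      unfolding eval_multiform_def m_def
      by (intro sum.mono_neutral_cong_right) (auto simp: c'_def)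
  qed
  have eval_0: "eval_multiform n m c' x y = 0" if "i < n" "y i = 0" for x y i
    unfolding eval
  proof (intro sum.neutral ballI)
    fix I assume "I \<in> ?E"
    then have "I i \<le> N" using that(1) by auto
    then have "x i ^ I i * y i ^ (N + 1 - I i) = 0" using that by (simp add: Suc_diff_le)
    then have "(\<Prod>i<n. x i ^ I i * y i ^ (N + 1 - I i)) = 0" using that(1) by (intro prod_zero) auto
    then show "c I * (\<Prod>i<n. x i ^ I i * y i ^ (N + 1 - I i)) = 0" by simp
  qed
  have eval_nz: "eval_multiform n m c' x y = (\<Prod>i<n. y i ^ (N + 1)) * H (\<lambda>i. x i / y i)"
    if y: "\<And>i. i < n \<Longrightarrow> y i \<noteq> 0" for x y
  proof -
    have "(\<Prod>i<n. x i ^ I i * y i ^ (N + 1 - I i)) = (\<Prod>i<n. y i ^ (N + 1)) * mono_fun {..<n} (\<lambda>j a. a j) I (\<lambda>i. x i / y i)"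
      if I: "I \<in> ?E" for I
      unfolding mono_fun_def prod.distrib[symmetric]
    proof (intro prod.cong refl)
      fix i assume i: "i \<in> {..<n}"
      have "N + 1 = (N + 1 - I i) + I i" using PiE_mem[OF I i] by simp
      then have eq: "y i ^ (N + 1) = y i ^ (N + 1 - I i) * y i ^ I i" by (metis power_add)
      have "y i ^ I i \<noteq> 0" using y i by simp
      then show "x i ^ I i * y i ^ (N + 1 - I i) = y i ^ (N + 1) * (x i / y i) ^ I i"
        unfolding eq power_divide by (simp add: field_simps del: power_eq_0_iff)
    qed
    then show ?thesis unfolding eval c by (simp add: sum_distrib_left mult_ac)
  qed
  let ?U = "{P \<in> proj_power n. \<not> multiform_vanishes n m c' P}"
  have "zariski_open n ?U"
    unfolding zariski_open_def zariski_closed_def by (intro conjI exI[of _ "{(m, c')}"]) auto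
  moreover have "?U \<noteq> {}"
  proof -
    let ?P = "restrict (\<lambda>i. proj_pt (a0 i) 1) {..<n}"
    have nz: "eval_multiform n m c' a0 (\<lambda>_. 1) \<noteq> 0" using a0 by (subst eval_nz) simp_all
    have "\<not> multiform_vanishes n m c' ?P"
    proof
      assume "multiform_vanishes n m c' ?P"
      from spec[OF spec[OF this[unfolded multiform_vanishes_def], of a0], of "\<lambda>_. 1"]
      show False using nz by simp
    qed
    moreover have "?P \<in> proj_power n" by (auto simp: proj_power_def)
    ultimately show ?thesis by blast
  qed
  moreover have "\<exists>a. H a \<noteq> 0 \<and> (\<forall>i<n. P i = proj_pt (a i) 1)" if P: "P \<in> ?U" for P
  proof -
    obtain x y where xy: "\<forall>i<n. (x i, y i) \<noteq> (0, 0) \<and> P i = proj_pt (x i) (y i)" "eval_multiform n m c' x y \<noteq> 0"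
      using P unfolding multiform_vanishes_def by blast
    have y: "y i \<noteq> 0" if "i < n" for i using eval_0[OF that] xy(2) by blast
    have "H (\<lambda>i. x i / y i) \<noteq> 0" using xy(2) y by (subst (asm) eval_nz) auto
    moreover have "P i = proj_pt (x i / y i) 1" if "i < n" for i
    proof -
      have "(x i, y i) \<noteq> (0, 0)" "P i = proj_pt (x i) (y i)" using xy(1) that by auto
      moreover have "proj_pt (x i) (y i) = proj_pt (x i / y i) 1"
        using y[OF that] by (subst proj_pt_eq_iff) auto
      ultimately show ?thesis by simp
    qed
    ultimately show ?thesis by blast
  qed
  ultimately show thesis by (rule that)
qed

lemma polyfun_difference_nonzero:
  assumes "finite Z" "i \<in> Z" "j \<in> Z" "i \<noteq> j"
  shows "(\<lambda>a. a i - a j) \<in> nonzero_polyfuns Z"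
  unfolding nonzero_polyfuns_def
proof (intro CollectI conjI exI)
  show "(\<lambda>a. a i - a j) \<in> polyfuns Z" by (rule polyfuns_diff[OF polyfuns_var polyfuns_var]) fact+
  show "(if i = i then 1 else 0) - (if j = i then 1 else 0) \<noteq> (0 :: 'b)" using assms by simp
qed

lemma polyfun_var_nonzero:
  assumes "finite Z" "i \<in> Z"
  shows "(\<lambda>a. a i) \<in> nonzero_polyfuns Z"
  unfolding nonzero_polyfuns_def
  using polyfuns_var[OF assms] by (intro CollectI conjI exI[of _ "\<lambda>_. 1"]) simp_all

theorem theorem3p3:
  fixes p n d :: nat and e :: "nat \<Rightarrow> nat"
  assumes "CHAR('k::alg_closed_field) = p" and "p > 2"
    and "\<And>i. i < n \<Longrightarrow> e i > 0 \<and> coprime (e i) p"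
    and "d > 0"
    and "(\<Sum>i<n. int (e i) - 1) = 2 * int d - 2"
  shows "\<exists>U :: (nat \<Rightarrow> 'k proj_line) set.
           zariski_open n U \<and> U \<noteq> {} \<and> (\<forall>P\<in>U. inj_on P {..<n}) \<and>
           (\<forall>P\<in>U. finite (ramified_map_classes d n e P) \<and>
              \<not> (\<exists>C\<in>ramified_map_classes d n e P. \<exists>f\<in>C. \<exists>i<n. \<exists>j<n. i \<noteq> j \<and> f (P i) = f (P j)))"
proof -
  have p: "prime p" using assms(1,2) prime_CHAR_semidom[where 'a='k] by auto
  have e: "e i > 0" "coprime (e i) p" if "i < n" for i using assms(3)[OF that] by auto
  \<comment> \<open>Positivity of the \<open>e i\<close> reconciles truncated subtraction with that
    of the integers.\<close>
  have "int (\<Sum>i<n. e i - 1) = (\<Sum>i<n. int (e i) - 1)"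
    unfolding of_nat_sum using e(1) by (intro sum.cong) (auto simp: of_nat_diff Suc_leI)
  then have sum_e: "(\<Sum>i<n. e i - 1) = 2 * d - 2" using assms(4,5) by linarith
  obtain H :: "(nat \<Rightarrow> 'k) \<Rightarrow> 'k" where H: "H \<in> nonzero_polyfuns {..<n}"
    "\<forall>a. inj_on a {..<n} \<and> (\<forall>i<n. a i \<noteq> 0) \<and> H a \<noteq> 0 \<longrightarrow> finite (normal_pairs d n e a) \<and>
      (\<forall>F G i j. (F, G) \<in> normal_pairs d n e a \<and> i < n \<and> j < n \<and> i \<noteq> j \<longrightarrow>
        poly F (a i) * poly G (a j) \<noteq> poly F (a j) * poly G (a i))"
    using normal_pairs_generic[OF p assms(1,4) sum_e e] by (rule bexE)
  let ?P = "{(i, j). i < n \<and> j < n \<and> i \<noteq> j}"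
  have finP: "finite ?P" by (rule finite_subset[of _ "{..<n} \<times> {..<n}"]) auto
  \<comment> \<open>The additional factors keep the points distinct and away from 0, which is
    reserved for the normalization.\<close>
  let ?H = "\<lambda>a. H a * ((\<Prod>i<n. a i) * (\<Prod>ij\<in>?P. a (fst ij) - a (snd ij)))"
  have "?H \<in> nonzero_polyfuns {..<n}"
    using finP by (intro nonzero_polyfuns_mult nonzero_polyfuns_prod H(1))
      (auto intro!: polyfun_difference_nonzero polyfun_var_nonzero)
  then obtain U where U: "zariski_open n U" "U \<noteq> {}"
    "\<And>P. P \<in> U \<Longrightarrow> \<exists>a. ?H a \<noteq> 0 \<and> (\<forall>i<n. P i = proj_pt (a i) 1)"
    by (rule nonvanishing_open) blast
  have generic: "inj_on P {..<n} \<and> finite (ramified_map_classes d n e P) \<and>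
      (\<forall>f\<in>ramified_maps d n e P. \<forall>i<n. \<forall>j<n. i \<noteq> j \<longrightarrow> f (P i) \<noteq> f (P j))" if "P \<in> U" for P
  proof -
    obtain a where a: "?H a \<noteq> 0" and P: "\<And>i. i < n \<Longrightarrow> P i = proj_pt (a i) 1" using U(3)[OF \<open>P \<in> U\<close>] by blast
    have "a i - a j \<noteq> 0" if "i < n" "j < n" "i \<noteq> j" for i j
      using a that finP by (auto simp: prod_zero_iff)
    then have inj: "inj_on a {..<n}" by (auto simp: inj_on_def)
    have nz: "a i \<noteq> 0" if "i < n" for i using a that by (auto simp: prod_zero_iff)
    have Ha: "H a \<noteq> 0" using a by auto
    have N: "finite (normal_pairs d n e a)"
      "\<And>F G i j. (F, G) \<in> normal_pairs d n e a \<Longrightarrow> i < n \<Longrightarrow> j < n \<Longrightarrow> i \<noteq> j \<Longrightarrow>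
        poly F (a i) * poly G (a j) \<noteq> poly F (a j) * poly G (a i)"
      using spec[OF H(2), of a] inj nz Ha by blast+
    have nf: "\<exists>\<alpha>\<in>proj_line_Aut. \<exists>F G. (F, G) \<in> normal_pairs d n e a \<and> given_by_forms (\<alpha> \<circ> f) d F G"
      if "f \<in> ramified_maps d n e P" for f
      by (rule ramified_map_normal_form[OF that P inj nz assms(4) sum_e])
    have "inj_on P {..<n}"
    proof (rule inj_onI)
      fix i j assume ij: "i \<in> {..<n}" "j \<in> {..<n}" "P i = P j"
      then have "proj_pt (a i) 1 = proj_pt (a j) 1" using P by auto
      then have "a i = a j" by (subst (asm) proj_pt_eq_iff) auto
      then show "i = j" using inj ij by (auto dest: inj_onD)
    qed
    moreover have "finite (ramified_map_classes d n e P)"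
      by (rule ramified_map_classes_finite[OF N(1) nf])
    moreover have "f (P i) \<noteq> f (P j)" if f: "f \<in> ramified_maps d n e P" and ij: "i < n" "j < n" "i \<noteq> j" for f i j
    proof
      assume "f (P i) = f (P j)"
      obtain \<alpha> F G where FG: "(F, G) \<in> normal_pairs d n e a" "given_by_forms (\<alpha> \<circ> f) d F G" using nf[OF f] by blast
      note D = given_by_formsD[OF FG(2)]
      have "(\<alpha> \<circ> f) (proj_pt (a i) 1) = (\<alpha> \<circ> f) (proj_pt (a j) 1)" using \<open>f (P i) = f (P j)\<close> P ij by simp
      then have "proj_pt (poly F (a i)) (poly G (a i)) = proj_pt (poly F (a j)) (poly G (a j))" by (simp only: D(5))
      then have "poly F (a i) * poly G (a j) = poly F (a j) * poly G (a i)"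
        using D(3)[of "a i"] D(3)[of "a j"] by (subst (asm) proj_pt_eq_iff) auto
      then show False using N(2)[OF FG(1) ij] by simp
    qed
    ultimately show ?thesis by blast
  qed
  have classes: "f \<in> ramified_maps d n e P" if "C \<in> ramified_map_classes d n e P" "f \<in> C" for C f P
    using that by (auto simp: ramified_map_classes_def quotient_def image_aut_rel_def)
  show ?thesis
    using U(1,2) generic classes by (intro exI[of _ U] conjI ballI) blast+
qed

end
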